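(* Let $x_0\in\mathbb{R}$, $c\in L_\infty(\mathbb{R})$ and $\alpha>0$. Assume $c\ge0$ almost everywhere, $c(x)>0$ for all $x\in(x_0,x_0+\alpha]$, the function $c^{-1}$ is bounded on $(x_0+\varepsilon,x_0+\alpha]$ for all $\varepsilon\in(0,\alpha)$, and $\int_{x_0}^{x_0+\alpha}c^{-1}=\infty$. Let $S^{(0)}$ be the viscosity semigroup on $L_2(\mathbb{R})$ with coefficient $c$. Then \[ S^{(0)}_tL_2(-\infty,x_0)\subseteq L_2(-\infty,x_0)\quad\text{and}\quad S^{(0)}_tL_2(x_0,\infty)\subseteq L_2(x_0,\infty) \] for all $t>0$. In particular the operator $S^{(0)}_t$ is not positivity improving for any $t>0$.
   Context: For a real-valued $c\in L_\infty(\mathbb{R})$ with $c\ge0$ a.e. and $\varepsilon\in(0,1]$, let $H_\varepsilon$ be the positive self-adjoint operator on $L_2(\mathbb{R})$ associated with the closed form $h_\varepsilon(\varphi)=\int_{\mathbb{R}}(c+\varepsilon)|\varphi'|^2$ with domain $W^{1,2}(\mathbb{R})$. As $\varepsilon\downarrow0$, $H_\varepsilon$ converges in the strong resolvent sense to a positive self-adjoint operator $H_0$, the viscosity operator with coefficient $c$ (the rigorous version of $-\frac{d}{dx}c\frac{d}{dx}$); the viscosity semigroup is $S^{(0)}_t=e^{-tH_0}$. For an interval $I$, $L_2(I)$ denotes the functions in $L_2(\mathbb{R})$ vanishing a.e. outside $I$. A bounded operator $S$ on $L_2(\mathbb{R})$ is positivity improving if $S\varphi>0$ almost everywhere whenever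 $\varphi\ge0$ and $\varphi\ne0$. *)

theory Defs
  imports "HOL-Analysis.Analysis" "HOL-Library.Complex_Order"
begin

definition square_integrable :: "(real \<Rightarrow> complex) \<Rightarrow> bool" where
  "square_integrable f \<longleftrightarrow>
     f \<in> borel_measurable lebesgue \<and> integrable lebesgue (\<lambda>x. (cmod (f x))\<^sup>2)"

lemma square_integrable_0: "square_integrable (\<lambda>x. 0)"
  by (simp add: square_integrable_def)

lemma square_integrable_mult_cnj:
  assumes "square_integrable f" "square_integrable g"
  shows "integrable lebesgue (\<lambda>x. f x * cnj (g x))"
proof (rule Bochner_Integration.integrable_bound)
  show "integrable lebesgue (\<lambda>x. (cmod (f x))\<^sup>2 + (cmod (g x))\<^sup>2)"
    using assms by (simp add: square_integrable_def)
  show "(\<lambda>x. f x * cnj (g x)) \<in> borel_measurable lebesgue"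
    using assms unfolding square_integrable_def
    by (intro borel_measurable_times borel_measurable_continuous_on[of cnj] continuous_intros) auto
  have "a * b \<le> a\<^sup>2 + b\<^sup>2" if "a \<ge> 0" "b \<ge> 0" for a b :: real
    using sum_squares_bound[of a b] mult_nonneg_nonneg[OF that] by linarith
  then show "AE x in lebesgue. norm (f x * cnj (g x)) \<le> norm ((cmod (f x))\<^sup>2 + (cmod (g x))\<^sup>2)"
    by (simp add: norm_mult)
qed

lemma square_integrable_scale:
  assumes "square_integrable f"
  shows "square_integrable (\<lambda>x. a * f x)"
  using assms by (auto simp: square_integrable_def norm_mult power_mult_distrib)

lemma square_integrable_add:
  assumes "square_integrable f" "square_integrable g"
  shows "square_integrable (\<lambda>x. f x + g x)"
  unfolding square_integrable_def
proof
  show m: "(\<lambda>x. f x + g x) \<in> borel_measurable lebesgue"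
    using assms by (auto simp: square_integrable_def)
  show "integrable lebesgue (\<lambda>x. (cmod (f x + g x))\<^sup>2)"
  proof (rule Bochner_Integration.integrable_bound)
    show "integrable lebesgue (\<lambda>x. 2 * (cmod (f x))\<^sup>2 + 2 * (cmod (g x))\<^sup>2)"
      using assms by (simp add: square_integrable_def)
    show "(\<lambda>x. (cmod (f x + g x))\<^sup>2) \<in> borel_measurable lebesgue"
      using m by measurable
    have "(cmod (a + b))\<^sup>2 \<le> 2 * (cmod a)\<^sup>2 + 2 * (cmod b)\<^sup>2" for a b
    proof -
      have "(cmod (a + b))\<^sup>2 \<le> (cmod a + cmod b)\<^sup>2"
        by (simp add: norm_triangle_ineq power_mono)
      then show ?thesis
        using sum_squares_bound[of "cmod a" "cmod b"] by (simp add: power2_sum)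
    qed
    then show "AE x in lebesgue. norm ((cmod (f x + g x))\<^sup>2)
        \<le> norm (2 * (cmod (f x))\<^sup>2 + 2 * (cmod (g x))\<^sup>2)"
      by simp
  qed
qed

quotient_type L2 = "real \<Rightarrow> complex" / partial:
  "\<lambda>f g. square_integrable f \<and> square_integrable g \<and> (AE x in lebesgue. f x = g x)"
proof (rule part_equivpI)
  show "\<exists>f. square_integrable f \<and> square_integrable f \<and> (AE x in lebesgue. f x = f x)"
    using square_integrable_0 by auto
  show "symp (\<lambda>f g. square_integrable f \<and> square_integrable g \<and> (AE x in lebesgue. f x = g x))"
    by (auto simp: symp_def elim: eventually_mono)
  show "transp (\<lambda>f g. square_integrable f \<and> square_integrable g \<and> (AE x in lebesgue. f x = g x))"
    by (auto simp: transp_def elim: eventually_elim2)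
qed

lift_definition cinner_L2 :: "L2 \<Rightarrow> L2 \<Rightarrow> complex" is
  "\<lambda>f g. LINT x|lebesgue. f x * cnj (g x)"
  by (rule integral_cong_AE)
    (auto simp: square_integrable_mult_cnj borel_measurable_integrable elim: eventually_elim2)

lift_definition scaleC_L2 :: "complex \<Rightarrow> L2 \<Rightarrow> L2" is "\<lambda>a f x. a * f x"
  by (auto intro: square_integrable_scale)

instantiation L2 :: real_inner
begin

lift_definition zero_L2 :: L2 is "\<lambda>x. 0"
  by (simp add: square_integrable_0)

lift_definition plus_L2 :: "L2 \<Rightarrow> L2 \<Rightarrow> L2" is "\<lambda>f g x. f x + g x"
  by (auto intro: square_integrable_add elim: eventually_elim2)

definition uminus_L2 :: "L2 \<Rightarrow> L2" where "uminus_L2 \<phi> = scaleC_L2 (- 1) \<phi>"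

definition minus_L2 :: "L2 \<Rightarrow> L2 \<Rightarrow> L2" where "minus_L2 \<phi> \<psi> = \<phi> + (- \<psi>)"

definition scaleR_L2 :: "real \<Rightarrow> L2 \<Rightarrow> L2" where "scaleR_L2 r \<phi> = scaleC_L2 (of_real r) \<phi>"

definition inner_L2 :: "L2 \<Rightarrow> L2 \<Rightarrow> real" where "inner_L2 \<phi> \<psi> = Re (cinner_L2 \<phi> \<psi>)"

definition norm_L2 :: "L2 \<Rightarrow> real" where "norm_L2 \<phi> = sqrt (inner \<phi> \<phi>)"

definition sgn_L2 :: "L2 \<Rightarrow> L2" where "sgn_L2 \<phi> = scaleR (inverse (norm \<phi>)) \<phi>"

definition dist_L2 :: "L2 \<Rightarrow> L2 \<Rightarrow> real" where "dist_L2 \<phi> \<psi> = norm (\<phi> - \<psi>)"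

definition uniformity_L2 :: "(L2 \<times> L2) filter" where
  "uniformity_L2 = (INF e\<in>{0 <..}. principal {(\<phi>, \<psi>). dist \<phi> \<psi> < e})"

definition open_L2 :: "L2 set \<Rightarrow> bool" where
  "open_L2 U \<longleftrightarrow> (\<forall>\<phi>\<in>U. eventually (\<lambda>(\<phi>', \<psi>). \<phi>' = \<phi> \<longrightarrow> \<psi> \<in> U) uniformity)"

instance
proof
  fix \<phi> \<psi> \<theta> :: L2 and r s :: real
  show "\<phi> + \<psi> + \<theta> = \<phi> + (\<psi> + \<theta>)"
    by transfer (auto intro!: square_integrable_add simp: add.assoc)
  show "\<phi> + \<psi> = \<psi> + \<phi>"
    by transfer (auto intro!: square_integrable_add simp: add.commute)
  show "0 + \<phi> = \<phi>"
    by transfer (auto)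
  show "- \<phi> + \<phi> = 0"
    unfolding uminus_L2_def
    by transfer (auto intro!: square_integrable_add square_integrable_scale square_integrable_0
      simp: square_integrable_0)
  show "\<phi> - \<psi> = \<phi> + - \<psi>"
    by (fact minus_L2_def)
  show "r *\<^sub>R (\<phi> + \<psi>) = r *\<^sub>R \<phi> + r *\<^sub>R \<psi>"
    unfolding scaleR_L2_def
    by transfer (auto intro!: square_integrable_add square_integrable_scale
      simp: distrib_left distrib_right mult.assoc)
  show "(r + s) *\<^sub>R \<phi> = r *\<^sub>R \<phi> + s *\<^sub>R \<phi>"
    unfolding scaleR_L2_def
    by transfer (auto intro!: square_integrable_add square_integrable_scale
      simp: distrib_left distrib_right mult.assoc)
  show "r *\<^sub>R s *\<^sub>R \<phi> = (r * s) *\<^sub>R \<phi>"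
    unfolding scaleR_L2_def
    by transfer (auto intro!: square_integrable_scale
      simp: distrib_left distrib_right mult.assoc)
  show "1 *\<^sub>R \<phi> = \<phi>"
    unfolding scaleR_L2_def by transfer auto
  show "sgn \<phi> = scaleR (inverse (norm \<phi>)) \<phi>"
    by (fact sgn_L2_def)
  show "dist \<phi> \<psi> = norm (\<phi> - \<psi>)"
    by (fact dist_L2_def)
  show "norm \<phi> = sqrt (inner \<phi> \<phi>)"
    by (fact norm_L2_def)
  show "uniformity = (INF e\<in>{0 <..}. principal {(\<phi>::L2, \<psi>). dist \<phi> \<psi> < e})"
    by (fact uniformity_L2_def)
  show "open U \<longleftrightarrow> (\<forall>\<phi>\<in>U. eventually (\<lambda>(\<phi>', \<psi>). \<phi>' = \<phi> \<longrightarrow> \<psi> \<in> U) uniformity)" for U :: "L2 set"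
    by (fact open_L2_def)
  have *: "cinner_L2 \<phi> \<psi> = cnj (cinner_L2 \<psi> \<phi>)"
    by transfer (simp flip: Bochner_Integration.integral_cnj add: mult.commute)
  then show "inner \<phi> \<psi> = inner \<psi> \<phi>"
    by (simp add: inner_L2_def)
  have "cinner_L2 (\<phi> + \<psi>) \<theta> = cinner_L2 \<phi> \<theta> + cinner_L2 \<psi> \<theta>"
    by transfer (simp add: distrib_right square_integrable_mult_cnj)
  then show "inner (\<phi> + \<psi>) \<theta> = inner \<phi> \<theta> + inner \<psi> \<theta>"
    by (simp add: inner_L2_def)
  have "cinner_L2 (scaleC_L2 a \<phi>) \<psi> = a * cinner_L2 \<phi> \<psi>" for a
    by transfer (simp add: mult.assoc)
  then show "inner (r *\<^sub>R \<phi>) \<psi> = r * inner \<phi> \<psi>"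
    by (simp add: inner_L2_def scaleR_L2_def)
  have **: "inner \<phi> \<phi> \<ge> 0 \<and> (inner \<phi> \<phi> = 0 \<longleftrightarrow> \<phi> = 0)"
    unfolding inner_L2_def
  proof transfer
    fix f :: "real \<Rightarrow> complex"
    assume f: "square_integrable f \<and> square_integrable f \<and> (AE x in lebesgue. f x = f x)"
    then have i: "integrable lebesgue (\<lambda>x. (cmod (f x))\<^sup>2)"
      by (simp add: square_integrable_def)
    have "(LINT x|lebesgue. f x * cnj (f x)) = (LINT x|lebesgue. complex_of_real ((cmod (f x))\<^sup>2))"
      by (simp only: complex_norm_square)
    then have eq: "Re (LINT x|lebesgue. f x * cnj (f x)) = (LINT x|lebesgue. (cmod (f x))\<^sup>2)"
      by (simp only: integral_complex_of_real Re_complex_of_real)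
    show "0 \<le> Re (LINT x|lebesgue. f x * cnj (f x)) \<and>
      (Re (LINT x|lebesgue. f x * cnj (f x)) = 0 \<longleftrightarrow>
        square_integrable f \<and> square_integrable (\<lambda>x. 0) \<and> (AE x in lebesgue. f x = 0))"
      unfolding eq using f integral_nonneg_eq_0_iff_AE[OF i]
      by (auto simp: square_integrable_0)
  qed
  then show "0 \<le> inner \<phi> \<phi>" "inner \<phi> \<phi> = 0 \<longleftrightarrow> \<phi> = 0"
    by auto
qed

end

type_synonym operator = "(L2 \<times> L2) set"

definition adjoint_op :: "operator \<Rightarrow> operator" where
  "adjoint_op H = {(\<phi>, \<psi>). \<forall>(u, v)\<in>H. cinner_L2 v \<phi> = cinner_L2 u \<psi>}"

text \<open>Density of the domain makes the adjoint single-valued, and the adjoint of any relation is a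
  complex-linear subspace; hence a self-adjoint \<open>H\<close> is the graph of a linear operator.\<close>

definition self_adjoint_op :: "operator \<Rightarrow> bool" where
  "self_adjoint_op H \<longleftrightarrow> closure (Domain H) = UNIV \<and> adjoint_op H = H"

definition positive_op :: "operator \<Rightarrow> bool" where
  "positive_op H \<longleftrightarrow> (\<forall>(u, v)\<in>H. 0 \<le> cinner_L2 v u)"

definition resolvent :: "operator \<Rightarrow> real \<Rightarrow> L2 \<Rightarrow> L2" where
  \<comment> \<open>\<open>(\<lambda> I + H)\<^sup>-\<^sup>1\<close>\<close>
  "resolvent H l f = (THE u. (u, f - l *\<^sub>R u) \<in> H)"

definition strong_resolvent_limit :: "(real \<Rightarrow> operator) \<Rightarrow> operator \<Rightarrow> real filter \<Rightarrow> bool" where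
  "strong_resolvent_limit H H0 F \<longleftrightarrow>
     (\<forall>l>0. \<forall>f. ((\<lambda>e. resolvent (H e) l f) \<longlongrightarrow> resolvent H0 l f) F)"

text \<open>Forms are sesquilinear, antilinear in the second argument; a quadratic form stands for its
  polarization.\<close>

definition form_operator :: "L2 set \<Rightarrow> (L2 \<Rightarrow> L2 \<Rightarrow> complex) \<Rightarrow> operator" where
  "form_operator D h = {(\<phi>, \<psi>). \<phi> \<in> D \<and> (\<forall>\<theta>\<in>D. h \<phi> \<theta> = cinner_L2 \<psi> \<theta>)}"

definition C0_semigroup :: "(real \<Rightarrow> L2 \<Rightarrow> L2) \<Rightarrow> bool" where
  "C0_semigroup S \<longleftrightarrow>
     (\<forall>t\<ge>0. bounded_linear (S t) \<and> (\<forall>a \<phi>. S t (scaleC_L2 a \<phi>) = scaleC_L2 a (S t \<phi>))) \<and>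
     (\<forall>\<phi>. S 0 \<phi> = \<phi>) \<and>
     (\<forall>s\<ge>0. \<forall>t\<ge>0. \<forall>\<phi>. S (s + t) \<phi> = S s (S t \<phi>)) \<and>
     (\<forall>\<phi>. ((\<lambda>t. S t \<phi>) \<longlongrightarrow> \<phi>) (at_right 0))"

definition generator :: "(real \<Rightarrow> L2 \<Rightarrow> L2) \<Rightarrow> operator" where
  "generator S = {(\<phi>, \<psi>). ((\<lambda>t. (S t \<phi> - \<phi>) /\<^sub>R t) \<longlongrightarrow> \<psi>) (at_right 0)}"

definition exp_semigroup :: "operator \<Rightarrow> (real \<Rightarrow> L2 \<Rightarrow> L2) \<Rightarrow> bool" where
  \<comment> \<open>\<open>S t = exp (- t H)\<close> for \<open>t \<ge> 0\<close>\<close>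
  "exp_semigroup H S \<longleftrightarrow> C0_semigroup S \<and> generator S = {(\<phi>, - \<psi>) |\<phi> \<psi>. (\<phi>, \<psi>) \<in> H}"

definition test_function :: "(real \<Rightarrow> real) \<Rightarrow> bool" where
  "test_function \<eta> \<longleftrightarrow>
     (\<forall>n. (deriv ^^ n) \<eta> differentiable_on UNIV) \<and> compact (closure {x. \<eta> x \<noteq> 0})"

text \<open>\<open>rep_L2 \<phi>\<close> is an arbitrary representative of the class \<open>\<phi>\<close>; everything below depends on it only
  up to null sets.\<close>

definition weak_derivative :: "L2 \<Rightarrow> L2 \<Rightarrow> bool" where
  "weak_derivative \<phi> \<psi> \<longleftrightarrow> (\<forall>\<eta>. test_function \<eta> \<longrightarrow>
     (LINT x|lebesgue. rep_L2 \<phi> x * of_real (deriv \<eta> x)) =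
       - (LINT x|lebesgue. rep_L2 \<psi> x * of_real (\<eta> x)))"

definition W12 :: "L2 set" where
  "W12 = {\<phi>. \<exists>\<psi>. weak_derivative \<phi> \<psi>}"

definition weak_deriv :: "L2 \<Rightarrow> L2" where
  "weak_deriv \<phi> = (THE \<psi>. weak_derivative \<phi> \<psi>)"

definition Linf :: "(real \<Rightarrow> real) set" where
  "Linf = {c \<in> borel_measurable lebesgue. \<exists>K. AE x in lebesgue. \<bar>c x\<bar> \<le> K}"

text \<open>The sesquilinear form whose quadratic form is \<open>\<phi> \<mapsto> \<integral> a |\<phi>'|\<^sup>2\<close>.\<close>

definition dirichlet_form :: "(real \<Rightarrow> real) \<Rightarrow> L2 \<Rightarrow> L2 \<Rightarrow> complex" where
  "dirichlet_form a \<phi> \<theta> =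
     (LINT x|lebesgue. of_real (a x) * rep_L2 (weak_deriv \<phi>) x * cnj (rep_L2 (weak_deriv \<theta>) x))"

definition viscosity_approx :: "(real \<Rightarrow> real) \<Rightarrow> real \<Rightarrow> operator" where
  "viscosity_approx c \<epsilon> = form_operator W12 (dirichlet_form (\<lambda>x. c x + \<epsilon>))"

definition is_viscosity_operator :: "(real \<Rightarrow> real) \<Rightarrow> operator \<Rightarrow> bool" where
  "is_viscosity_operator c H0 \<longleftrightarrow> self_adjoint_op H0 \<and> positive_op H0 \<and>
     strong_resolvent_limit (viscosity_approx c) H0 (at_right 0)"

definition is_viscosity_semigroup :: "(real \<Rightarrow> real) \<Rightarrow> (real \<Rightarrow> L2 \<Rightarrow> L2) \<Rightarrow> bool" where
  "is_viscosity_semigroup c S \<longleftrightarrow> (\<exists>H0. is_viscosity_operator c H0 \<and> exp_semigroup H0 S)"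

definition L2_on :: "real set \<Rightarrow> L2 set" where
  "L2_on I = {\<phi>. AE x in lebesgue. x \<notin> I \<longrightarrow> rep_L2 \<phi> x = 0}"

text \<open>In the order on the complex numbers, \<open>0 \<le> z\<close> and \<open>0 < z\<close> include that \<open>z\<close> is real.\<close>

definition positivity_improving :: "(L2 \<Rightarrow> L2) \<Rightarrow> bool" where
  "positivity_improving T \<longleftrightarrow>
     (\<forall>\<phi>. (AE x in lebesgue. 0 \<le> rep_L2 \<phi> x) \<and> \<phi> \<noteq> 0 \<longrightarrow> (AE x in lebesgue. 0 < rep_L2 (T \<phi>) x))"

end

theory Submission
  imports Defs "HOL-Computational_Algebra.Polynomial"
begin

text \<open>Let \<open>H\<close> be the viscosity operator and \<open>Q\<close> the multiplication by the indicator of \<open>(x\<^sub>0, \<infinity>)\<close>.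
  The heart of the matter is \<open>0 \<le> Re \<langle>H u, Q u\<rangle> \<le> Re \<langle>H u, u\<rangle>\<close> for \<open>u\<close> in the domain of \<open>H\<close>. It makes
  \<open>\<parallel>Q S\<^sub>t \<phi>\<parallel>\<close> and \<open>\<parallel>(1 - Q) S\<^sub>t \<phi>\<parallel>\<close> nonincreasing in \<open>t\<close>, so that the kernels of \<open>Q\<close> and \<open>1 - Q\<close>
  are invariant.

  To prove it, let \<open>f = u + H u\<close>, \<open>u\<^sub>\<epsilon> = (1 + H\<^sub>\<epsilon>)\<^sup>-\<^sup>1 f \<rightarrow> u\<close> and \<open>v\<^sub>\<epsilon> = f - u\<^sub>\<epsilon> \<rightarrow> H u\<close>, and test the equation of
  \<open>u\<^sub>\<epsilon>\<close> with \<open>m u\<^sub>\<epsilon>\<close> for a cut-off \<open>m\<close> which increases from \<open>0\<close> to \<open>1\<close> on the right of \<open>x\<^sub>0\<close>. This costs an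
  error controlled by \<open>\<integral> (c + \<epsilon>) m'\<^sup>2 |u\<^sub>\<epsilon>|\<^sup>2\<close>. With \<open>s(x) = \<integral>\<^sub>x\<^sup>b 1/c\<close>, the energy bound gives only
  \<open>|u\<^sub>\<epsilon>(x)|\<^sup>2 \<le> C (1 + s(x))\<close>, uniformly in \<open>\<epsilon>\<close>, so \<open>m\<close> is taken logarithmic in \<open>s\<close>, that is
  \<open>m' = 1 / (L c (1 + s))\<close>, which makes the error \<open>C / L\<close>. The normalisation \<open>L\<close> tends to infinity as the
  support of \<open>m'\<close> approaches \<open>x\<^sub>0\<close> because \<open>\<integral> 1/c = \<infinity>\<close>.\<close>

subsection \<open>The space \<open>L2\<close>\<close>

text \<open>A cut-off linear in \<open>s\<close>, with \<open>m' = 1 / (S c)\<close> and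
  \<open>S = s(\<delta>)\<close>, would fail: the growth \<open>C (1 + s)\<close> then bounds the
  error only by \<open>C / S^2\<close> times the integral of \<open>(1 + s) / c\<close>, which tends
  to \<open>C / 2\<close>. The growth itself is that of Cauchy-Schwarz for
  \<open>u' = c^(-1/2) (c^(1/2) u')\<close>. The support of \<open>m'\<close> stays away from
  \<open>x0\<close>, where \<open>1/c\<close> is bounded. Only then does the part \<epsilon>
  \<open>m'^2 |u|^2\<close> of the error vanish with \<epsilon>. So the cut-off is fixed while
  \<epsilon> tends to 0 and is refined afterwards. The cross term is split by Young's inequality
  with a parameter \<tau>, which tends to 0 last because the energy stays merely bounded. The two
  halves of the key inequality come from one argument, applied to \<open>m\<close> and to
  \<open>1 - m\<close>, whose derivatives have the same square. \<open>H\<close> is given only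
  through strong resolvent convergence and \<open>S\<close> only as a C0 semigroup with generator
  \<open>- H\<close>; neither a form for \<open>H\<close> nor contractivity is at hand. Hence the
  approximating resolvents are constructed by projection, and the local bound on \<open>S\<close>
  comes from Baire's theorem.\<close>

lemma square_integrable_rep: "square_integrable (rep_L2 \<phi>)"
  using Quotient3_rep_reflp[OF Quotient3_L2] by blast

lemma rep_L2_measurable [measurable]: "rep_L2 \<phi> \<in> borel_measurable lebesgue"
  using square_integrable_rep[of \<phi>] by (simp add: square_integrable_def)

lemma integrable_norm_rep_sq: "integrable lebesgue (\<lambda>x. (cmod (rep_L2 \<phi> x))\<^sup>2)"
  using square_integrable_rep[of \<phi>] by (simp add: square_integrable_def)

lemma abs_rep_L2: "abs_L2 (rep_L2 \<phi>) = \<phi>"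
  by (rule Quotient3_abs_rep[OF Quotient3_L2])

lemma rep_abs_L2: "square_integrable f \<Longrightarrow> AE x in lebesgue. rep_L2 (abs_L2 f) x = f x"
  using rep_abs_rsp_left[OF Quotient3_L2, of f f] by simp

lemma abs_L2_cong:
  assumes "square_integrable f" "square_integrable g" "AE x in lebesgue. f x = g x"
  shows "abs_L2 f = abs_L2 g"
  using assms Quotient3_rel_abs[OF Quotient3_L2] by blast

lemma L2_eqI: "AE x in lebesgue. rep_L2 \<phi> x = rep_L2 \<psi> x \<Longrightarrow> \<phi> = \<psi>"
  using abs_L2_cong[OF square_integrable_rep square_integrable_rep] by (simp add: abs_rep_L2)

lemma rep_add: "AE x in lebesgue. rep_L2 (\<phi> + \<psi>) x = rep_L2 \<phi> x + rep_L2 \<psi> x"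
proof -
  have "\<phi> + \<psi> = abs_L2 (\<lambda>x. rep_L2 \<phi> x + rep_L2 \<psi> x)"
    using plus_L2.abs_eq[of "rep_L2 \<phi>" "rep_L2 \<psi>"] by (simp add: abs_rep_L2 square_integrable_rep)
  then show ?thesis
    by (simp add: rep_abs_L2 square_integrable_add square_integrable_rep)
qed

lemma rep_scaleC: "AE x in lebesgue. rep_L2 (scaleC_L2 a \<phi>) x = a * rep_L2 \<phi> x"
proof -
  have "scaleC_L2 a \<phi> = abs_L2 (\<lambda>x. a * rep_L2 \<phi> x)"
    using scaleC_L2.abs_eq[of "rep_L2 \<phi>"] by (simp add: abs_rep_L2 square_integrable_rep)
  then show ?thesis
    by (simp add: rep_abs_L2 square_integrable_scale square_integrable_rep)
qed

lemma rep_scaleR: "AE x in lebesgue. rep_L2 (r *\<^sub>R \<phi>) x = of_real r * rep_L2 \<phi> x"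
  unfolding scaleR_L2_def by (rule rep_scaleC)

lemma rep_zero: "AE x in lebesgue. rep_L2 0 x = 0"
  unfolding zero_L2_def by (rule rep_abs_L2[OF square_integrable_0])

lemma rep_diff: "AE x in lebesgue. rep_L2 (\<phi> - \<psi>) x = rep_L2 \<phi> x - rep_L2 \<psi> x"
  using rep_add[of \<phi> "- \<psi>"] rep_scaleC[of "- 1" \<psi>]
  unfolding uminus_L2_def[symmetric] minus_L2_def by eventually_elim simp

lemma cinner_L2_rep: "cinner_L2 \<phi> \<psi> = (LINT x|lebesgue. rep_L2 \<phi> x * cnj (rep_L2 \<psi> x))"
  using cinner_L2.abs_eq[of "rep_L2 \<phi>" "rep_L2 \<psi>"] by (simp add: abs_rep_L2 square_integrable_rep)

lemma integrable_rep_cnj: "integrable lebesgue (\<lambda>x. rep_L2 \<phi> x * cnj (rep_L2 \<psi> x))"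
  by (intro square_integrable_mult_cnj square_integrable_rep)

lemma inner_L2_rep:
  "inner \<phi> \<psi> = (LINT x|lebesgue. Re (rep_L2 \<phi> x * cnj (rep_L2 \<psi> x)))"
  unfolding inner_L2_def cinner_L2_rep by (simp only: integral_Re[OF integrable_rep_cnj])

lemma norm_L2_rep: "(norm \<phi>)\<^sup>2 = (LINT x|lebesgue. (cmod (rep_L2 \<phi> x))\<^sup>2)"
  for \<phi> :: L2
  unfolding power2_norm_eq_inner[of \<phi>] inner_L2_rep by (simp add: complex_mult_cnj cmod_power2)

lemma cinner_commute: "cinner_L2 \<phi> \<psi> = cnj (cinner_L2 \<psi> \<phi>)"
  unfolding cinner_L2_rep by (simp flip: Bochner_Integration.integral_cnj add: mult.commute)

lemma cinner_scaleC_left: "cinner_L2 (scaleC_L2 a \<phi>) \<psi> = a * cinner_L2 \<phi> \<psi>"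
  by transfer (simp add: mult.assoc)

lemma cinner_scaleC_right: "cinner_L2 \<phi> (scaleC_L2 a \<psi>) = cnj a * cinner_L2 \<phi> \<psi>"
  by (metis cinner_commute cinner_scaleC_left complex_cnj_mult)

lemma cinner_add_left: "cinner_L2 (\<phi> + \<psi>) \<theta> = cinner_L2 \<phi> \<theta> + cinner_L2 \<psi> \<theta>"
  by transfer (simp add: distrib_right square_integrable_mult_cnj)

lemma cinner_diff_left: "cinner_L2 (\<phi> - \<psi>) \<theta> = cinner_L2 \<phi> \<theta> - cinner_L2 \<psi> \<theta>"
  by (metis cinner_add_left add_diff_cancel_right' diff_add_cancel)

lemma cinner_scaleR_left: "cinner_L2 (r *\<^sub>R \<phi>) \<psi> = of_real r * cinner_L2 \<phi> \<psi>"
  unfolding scaleR_L2_def by (rule cinner_scaleC_left)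

text \<open>The type class supplies continuity for the real inner product only; this transfers it to
  the complex one, whose imaginary part appears after rotating the antilinear argument by
  \<open>\<i>\<close>.\<close>

lemma cinner_inner: "cinner_L2 \<phi> \<psi> = Complex (inner \<phi> \<psi>) (inner \<phi> (scaleC_L2 \<i> \<psi>))"
  by (simp add: inner_L2_def complex_eq_iff cinner_scaleC_right)

subsection \<open>Multiplication operators\<close>

text \<open>Meaningful for \<open>m\<close> in \<open>Linf\<close>, where the product is again
  square integrable. Real multipliers make the operator symmetric.\<close>

definition mulop :: "(real \<Rightarrow> real) \<Rightarrow> L2 \<Rightarrow> L2" where
  "mulop m \<phi> = abs_L2 (\<lambda>x. of_real (m x) * rep_L2 \<phi> x)"

lemma Linf_measurable: "m \<in> Linf \<Longrightarrow> m \<in> borel_measurable lebesgue"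
  by (simp add: Linf_def)

lemma Linf_bound:
  assumes "m \<in> Linf" obtains K where "K > 0" "AE x in lebesgue. \<bar>m x\<bar> \<le> K"
proof -
  obtain K where "AE x in lebesgue. \<bar>m x\<bar> \<le> K" using assms by (auto simp: Linf_def)
  then have "AE x in lebesgue. \<bar>m x\<bar> \<le> max K 1" by eventually_elim simp
  then show ?thesis using that[of "max K 1"] by simp
qed

lemma square_integrable_mult:
  assumes "m \<in> Linf" "square_integrable f"
  shows "square_integrable (\<lambda>x. of_real (m x) * f x)"
proof -
  obtain K where K: "K > 0" "AE x in lebesgue. \<bar>m x\<bar> \<le> K" using Linf_bound[OF assms(1)] by metis
  have [measurable]: "m \<in> borel_measurable lebesgue" "f \<in> borel_measurable lebesgue"
    using assms by (auto simp: Linf_def square_integrable_def)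
  show ?thesis unfolding square_integrable_def
  proof
    show "integrable lebesgue (\<lambda>x. (cmod (of_real (m x) * f x))\<^sup>2)"
    proof (rule Bochner_Integration.integrable_bound)
      show "integrable lebesgue (\<lambda>x. K\<^sup>2 * (cmod (f x))\<^sup>2)"
        using assms(2) by (simp add: square_integrable_def)
      show "AE x in lebesgue. norm ((cmod (of_real (m x) * f x))\<^sup>2) \<le> norm (K\<^sup>2 * (cmod (f x))\<^sup>2)"
        using K(2)
        by eventually_elim (use K(1) in \<open>auto simp: norm_mult power_mult_distrib intro!: mult_right_mono power2_mono\<close>)
    qed measurable
  qed measurable
qed

lemma rep_mulop:
  "m \<in> Linf \<Longrightarrow> AE x in lebesgue. rep_L2 (mulop m \<phi>) x = of_real (m x) * rep_L2 \<phi> x"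
  unfolding mulop_def by (rule rep_abs_L2) (intro square_integrable_mult square_integrable_rep)

lemma cinner_mulop:
  assumes "m \<in> Linf"
  shows "cinner_L2 (mulop m \<phi>) \<psi> = (LINT x|lebesgue. of_real (m x) * rep_L2 \<phi> x * cnj (rep_L2 \<psi> x))"
proof -
  have [measurable]: "m \<in> borel_measurable lebesgue" using assms by (auto simp: Linf_def)
  have [measurable]: "cnj \<in> borel_measurable borel"
    by (intro borel_measurable_continuous_onI continuous_intros)
  show ?thesis
    unfolding cinner_L2_rep
    by (rule integral_cong_AE) (use rep_mulop[OF assms, of \<phi>] in \<open>auto elim: eventually_mono\<close>)
qed

lemma cinner_mulop_commute:
  assumes "m \<in> Linf"
  shows "cinner_L2 (mulop m \<phi>) \<psi> = cinner_L2 \<phi> (mulop m \<psi>)"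
  by (subst (2) cinner_commute)
    (simp add: cinner_mulop[OF assms] ac_simps flip: Bochner_Integration.integral_cnj)

lemma inner_mulop_commute: "m \<in> Linf \<Longrightarrow> inner (mulop m \<phi>) \<psi> = inner \<phi> (mulop m \<psi>)"
  unfolding inner_L2_def by (simp add: cinner_mulop_commute)

lemma norm_mulop_le:
  assumes "m \<in> Linf" "AE x in lebesgue. \<bar>m x\<bar> \<le> K" "K \<ge> 0"
  shows "norm (mulop m \<phi>) \<le> K * norm \<phi>"
proof (rule power2_le_imp_le)
  have "(norm (mulop m \<phi>))\<^sup>2 \<le> (LINT x|lebesgue. K\<^sup>2 * (cmod (rep_L2 \<phi> x))\<^sup>2)"
    unfolding norm_L2_rep
  proof (rule integral_mono_AE)
    show "AE x in lebesgue. (cmod (rep_L2 (mulop m \<phi>) x))\<^sup>2 \<le> K\<^sup>2 * (cmod (rep_L2 \<phi> x))\<^sup>2"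
      using rep_mulop[OF assms(1), of \<phi>] assms(2)
      by eventually_elim (use assms(3) in \<open>auto simp: norm_mult power_mult_distrib intro!: mult_right_mono power2_mono\<close>)
  qed (simp_all add: integrable_norm_rep_sq)
  then show "(norm (mulop m \<phi>))\<^sup>2 \<le> (K * norm \<phi>)\<^sup>2"
    by (simp add: power_mult_distrib norm_L2_rep[symmetric])
qed (simp add: assms)

lemma bounded_linear_mulop:
  assumes "m \<in> Linf" shows "bounded_linear (mulop m)"
proof -
  obtain K where K: "K > 0" "AE x in lebesgue. \<bar>m x\<bar> \<le> K" using Linf_bound[OF assms(1)] by metis
  show ?thesis
  proof (rule bounded_linear_intro)
    show "mulop m (\<phi> + \<psi>) = mulop m \<phi> + mulop m \<psi>" for \<phi> \<psi>
    proof (rule L2_eqI)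
      show "AE x in lebesgue. rep_L2 (mulop m (\<phi> + \<psi>)) x = rep_L2 (mulop m \<phi> + mulop m \<psi>) x"
        using rep_mulop[OF assms, of "\<phi> + \<psi>"] rep_mulop[OF assms, of "\<phi>"] rep_mulop[OF assms, of "\<psi>"]
          rep_add[of \<phi> \<psi>] rep_add[of "mulop m \<phi>" "mulop m \<psi>"]
        by eventually_elim (simp add: distrib_left)
    qed
    show "mulop m (r *\<^sub>R \<phi>) = r *\<^sub>R mulop m \<phi>" for r \<phi>
    proof (rule L2_eqI)
      show "AE x in lebesgue. rep_L2 (mulop m (r *\<^sub>R \<phi>)) x = rep_L2 (r *\<^sub>R mulop m \<phi>) x"
        using rep_mulop[OF assms, of "r *\<^sub>R \<phi>"] rep_mulop[OF assms, of "\<phi>"]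
          rep_scaleR[of r \<phi>] rep_scaleR[of r "mulop m \<phi>"]
        by eventually_elim simp
    qed
    show "norm (mulop m \<phi>) \<le> norm \<phi> * K" for \<phi>
      using norm_mulop_le[OF assms K(2), of \<phi>] K(1) by (simp add: mult.commute)
  qed
qed

text \<open>Form identities become operator algebra, so integrals are unfolded only where signs
  matter.\<close>

lemma dirichlet_form_mulop:
  "a \<in> Linf \<Longrightarrow> dirichlet_form a \<phi> \<theta> = cinner_L2 (mulop a (weak_deriv \<phi>)) (weak_deriv \<theta>)"
  unfolding dirichlet_form_def by (simp add: cinner_mulop)

subsection \<open>Completeness\<close>

text \<open>Riesz-Fischer. Completeness serves twice: for the projection that yields the resolvents,
  and for Baire's theorem in the bound on the semigroup.\<close>

instance L2 :: banach
proof
  fix X :: "nat \<Rightarrow> L2"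
  assume X: "Cauchy X"
  have "\<forall>k. \<exists>n\<ge>k. \<forall>i\<ge>n. \<forall>j\<ge>n. dist (X i) (X j) < (1/4)^k"
  proof
    fix k
    obtain M where M: "\<forall>i\<ge>M. \<forall>j\<ge>M. dist (X i) (X j) < (1/4)^k"
      using X unfolding Cauchy_def by (metis zero_less_power zero_less_divide_1_iff zero_less_numeral)
    then show "\<exists>n\<ge>k. \<forall>i\<ge>n. \<forall>j\<ge>n. dist (X i) (X j) < (1/4)^k"
      by (intro exI[of _ "max M k"]) auto
  qed
  then obtain N where N: "\<And>k. N k \<ge> k" "\<And>k i j. i \<ge> N k \<Longrightarrow> j \<ge> N k \<Longrightarrow> dist (X i) (X j) < (1/4)^k"
    by metis
  \<comment> \<open>The running maximum makes the chosen indices monotone, so that one bound holds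
    for all later terms.\<close>
  define r where "r k = Max (N ` {..k})" for k
  have rN: "r k \<ge> N k" for k unfolding r_def by (intro Max_ge) auto
  have rmono: "r k \<le> r l" if "k \<le> l" for k l unfolding r_def using that by (intro Max_mono) auto
  define Y where "Y k = X (r k)" for k
  have Y: "norm (Y i - Y j) < (1/4)^k" if "i \<ge> k" "j \<ge> k" for i j k
    using N(2)[of k "r i" "r j"] rN[of k] rmono[OF that(1)] rmono[OF that(2)]
    unfolding Y_def dist_norm by auto
  define d where "d k x = cmod (rep_L2 (Y (Suc k)) x - rep_L2 (Y k) x)" for k x
  have dm[measurable]: "d k \<in> borel_measurable lebesgue" for k
    unfolding d_def by measurable
  have nn_diff: "(\<integral>\<^sup>+x. ennreal ((cmod (rep_L2 \<phi> x - rep_L2 \<psi> x))\<^sup>2) \<partial>lebesgue) = ennreal ((norm (\<phi> - \<psi>))\<^sup>2)"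
    for \<phi> \<psi>
  proof -
    have "(\<integral>\<^sup>+x. ennreal ((cmod (rep_L2 \<phi> x - rep_L2 \<psi> x))\<^sup>2) \<partial>lebesgue) =
      (\<integral>\<^sup>+x. ennreal ((cmod (rep_L2 (\<phi> - \<psi>) x))\<^sup>2) \<partial>lebesgue)"
      by (rule nn_integral_cong_AE) (use rep_diff[of \<phi> \<psi>] in eventually_elim, simp)
    also have "\<dots> = ennreal ((norm (\<phi> - \<psi>))\<^sup>2)"
      unfolding norm_L2_rep by (intro nn_integral_eq_integral integrable_norm_rep_sq) auto
    finally show ?thesis .
  qed
  have "(\<integral>\<^sup>+x. (\<Sum>k. ennreal (4^k * (d k x)\<^sup>2)) \<partial>lebesgue) = (\<Sum>k. \<integral>\<^sup>+x. ennreal (4^k * (d k x)\<^sup>2) \<partial>lebesgue)"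
    by (rule nn_integral_suminf) measurable
  \<comment> \<open>Norms below \<open>(1/4)^k\<close> have squares below \<open>(1/16)^k\<close>,
    which leaves room for the factor \<open>4^k\<close>. Finiteness of the sum at \<open>x\<close>
    then forces \<open>d k x\<close> below \<open>(1/2)^k\<close> eventually, hence pointwise
    convergence.\<close>
  also have "\<dots> \<le> (\<Sum>k. ennreal ((1/4)^k))"
  proof (intro suminf_le allI)
    fix k
    have "(\<integral>\<^sup>+x. ennreal (4^k * (d k x)\<^sup>2) \<partial>lebesgue) = ennreal (4^k) * ennreal ((norm (Y (Suc k) - Y k))\<^sup>2)"
      unfolding nn_diff[symmetric] d_def by (subst nn_integral_cmult[symmetric]) (auto simp: ennreal_mult)
    also have "\<dots> \<le> ennreal (4^k) * ennreal (((1/4)^k)\<^sup>2)"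
      using Y[of k "Suc k" k] by (intro mult_left_mono ennreal_leI power_mono) auto
    also have "\<dots> = ennreal ((1/4)^k)"
      by (simp flip: ennreal_mult add: power2_eq_square power_one_over field_simps)
    finally show "(\<integral>\<^sup>+x. ennreal (4^k * (d k x)\<^sup>2) \<partial>lebesgue) \<le> ennreal ((1/4)^k)" .
  qed auto
  also have "\<dots> < \<infinity>"
    by (subst suminf_ennreal2) (auto intro: summable_geometric)
  finally have fin: "AE x in lebesgue. (\<Sum>k. ennreal (4^k * (d k x)\<^sup>2)) \<noteq> \<infinity>"
    by (intro nn_integral_PInf_AE) auto
  have conv: "AE x in lebesgue. convergent (\<lambda>k. rep_L2 (Y k) x)"
    using fin
  proof eventually_elim
    case (elim x)
    then have "summable (\<lambda>k. 4^k * (d k x)\<^sup>2)"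
      by (intro summable_suminf_not_top) auto
    then have "(\<lambda>k. 4^k * (d k x)\<^sup>2) \<longlonglongrightarrow> 0" by (rule summable_LIMSEQ_zero)
    then have "eventually (\<lambda>k. 4^k * (d k x)\<^sup>2 < 1) sequentially"
      by (rule order_tendstoD) simp
    then have ev: "eventually (\<lambda>k. norm (rep_L2 (Y (Suc k)) x - rep_L2 (Y k) x) \<le> (1/2)^k) sequentially"
    proof eventually_elim
      case (elim k)
      have "(2^k * d k x)\<^sup>2 \<le> 1\<^sup>2" using elim
        by (simp add: power_mult_distrib flip: power_mult power_even_eq) (simp add: mult.commute[of k] power_mult)
      then have "2^k * d k x \<le> 1" by (rule power2_le_imp_le) simp
      then show ?case unfolding d_def by (simp add: field_simps power_one_over)
    qed
    have "summable (\<lambda>k. rep_L2 (Y (Suc k)) x - rep_L2 (Y k) x)"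
      by (rule summable_comparison_test_ev[OF ev]) (intro summable_geometric, simp)
    then have "convergent (\<lambda>n. \<Sum>k<n. rep_L2 (Y (Suc k)) x - rep_L2 (Y k) x)"
      by (simp add: summable_iff_convergent)
    then have "convergent (\<lambda>n. (rep_L2 (Y n) x - rep_L2 (Y 0) x) + rep_L2 (Y 0) x)"
      unfolding sum_lessThan_telescope[of "\<lambda>k. rep_L2 (Y k) x"] by (intro convergent_add convergent_const)
    then show ?case by simp
  qed
  define f where "f x = lim (\<lambda>k. rep_L2 (Y k) x)" for x
  have fm[measurable]: "f \<in> borel_measurable lebesgue"
    unfolding f_def by measurable
  \<comment> \<open>Fatou's lemma in \<open>k\<close> carries the Cauchy bound over to the pointwise
    limit.\<close>
  have fin: "(\<integral>\<^sup>+x. ennreal ((cmod (f x - rep_L2 (Y n) x))\<^sup>2) \<partial>lebesgue) \<le> ennreal (((1/4)^n)\<^sup>2)" for n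
  proof -
    have "(\<integral>\<^sup>+x. ennreal ((cmod (f x - rep_L2 (Y n) x))\<^sup>2) \<partial>lebesgue) =
      (\<integral>\<^sup>+x. liminf (\<lambda>k. ennreal ((cmod (rep_L2 (Y k) x - rep_L2 (Y n) x))\<^sup>2)) \<partial>lebesgue)"
    proof (rule nn_integral_cong_AE)
      show "AE x in lebesgue. ennreal ((cmod (f x - rep_L2 (Y n) x))\<^sup>2) =
        liminf (\<lambda>k. ennreal ((cmod (rep_L2 (Y k) x - rep_L2 (Y n) x))\<^sup>2))"
        using conv
      proof eventually_elim
        case (elim x)
        then have "(\<lambda>k. rep_L2 (Y k) x) \<longlonglongrightarrow> f x"
          unfolding f_def by (simp add: convergent_LIMSEQ_iff)
        then have "(\<lambda>k. ennreal ((cmod (rep_L2 (Y k) x - rep_L2 (Y n) x))\<^sup>2)) \<longlonglongrightarrow> ennreal ((cmod (f x - rep_L2 (Y n) x))\<^sup>2)"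
          by (intro tendsto_intros)
        then show ?case by (intro lim_imp_Liminf[symmetric]) auto
      qed
    qed
    also have "\<dots> \<le> liminf (\<lambda>k. \<integral>\<^sup>+x. ennreal ((cmod (rep_L2 (Y k) x - rep_L2 (Y n) x))\<^sup>2) \<partial>lebesgue)"
      by (rule nn_integral_liminf) measurable
    also have "\<dots> \<le> liminf (\<lambda>k::nat. ennreal (((1/4)^n)\<^sup>2))"
    proof (rule Liminf_mono)
      show "\<forall>\<^sub>F k in sequentially. (\<integral>\<^sup>+x. ennreal ((cmod (rep_L2 (Y k) x - rep_L2 (Y n) x))\<^sup>2) \<partial>lebesgue) \<le> ennreal (((1/4)^n)\<^sup>2)"
        using eventually_ge_at_top[of n]
      proof eventually_elim
        case (elim k)
        then show ?case unfolding nn_diff using Y[of n k n] by (intro ennreal_leI power_mono) auto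
      qed
    qed
    finally show ?thesis by (simp add: Liminf_const)
  qed
  have sq: "square_integrable (\<lambda>x. f x - rep_L2 (Y n) x)" for n
    unfolding square_integrable_def
  proof
    show "integrable lebesgue (\<lambda>x. (cmod (f x - rep_L2 (Y n) x))\<^sup>2)"
      by (rule integrableI_bounded) (use le_less_trans[OF fin[of n]] in auto)
  qed measurable
  have sqf: "square_integrable f"
    using square_integrable_add[OF sq[of 0] square_integrable_rep[of "Y 0"]] by simp
  have lim: "norm (abs_L2 f - Y n) \<le> (1/4)^n" for n
  proof (rule power2_le_imp_le)
    have "ennreal ((norm (abs_L2 f - Y n))\<^sup>2) = (\<integral>\<^sup>+x. ennreal ((cmod (f x - rep_L2 (Y n) x))\<^sup>2) \<partial>lebesgue)"
      unfolding nn_diff[symmetric]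
      by (rule nn_integral_cong_AE) (use rep_abs_L2[OF sqf] in eventually_elim, simp)
    then show "(norm (abs_L2 f - Y n))\<^sup>2 \<le> ((1/4)^n)\<^sup>2"
      using fin[of n] by (metis ennreal_le_iff zero_le_power2)
  qed simp
  have "X \<longlonglongrightarrow> abs_L2 f"
  proof (rule metric_LIMSEQ_I)
    fix e :: real assume "e > 0"
    then obtain k where k: "(1/4::real)^k < e/2" using real_arch_pow_inv[of "e/2" "1/4"] by auto
    show "\<exists>no. \<forall>n\<ge>no. dist (X n) (abs_L2 f) < e"
    proof (intro exI allI impI)
      fix n assume "n \<ge> r k"
      then have "dist (X n) (Y k) < (1/4)^k" unfolding Y_def using N(2)[of k n "r k"] rN[of k] by auto
      moreover have "dist (Y k) (abs_L2 f) \<le> (1/4)^k" using lim[of k] by (simp add: dist_norm norm_minus_commute)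
      ultimately show "dist (X n) (abs_L2 f) < e" using k dist_triangle[of "X n" "abs_L2 f" "Y k"] by linarith
    qed
  qed
  then show "convergent X" by (auto simp: convergent_def)
qed

subsection \<open>Orthogonal projection\<close>

text \<open>A minimising sequence is Cauchy by the parallelogram law. This takes the place of
  Lax-Milgram when the resolvent equations are solved.\<close>

lemma orthogonal_projection_exists:
  fixes V :: "'a::{real_inner, complete_space} set"
  assumes V: "subspace V" "closed V"
  shows "\<exists>y\<in>V. \<forall>v\<in>V. inner (x - y) v = 0"
proof -
  let ?A = "(\<lambda>v. (norm (x - v))\<^sup>2) ` V"
  define D where "D = Inf ?A"
  have D: "D \<le> (norm (x - v))\<^sup>2" if "v \<in> V" for v
    unfolding D_def using that by (intro cInf_lower bdd_belowI2[where m = 0]) auto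
  have "\<exists>v\<in>V. (norm (x - v))\<^sup>2 < D + inverse (real (Suc n))" for n
    using cInf_lessD[of ?A "D + inverse (real (Suc n))"] subspace_0[OF V(1)]
    unfolding D_def by fastforce
  then obtain y where y: "\<And>n. y n \<in> V" "\<And>n. (norm (x - y n))\<^sup>2 < D + inverse (real (Suc n))"
    by metis
  have par: "(norm (y n - y m))\<^sup>2 \<le> 2 * inverse (real (Suc n)) + 2 * inverse (real (Suc m))" for n m
  proof -
    have "(1/2) *\<^sub>R (y n + y m) \<in> V" using y(1) V(1) by (intro subspace_scale subspace_add)
    then have "D \<le> (norm (x - (1/2) *\<^sub>R (y n + y m)))\<^sup>2" by (rule D)
    moreover have "(norm (y n - y m))\<^sup>2 + 4 * (norm (x - (1/2) *\<^sub>R (y n + y m)))\<^sup>2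
       = 2 * (norm (x - y n))\<^sup>2 + 2 * (norm (x - y m))\<^sup>2"
      by (simp add: power2_norm_eq_inner algebra_simps inner_commute)
    ultimately show ?thesis using y(2)[of n] y(2)[of m] by linarith
  qed
  have "Cauchy y"
  proof (rule metric_CauchyI)
    fix e :: real assume e: "e > 0"
    then have "e\<^sup>2/4 > 0" by simp
    then obtain N where N: "inverse (real (Suc N)) < e\<^sup>2/4" using reals_Archimedean by blast
    show "\<exists>M. \<forall>m\<ge>M. \<forall>n\<ge>M. dist (y m) (y n) < e"
    proof (intro exI allI impI)
      fix m n assume "m \<ge> N" "n \<ge> N"
      then have "inverse (real (Suc m)) \<le> inverse (real (Suc N))" "inverse (real (Suc n)) \<le> inverse (real (Suc N))"
        by (auto intro!: le_imp_inverse_le)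
      then have "(norm (y m - y n))\<^sup>2 < e\<^sup>2" using par[of m n] N by linarith
      then show "dist (y m) (y n) < e" unfolding dist_norm using e power_less_imp_less_base by fastforce
    qed
  qed
  then obtain z where z: "y \<longlonglongrightarrow> z" by (metis Cauchy_convergent convergent_def)
  have "z \<in> V" using V(2) y(1) z by (auto intro: closed_sequentially)
  have "(\<lambda>n. D + inverse (real (Suc n))) \<longlonglongrightarrow> D + 0"
    by (intro tendsto_add tendsto_const LIMSEQ_inverse_real_of_nat)
  moreover have "(\<lambda>n. (norm (x - y n))\<^sup>2) \<longlonglongrightarrow> (norm (x - z))\<^sup>2"
    by (intro tendsto_intros z)
  ultimately have Dz: "(norm (x - z))\<^sup>2 \<le> D"
    using y(2) by (intro LIMSEQ_le[of _ _ "\<lambda>n. D + inverse (real (Suc n))"]) (auto intro!: exI[of _ 0] less_imp_le)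
  have "inner (x - z) v = 0" if "v \<in> V" for v
  proof (rule ccontr)
    assume a: "inner (x - z) v \<noteq> 0"
    then have n: "norm v > 0" by auto
    \<comment> \<open>The minimiser of the quadratic polynomial \<open>t\<close> to
      \<open>(norm (x - z - t v))^2\<close>; it would beat the infimum \<open>D\<close>.\<close>
    define t where "t = inner (x - z) v / (norm v)\<^sup>2"
    have "z + t *\<^sub>R v \<in> V" using \<open>z \<in> V\<close> that V(1) by (intro subspace_scale subspace_add)
    then have "D \<le> (norm (x - (z + t *\<^sub>R v)))\<^sup>2" by (rule D)
    also have "\<dots> = (norm (x - z))\<^sup>2 - 2 * t * inner (x - z) v + t\<^sup>2 * (norm v)\<^sup>2"
      unfolding power2_norm_eq_inner by (simp add: algebra_simps inner_commute power2_eq_square)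
    also have "\<dots> = (norm (x - z))\<^sup>2 - (inner (x - z) v)\<^sup>2 / (norm v)\<^sup>2"
      using n by (simp add: t_def field_simps power2_eq_square)
    finally show False using Dz a n by (smt (verit) divide_pos_pos zero_less_power2 zero_less_power)
  qed
  with \<open>z \<in> V\<close> show ?thesis by auto
qed

subsection \<open>Semigroups\<close>

text \<open>Each orbit is bounded on a time interval that depends on its starting point. The closed
  sets \<open>A n\<close> tie the bound \<open>n\<close> to the time \<open>1 / (n + 1)\<close>, so
  a single Baire argument makes both uniform.\<close>

lemma C0_locally_bounded:
  fixes S :: "real \<Rightarrow> 'a::banach \<Rightarrow> 'a"
  assumes lin: "\<And>t. t \<ge> 0 \<Longrightarrow> bounded_linear (S t)"
    and zero: "\<And>\<phi>. S 0 \<phi> = \<phi>"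
    and cont: "\<And>\<phi>. ((\<lambda>t. S t \<phi>) \<longlongrightarrow> \<phi>) (at_right 0)"
  shows "\<exists>M\<ge>0. \<exists>\<delta>>0. \<forall>t\<in>{0..\<delta>}. \<forall>\<phi>. norm (S t \<phi>) \<le> M * norm \<phi>"
proof -
  define A where "A n = {\<phi>. \<forall>t\<in>{0..inverse (real (Suc n))}. norm (S t \<phi>) \<le> real n}" for n
  have cl: "closed (A n)" for n
  proof -
    have "A n = (\<Inter>t\<in>{0..inverse (real (Suc n))}. {\<phi>. norm (S t \<phi>) \<le> real n})"
      by (auto simp: A_def)
    also have "closed \<dots>"
      using lin by (intro closed_INT ballI closed_Collect_le continuous_intros)
        (auto intro!: linear_continuous_on)
    finally show ?thesis .
  qed
  have cover: "\<exists>n. \<phi> \<in> A n" for \<phi>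
  proof -
    have "eventually (\<lambda>t. norm (S t \<phi>) < norm \<phi> + 1) (at_right 0)"
      by (rule order_tendstoD(2)[OF tendsto_norm[OF cont]]) simp
    then obtain b where b: "b > 0" "\<And>t. 0 < t \<Longrightarrow> t < b \<Longrightarrow> norm (S t \<phi>) < norm \<phi> + 1"
      unfolding eventually_at_right_field by auto
    obtain m where m: "inverse (real (Suc m)) < b" using reals_Archimedean[OF b(1)] by blast
    obtain k where k: "norm \<phi> + 1 < real k" using reals_Archimedean2 by blast
    have "\<phi> \<in> A (max m k)"
      unfolding A_def mem_Collect_eq
    proof
      fix t assume t: "t \<in> {0..inverse (real (Suc (max m k)))}"
      moreover have "inverse (real (Suc (max m k))) \<le> inverse (real (Suc m))"
        by (intro le_imp_inverse_le) auto
      ultimately have "t < b" using m unfolding atLeastAtMost_iff by linarith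
      then have "norm (S t \<phi>) \<le> norm \<phi> + 1"
        using b(2)[of t] t zero[of \<phi>] by (cases "t = 0") (auto intro: less_imp_le)
      then show "norm (S t \<phi>) \<le> real (max m k)" using k by simp
    qed
    then show ?thesis by blast
  qed
  have "\<exists>n. interior (A n) \<noteq> {}"
  proof (rule ccontr)
    assume "\<not> ?thesis"
    then have int: "interior (A n) = {}" for n by auto
    have "euclidean interior_of \<Union>(range A) = {}"
      by (rule Baire_category_alt)
        (use cl int in \<open>auto simp: completely_metrizable_space_euclidean\<close>)
    moreover have "\<Union>(range A) = UNIV" using cover by auto
    ultimately show False by simp
  qed
  then obtain n \<phi>0 e where e: "e > 0" "ball \<phi>0 e \<subseteq> A n"
    by (metis all_not_in_conv mem_interior)
  \<comment> \<open>A vector of norm \<open>e / 2\<close> is a difference of two points of the ball,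
    so its image has norm at most \<open>2 n\<close>; rescaling gives
    \<open>4 n / e\<close>.\<close>
  define M where "M = 4 * real n / e"
  have "norm (S t \<phi>) \<le> M * norm \<phi>" if t: "t \<in> {0..inverse (real (Suc n))}" for t \<phi>
  proof (cases "\<phi> = 0")
    case True then show ?thesis using lin[of t] t by (simp add: linear_simps)
  next
    case False
    interpret bounded_linear "S t" using lin t by simp
    define \<psi> where "\<psi> = (e / (2 * norm \<phi>)) *\<^sub>R \<phi>"
    have "\<phi>0 \<in> ball \<phi>0 e" "\<phi>0 + \<psi> \<in> ball \<phi>0 e" using e(1) False by (auto simp: \<psi>_def dist_norm)
    then have *: "norm (S t \<phi>0) \<le> real n" "norm (S t (\<phi>0 + \<psi>)) \<le> real n"
      using e(2) t unfolding A_def by blast+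
    have "norm (S t \<psi>) = norm (S t (\<phi>0 + \<psi>) - S t \<phi>0)" by (simp add: add)
    also have "\<dots> \<le> 2 * real n" using norm_triangle_ineq4[of "S t (\<phi>0 + \<psi>)" "S t \<phi>0"] * by linarith
    finally have "e / (2 * norm \<phi>) * norm (S t \<phi>) \<le> 2 * real n" using e(1) False by (simp add: \<psi>_def scaleR)
    then show ?thesis using e(1) False by (simp add: M_def field_simps)
  qed
  then show ?thesis using e(1)
    by (intro exI[of _ M] conjI exI[of _ "inverse (real (Suc n))"] ballI allI) (auto simp: M_def)
qed

text \<open>The semigroup law multiplies the bound by \<open>M\<close> for each further step of
  length \<delta>; \<open>M\<close> is at least 1 so that the powers increase.\<close>

lemma semigroup_bounded:
  fixes S :: "real \<Rightarrow> 'a::banach \<Rightarrow> 'a"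
  assumes lin: "\<And>t. t \<ge> 0 \<Longrightarrow> bounded_linear (S t)"
    and zero: "\<And>\<phi>. S 0 \<phi> = \<phi>"
    and cont: "\<And>\<phi>. ((\<lambda>t. S t \<phi>) \<longlongrightarrow> \<phi>) (at_right 0)"
    and semi: "\<And>s t \<phi>. s \<ge> 0 \<Longrightarrow> t \<ge> 0 \<Longrightarrow> S (s + t) \<phi> = S s (S t \<phi>)"
  shows "\<exists>M\<ge>1. \<forall>t\<in>{0..T}. \<forall>\<phi>. norm (S t \<phi>) \<le> M * norm \<phi>"
proof -
  obtain M0 \<delta> where "M0 \<ge> 0" and \<delta>: "\<delta> > 0" and M0: "\<And>t \<phi>. t \<in> {0..\<delta>} \<Longrightarrow> norm (S t \<phi>) \<le> M0 * norm \<phi>"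
    using C0_locally_bounded[OF lin zero cont] by metis
  define M where "M = max M0 1"
  have M: "M \<ge> 1" "\<And>t \<phi>. t \<in> {0..\<delta>} \<Longrightarrow> norm (S t \<phi>) \<le> M * norm \<phi>"
    unfolding M_def using M0 order_trans[OF M0 mult_right_mono[of M0 "max M0 1"]] by simp_all
  have *: "\<forall>t\<in>{0..real n * \<delta>}. \<forall>\<phi>. norm (S t \<phi>) \<le> M^n * norm \<phi>" for n
  proof (induction n)
    case 0 then show ?case by (simp add: zero)
  next
    case (Suc n)
    show ?case
    proof (intro ballI allI)
      fix t \<phi> assume t: "t \<in> {0..real (Suc n) * \<delta>}"
      show "norm (S t \<phi>) \<le> M ^ Suc n * norm \<phi>"
      proof (cases "t \<le> \<delta>")
        case True
        then have "norm (S t \<phi>) \<le> M * norm \<phi>" using M(2) t by simp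
        also have "\<dots> \<le> M ^ Suc n * norm \<phi>" using M(1) one_le_power[of M n] by (intro mult_right_mono) auto
        finally show ?thesis .
      next
        case False
        then have "S t \<phi> = S \<delta> (S (t - \<delta>) \<phi>)" using semi[of \<delta> "t - \<delta>" \<phi>] \<delta> by simp
        also have "norm \<dots> \<le> M * norm (S (t - \<delta>) \<phi>)" using M(2) \<delta> by simp
        also have "\<dots> \<le> M * (M ^ n * norm \<phi>)"
          using Suc t False M(1) by (intro mult_left_mono) (auto simp: algebra_simps)
        finally show ?thesis by simp
      qed
    qed
  qed
  obtain n where "T / \<delta> < real n" using reals_Archimedean2 by blast
  then have "T \<le> real n * \<delta>" using \<delta> by (simp add: field_simps)
  then show ?thesis using *[of n] M(1) by (intro exI[of _ "M^n"]) auto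
qed

text \<open>The orbit of a point of the domain satisfies \<open>d/dt \<parallel>Q S\<^sub>t \<phi>\<parallel>\<^sup>2 \<le> 0\<close>. Only the derivative at
  \<open>0\<close> is available, so it is integrated by Euler steps, whose error is uniform on bounded time intervals.\<close>

lemma norm_semigroup_decreasing_on_domain:
  fixes S :: "real \<Rightarrow> 'a::{banach,real_inner} \<Rightarrow> 'a"
  assumes lin: "\<And>t. t \<ge> 0 \<Longrightarrow> bounded_linear (S t)"
    and zero: "\<And>\<phi>. S 0 \<phi> = \<phi>"
    and cont: "\<And>\<phi>. ((\<lambda>t. S t \<phi>) \<longlongrightarrow> \<phi>) (at_right 0)"
    and semi: "\<And>s t \<phi>. s \<ge> 0 \<Longrightarrow> t \<ge> 0 \<Longrightarrow> S (s + t) \<phi> = S s (S t \<phi>)"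
    and Q: "bounded_linear Q"
    and dissipative: "\<And>t. t \<ge> 0 \<Longrightarrow> inner (Q (S t \<phi>)) (Q (S t \<psi>)) \<le> 0"
    and gen: "((\<lambda>t. (S t \<phi> - \<phi>) /\<^sub>R t) \<longlongrightarrow> \<psi>) (at_right 0)"
    and T: "T > 0"
  shows "norm (Q (S T \<phi>)) \<le> norm (Q \<phi>)"
proof -
  obtain M where M: "M \<ge> 1" "\<And>t \<phi>. t \<in> {0..T} \<Longrightarrow> norm (S t \<phi>) \<le> M * norm \<phi>"
    using semigroup_bounded[OF lin zero cont semi] by metis
  obtain B where B: "B > 0" "\<And>\<phi>. norm (Q \<phi>) \<le> norm \<phi> * B" using bounded_linear.pos_bounded[OF Q] by blast
  define K where "K = B * M"
  have K: "K > 0" using B M by (simp add: K_def)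
  have QS: "norm (Q (S t \<phi>)) \<le> K * norm \<phi>" if "t \<in> {0..T}" for t \<phi>
  proof -
    have "norm (Q (S t \<phi>)) \<le> norm (S t \<phi>) * B" by (rule B(2))
    also have "\<dots> \<le> (M * norm \<phi>) * B" using M(2)[OF that] B(1) by (intro mult_right_mono) auto
    finally show ?thesis by (simp add: K_def ac_simps)
  qed
  define g where "g t = (norm (Q (S t \<phi>)))\<^sup>2" for t
  have main: "g T \<le> g 0 + T * (2 * K\<^sup>2 * norm \<phi> * e + e * K\<^sup>2 * (norm \<psi> + e)\<^sup>2)" if e: "e > 0" for e
  proof -
    have "eventually (\<lambda>t. dist ((S t \<phi> - \<phi>) /\<^sub>R t) \<psi> < e) (at_right 0)"
      using gen e by (rule tendstoD)
    then obtain b where b: "b > 0" "\<And>h. 0 < h \<Longrightarrow> h < b \<Longrightarrow> dist ((S h \<phi> - \<phi>) /\<^sub>R h) \<psi> < e"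
      unfolding eventually_at_right_field by auto
    \<comment> \<open>The step \<open>T / n\<close> must be below \<open>b\<close> for the
      difference quotient to be close to its limit, and below \<open>e\<close> so that terms of
      order \<open>h * h\<close> are absorbed into \<open>h * e\<close>.\<close>
    obtain n where n: "T / min b e < real n" using reals_Archimedean2 by blast
    have "0 < T / min b e" using T b e by simp
    then have n0: "real n > 0" using n by linarith
    define h where "h = T / real n"
    have "h > 0" using T n0 by (simp add: h_def)
    moreover have "h < min b e"
      using n b(1) e n0 unfolding h_def by (metis min_less_iff_conj mult.commute pos_divide_less_eq)
    ultimately have h: "h > 0" "h < b" "h < e" by auto
    define r where "r = S h \<phi> - \<phi> - h *\<^sub>R \<psi>"
    have r: "norm r \<le> h * e"
    proof -
      have "r = h *\<^sub>R ((S h \<phi> - \<phi>) /\<^sub>R h - \<psi>)" using h by (simp add: r_def scaleR_diff_right)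
      then have "norm r = h * norm ((S h \<phi> - \<phi>) /\<^sub>R h - \<psi>)" using h by simp
      also have "\<dots> \<le> h * e" using b(2)[OF h(1,2)] h(1) by (intro mult_left_mono) (auto simp: dist_norm)
      finally show ?thesis .
    qed
    \<comment> \<open>The same remainder \<open>r\<close> serves every \<open>t\<close>, because the
      semigroup law writes the next point as \<open>S t\<close> applied to the first Euler step. The
      bound \<open>K\<close> then makes the error uniform in \<open>t\<close>.\<close>
    have step: "g (t + h) \<le> g t + h * (2 * K\<^sup>2 * norm \<phi> * e + e * K\<^sup>2 * (norm \<psi> + e)\<^sup>2)" if t: "t \<in> {0..T}" for t
    proof -
      interpret S: bounded_linear "S t" using lin t by simp
      interpret Q: bounded_linear Q by (rule Q)
      have "S (t + h) \<phi> = S t (\<phi> + h *\<^sub>R \<psi> + r)" using semi[of t h \<phi>] t h by (simp add: r_def)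
      then have eq: "Q (S (t + h) \<phi>) = Q (S t \<phi>) + (h *\<^sub>R Q (S t \<psi>) + Q (S t r))"
        by (simp add: S.add S.scaleR Q.add Q.scaleR)
      have "g (t + h) = g t + 2 * h * inner (Q (S t \<phi>)) (Q (S t \<psi>)) + 2 * inner (Q (S t \<phi>)) (Q (S t r))
          + (norm (h *\<^sub>R Q (S t \<psi>) + Q (S t r)))\<^sup>2"
        unfolding g_def eq dot_norm[of "Q (S t \<phi>)"] by (simp add: power2_norm_eq_inner inner_simps inner_commute field_simps)
      moreover have "2 * h * inner (Q (S t \<phi>)) (Q (S t \<psi>)) \<le> 0"
        using dissipative[of t] t h(1) by (simp add: mult_nonneg_nonpos)
      moreover have "inner (Q (S t \<phi>)) (Q (S t r)) \<le> (K * norm \<phi>) * (K * (h * e))"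
      proof -
        have "inner (Q (S t \<phi>)) (Q (S t r)) \<le> norm (Q (S t \<phi>)) * norm (Q (S t r))" by (rule norm_cauchy_schwarz)
        also have "\<dots> \<le> (K * norm \<phi>) * (K * (h * e))"
          using QS[OF t, of \<phi>] order_trans[OF QS[OF t, of r] mult_left_mono[OF r]] K by (intro mult_mono) auto
        finally show ?thesis .
      qed
      moreover have "(norm (h *\<^sub>R Q (S t \<psi>) + Q (S t r)))\<^sup>2 \<le> h * e * K\<^sup>2 * (norm \<psi> + e)\<^sup>2"
      proof -
        have "norm (h *\<^sub>R Q (S t \<psi>) + Q (S t r)) \<le> h * norm (Q (S t \<psi>)) + norm (Q (S t r))"
          using norm_triangle_ineq[of "h *\<^sub>R Q (S t \<psi>)" "Q (S t r)"] h(1) by simp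
        also have "\<dots> \<le> h * (K * norm \<psi>) + K * (h * e)"
          using QS[OF t, of \<psi>] order_trans[OF QS[OF t, of r] mult_left_mono[OF r]] K h(1)
          by (intro add_mono mult_left_mono) auto
        also have "\<dots> = h * K * (norm \<psi> + e)" by (simp add: algebra_simps)
        finally have "(norm (h *\<^sub>R Q (S t \<psi>) + Q (S t r)))\<^sup>2 \<le> (h * K * (norm \<psi> + e))\<^sup>2" by (intro power_mono) auto
        also have "\<dots> = h * h * K\<^sup>2 * (norm \<psi> + e)\<^sup>2" by (simp add: power2_eq_square)
        also have "\<dots> \<le> h * e * K\<^sup>2 * (norm \<psi> + e)\<^sup>2" using h by (intro mult_right_mono mult_left_mono) auto
        finally show ?thesis .
      qed
      ultimately show ?thesis by (simp add: algebra_simps power2_eq_square)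
    qed
    have "g (real k * h) \<le> g 0 + real k * (h * (2 * K\<^sup>2 * norm \<phi> * e + e * K\<^sup>2 * (norm \<psi> + e)\<^sup>2))" if "k \<le> n" for k
      using that
    proof (induction k)
      case (Suc k)
      have "real k * h \<le> real n * h" using Suc.prems h(1) by (intro mult_right_mono) auto
      moreover have "real n * h = T" using n0 by (simp add: h_def)
      ultimately have "real k * h \<in> {0..T}" using h(1) by simp
      from step[OF this] Suc show ?case by (simp add: algebra_simps)
    qed simp
    from this[of n] show ?thesis using n0 by (simp add: h_def)
  qed
  have "((\<lambda>e. g 0 + T * (2 * K\<^sup>2 * norm \<phi> * e + e * K\<^sup>2 * (norm \<psi> + e)\<^sup>2)) \<longlongrightarrow>
      g 0 + T * (2 * K\<^sup>2 * norm \<phi> * 0 + 0 * K\<^sup>2 * (norm \<psi> + 0)\<^sup>2)) (at_right 0)"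
    by (intro tendsto_intros)
  then have "g T \<le> g 0 + T * (2 * K\<^sup>2 * norm \<phi> * 0 + 0 * K\<^sup>2 * (norm \<psi> + 0)\<^sup>2)"
    by (rule tendsto_lowerbound) (rule eventually_at_rightI[of 0 1], rule main, simp_all)
  then have "(norm (Q (S T \<phi>)))\<^sup>2 \<le> (norm (Q \<phi>))\<^sup>2" by (simp add: g_def zero)
  then show ?thesis by (rule power2_le_imp_le) simp
qed

text \<open>Applying \<open>S t\<close> to the difference quotient shows that the orbit stays in the
  domain and that the generator commutes with \<open>S t\<close>, so \<open>pos\<close> holds along
  the orbit. Density and continuity of \<open>S T\<close> extend the inequality to the whole
  space.\<close>

lemma exp_semigroup_norm_le:
  assumes S: "exp_semigroup H S" and dense: "closure (Domain H) = UNIV" and Q: "bounded_linear Q"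
    and pos: "\<And>u v. (u, v) \<in> H \<Longrightarrow> inner (Q v) (Q u) \<ge> 0" and T: "T > 0"
  shows "norm (Q (S T \<phi>)) \<le> norm (Q \<phi>)"
proof -
  have C0: "C0_semigroup S" and gen: "generator S = {(\<phi>, - \<psi>) |\<phi> \<psi>. (\<phi>, \<psi>) \<in> H}"
    using S by (auto simp: exp_semigroup_def)
  have lin: "\<And>t. t \<ge> 0 \<Longrightarrow> bounded_linear (S t)"
    and zero: "\<And>\<phi>. S 0 \<phi> = \<phi>"
    and cont: "\<And>\<phi>. ((\<lambda>t. S t \<phi>) \<longlongrightarrow> \<phi>) (at_right 0)"
    and semi: "\<And>s t \<phi>. s \<ge> 0 \<Longrightarrow> t \<ge> 0 \<Longrightarrow> S (s + t) \<phi> = S s (S t \<phi>)"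
    using C0 unfolding C0_semigroup_def by blast+
  let ?C = "{\<phi>. norm (Q (S T \<phi>)) \<le> norm (Q \<phi>)}"
  have "Domain H \<subseteq> ?C"
  proof
    fix \<phi> assume "\<phi> \<in> Domain H"
    then obtain \<psi> where "(\<phi>, \<psi>) \<in> H" by auto
    then have g: "((\<lambda>t. (S t \<phi> - \<phi>) /\<^sub>R t) \<longlongrightarrow> - \<psi>) (at_right 0)"
      using gen by (auto simp: generator_def)
    have "inner (Q (S t \<phi>)) (Q (S t (- \<psi>))) \<le> 0" if t: "t \<ge> 0" for t
    proof -
      interpret S: bounded_linear "S t" using lin t by simp
      interpret Q: bounded_linear Q by (rule Q)
      have "((\<lambda>h. S t ((S h \<phi> - \<phi>) /\<^sub>R h)) \<longlongrightarrow> S t (- \<psi>)) (at_right 0)"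
        by (rule S.tendsto[OF g])
      then have "((\<lambda>h. (S h (S t \<phi>) - S t \<phi>) /\<^sub>R h) \<longlongrightarrow> S t (- \<psi>)) (at_right 0)"
      proof (rule Lim_transform_eventually)
        show "\<forall>\<^sub>F h in at_right 0. S t ((S h \<phi> - \<phi>) /\<^sub>R h) = (S h (S t \<phi>) - S t \<phi>) /\<^sub>R h"
        proof (rule eventually_at_rightI[of 0 1])
          fix h :: real assume "h \<in> {0<..<1}"
          then have "S h (S t \<phi>) = S t (S h \<phi>)" using semi[of h t \<phi>] semi[of t h \<phi>] t by (simp add: add.commute)
          then show "S t ((S h \<phi> - \<phi>) /\<^sub>R h) = (S h (S t \<phi>) - S t \<phi>) /\<^sub>R h" by (simp add: S.scaleR S.diff)
        qed simp
      qed
      then have "(S t \<phi>, S t (- \<psi>)) \<in> generator S" by (simp add: generator_def)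
      then have "(S t \<phi>, S t \<psi>) \<in> H" unfolding gen by (auto simp: S.neg)
      then show ?thesis using pos by (simp add: S.neg Q.neg inner_commute)
    qed
    then show "\<phi> \<in> ?C"
      using norm_semigroup_decreasing_on_domain[OF lin zero cont semi Q _ g T] by blast
  qed
  moreover have "closed ?C"
    using linear_continuous_on[OF bounded_linear_compose[OF Q lin[OF less_imp_le[OF T]]]] linear_continuous_on[OF Q]
    by (intro closed_Collect_le continuous_intros) auto
  ultimately have "closure (Domain H) \<subseteq> ?C" by (rule closure_minimal)
  then show ?thesis using dense by auto
qed

subsection \<open>Primitives\<close>

definition locally_integrable :: "(real \<Rightarrow> complex) \<Rightarrow> bool" where
  "locally_integrable f \<longleftrightarrow> (\<forall>a b. f absolutely_integrable_on {a..b})"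

text \<open>Local absolute continuity of \<open>F\<close> with derivative \<open>f\<close>, stated
  through integrals so that no pointwise differentiation enters.\<close>

definition primitive :: "(real \<Rightarrow> complex) \<Rightarrow> (real \<Rightarrow> complex) \<Rightarrow> bool" where
  "primitive F f \<longleftrightarrow> locally_integrable f \<and> (\<forall>a b. a \<le> b \<longrightarrow> F b - F a = integral {a..b} f)"

lemma locally_integrable_integrable: "locally_integrable f \<Longrightarrow> f integrable_on {a..b}"
  by (auto simp: locally_integrable_def intro: absolutely_integrable_on_def[THEN iffD1, THEN conjunct1])

lemma primitive_exists:
  assumes "locally_integrable f" shows "\<exists>F. primitive F f"
proof -
  \<comment> \<open>For \<open>x\<close> other than 0 one of the two intervals is empty, and its
    integral is 0.\<close>
  define F where "F x = integral {0..x} f - integral {x..0} f" for x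
  have *: "integral {a..c} f + integral {c..b} f = integral {a..b} f" if "a \<le> c" "c \<le> b" for a b c
    using that locally_integrable_integrable[OF assms] by (intro Henstock_Kurzweil_Integration.integral_combine)
  have "F b - F a = integral {a..b} f" if "a \<le> b" for a b
  proof -
    consider "0 \<le> a" | "a \<le> 0" "0 \<le> b" | "b \<le> 0" by linarith
    then show ?thesis
    proof cases
      case 1 then show ?thesis using that *[of 0 a b] by (cases "a = 0"; cases "b = 0") (auto simp: F_def algebra_simps)
    next
      case 2 then show ?thesis using that *[of a 0 b] by (cases "a = 0"; cases "b = 0") (auto simp: F_def algebra_simps)
    next
      case 3 then show ?thesis using that *[of a b 0] by (cases "a = 0"; cases "b = 0") (auto simp: F_def algebra_simps)
    qed
  qed
  then show ?thesis using assms by (auto simp: primitive_def)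
qed

lemma primitive_continuous:
  assumes "primitive F f" shows "continuous_on A F"
proof -
  have "isCont F x" for x
  proof -
    have "continuous_on {x-1..x+1} (\<lambda>y. F (x-1) + integral {x-1..y} f)"
      using assms by (intro continuous_intros indefinite_integral_continuous_1) (auto simp: primitive_def locally_integrable_integrable)
    moreover have "F (x-1) + integral {x-1..y} f = F y" if "y \<in> {x-1..x+1}" for y
      using assms that unfolding primitive_def by (metis add.commute atLeastAtMost_iff diff_add_cancel)
    ultimately have "continuous_on {x-1..x+1} F" by (metis (no_types, lifting) continuous_on_cong)
    then show ?thesis by (rule continuous_on_interior) auto
  qed
  then show ?thesis by (simp add: continuous_at_imp_continuous_on)
qed

lemma primitive_measurable: "primitive F f \<Longrightarrow> F \<in> borel_measurable lebesgue"
  using borel_measurable_continuous_onI[OF primitive_continuous] by (simp add: measurable_completion)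

lemma primitive_add_const: "primitive F f \<Longrightarrow> primitive (\<lambda>x. F x + C) f"
  by (simp add: primitive_def)

lemma locally_integrable_measurable:
  assumes "locally_integrable f" shows "f \<in> borel_measurable lebesgue"
proof -
  show ?thesis
  proof (rule borel_measurable_LIMSEQ_metric)
    show "(\<lambda>x. indicat_real {- real n..real n} x *\<^sub>R f x) \<in> borel_measurable lebesgue" for n
      using assms unfolding locally_integrable_def set_integrable_def by (intro borel_measurable_integrable) blast
    show "(\<lambda>n. indicat_real {- real n..real n} x *\<^sub>R f x) \<longlonglongrightarrow> f x" for x
    proof (rule tendsto_eventually)
      obtain N where "\<bar>x\<bar> \<le> real N" using real_arch_simple by blast
      then show "\<forall>\<^sub>F n in sequentially. indicat_real {- real n..real n} x *\<^sub>R f x = f x"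
        by (intro eventually_sequentiallyI[of N]) (auto simp: indicator_def)
    qed
  qed
qed

lemma locally_integrable_mult_continuous:
  assumes f: "locally_integrable f" and G: "continuous_on UNIV G"
  shows "locally_integrable (\<lambda>x. G x * f x)"
  unfolding locally_integrable_def
proof (intro allI)
  fix a b :: real
  have c: "continuous_on {a..b} G" using G continuous_on_subset by blast
  show "(\<lambda>x. G x * f x) absolutely_integrable_on {a..b}"
  proof (rule absolutely_integrable_bounded_measurable_product[OF bilinear_times])
    show "G \<in> borel_measurable (lebesgue_on {a..b})"
      by (rule continuous_imp_measurable_on_sets_lebesgue[OF c]) simp
    show "bounded (G ` {a..b})"
      by (intro compact_imp_bounded compact_continuous_image c compact_Icc)
    show "f absolutely_integrable_on {a..b}" using f by (simp add: locally_integrable_def)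
  qed simp
qed

lemma locally_integrable_add:
  "locally_integrable f \<Longrightarrow> locally_integrable g \<Longrightarrow> locally_integrable (\<lambda>x. f x + g x)"
  by (auto simp: locally_integrable_def intro: set_integral_add(1))

section \<open>Integration by parts for primitives\<close>

lemma sigma_finite_lebesgue: "sigma_finite_measure lebesgue"
proof
  show "\<exists>A::'a set set. countable A \<and> A \<subseteq> sets lebesgue \<and> \<Union>A = space lebesgue \<and> (\<forall>a\<in>A. emeasure lebesgue a \<noteq> \<infinity>)"
  proof (intro exI conjI ballI)
    show "countable (range (\<lambda>n::nat. ball (0::'a) (real n)))" by simp
    show "\<Union> (range (\<lambda>n::nat. ball (0::'a) (real n))) = space lebesgue"
      using reals_Archimedean2 by auto
    show "emeasure lebesgue a \<noteq> \<infinity>" if "a \<in> range (\<lambda>n::nat. ball (0::'a) (real n))" for a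
      using that emeasure_bounded_finite[of a] by (auto simp: less_top)
  qed auto
qed

text \<open>Both sides are the integral of \<open>f x * g y\<close> over the triangle
  \<open>a \<le> y \<le> x \<le> b\<close>, evaluated in the two orders by Fubini. This is
  integration by parts without differentiability.\<close>

lemma integral_primitive_swap:
  assumes F: "primitive F f" and G: "primitive G g" and ab: "a \<le> b"
  shows "integral {a..b} (\<lambda>x. (G x - G a) * f x) = integral {a..b} (\<lambda>y. (F b - F y) * g y)"
proof -
  interpret sigma_finite_measure "lebesgue :: real measure" by (rule sigma_finite_lebesgue)
  interpret pair_sigma_finite "lebesgue :: real measure" "lebesgue :: real measure" ..
  have lf: "locally_integrable f" and lg: "locally_integrable g" using F G by (auto simp: primitive_def)
  have [measurable]: "f \<in> borel_measurable lebesgue" "g \<in> borel_measurable lebesgue"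
    using lf lg by (auto intro: locally_integrable_measurable)
  have fst_m[measurable]: "fst \<in> borel_measurable ((lebesgue :: real measure) \<Otimes>\<^sub>M (lebesgue :: real measure))"
    "snd \<in> borel_measurable ((lebesgue :: real measure) \<Otimes>\<^sub>M (lebesgue :: real measure))"
  proof -
    have "(\<lambda>x::real. x) \<in> borel_measurable lebesgue" by (intro measurable_completion) simp
    from measurable_compose[OF measurable_fst this] measurable_compose[OF measurable_snd this]
    show "fst \<in> borel_measurable ((lebesgue :: real measure) \<Otimes>\<^sub>M (lebesgue :: real measure))"
      "snd \<in> borel_measurable ((lebesgue :: real measure) \<Otimes>\<^sub>M (lebesgue :: real measure))" .
  qed
  define h :: "real \<Rightarrow> real \<Rightarrow> complex" where
    "h x y = (indicator {a..b} x *\<^sub>R f x) * (indicator {a..b} y *\<^sub>R g y) * indicator {..x} y" for x y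
  have meas: "case_prod h \<in> borel_measurable (lebesgue \<Otimes>\<^sub>M lebesgue)"
  proof -
    have "indicator {..x} y = (if y \<le> x then 1 else 0 :: complex)" for x y :: real by (simp add: indicator_def)
    then have "case_prod h = (\<lambda>p. (indicator {a..b} (fst p) *\<^sub>R f (fst p)) * (indicator {a..b} (snd p) *\<^sub>R g (snd p)) * (if snd p \<le> fst p then 1 else 0))"
      by (auto simp: h_def fun_eq_iff)
    also have "\<dots> \<in> borel_measurable (lebesgue \<Otimes>\<^sub>M lebesgue)" by measurable
    finally show ?thesis .
  qed
  have intf: "integrable lebesgue (\<lambda>x. indicator {a..b} x *\<^sub>R f x)" and intg: "integrable lebesgue (\<lambda>x. indicator {a..b} x *\<^sub>R g x)"
    using lf lg by (auto simp: locally_integrable_def set_integrable_def)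
  have int: "integrable (lebesgue \<Otimes>\<^sub>M lebesgue) (case_prod h)"
  proof (rule Bochner_Integration.integrable_bound[OF _ meas])
    show "integrable (lebesgue \<Otimes>\<^sub>M lebesgue) (\<lambda>(x, y). (indicator {a..b} x *\<^sub>R f x) * (indicator {a..b} y *\<^sub>R g y))"
    proof (rule Fubini_integrable)
      have "integrable lebesgue (\<lambda>x. cmod (indicator {a..b} x *\<^sub>R f x) * (LINT y|lebesgue. cmod (indicator {a..b} y *\<^sub>R g y)))"
        by (intro integrable_mult_left integrable_norm intf)
      then show "integrable lebesgue (\<lambda>x. LINT y|lebesgue. cmod (case (x, y) of (x, y) \<Rightarrow>
          indicator {a..b} x *\<^sub>R f x * (indicator {a..b} y *\<^sub>R g y)))"
        by (simp add: norm_mult del: norm_scaleR mult_scaleR_left mult_scaleR_right)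
      show "AE x in lebesgue. integrable lebesgue (\<lambda>y. case (x, y) of (x, y) \<Rightarrow>
          indicator {a..b} x *\<^sub>R f x * (indicator {a..b} y *\<^sub>R g y))"
        by (simp del: mult_scaleR_left mult_scaleR_right add: intg)
    qed measurable
  qed (auto simp: h_def indicator_def)
  have "integral {a..b} (\<lambda>x. (G x - G a) * f x) = (LINT x|lebesgue. LINT y|lebesgue. h x y)"
  proof -
    have "(\<lambda>x. (G x - G a) * f x) absolutely_integrable_on {a..b}"
      using locally_integrable_mult_continuous[OF lf continuous_on_diff[OF primitive_continuous[OF G] continuous_on_const]]
      by (simp add: locally_integrable_def)
    then have "integral {a..b} (\<lambda>x. (G x - G a) * f x) = (LINT x:{a..b}|lebesgue. (G x - G a) * f x)"
      by (rule set_lebesgue_integral_eq_integral(2)[symmetric])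
    also have "\<dots> = (LINT x|lebesgue. LINT y|lebesgue. h x y)"
      unfolding set_lebesgue_integral_def
    proof (rule Bochner_Integration.integral_cong)
      fix x :: real
      show "indicator {a..b} x *\<^sub>R ((G x - G a) * f x) = (LINT y|lebesgue. h x y)"
      proof (cases "x \<in> {a..b}")
        case True
        have "(LINT y|lebesgue. h x y) = (LINT y|lebesgue. f x * (indicator {a..x} y *\<^sub>R g y))"
          using True by (intro Bochner_Integration.integral_cong) (auto simp: h_def indicator_def)
        also have "\<dots> = f x * (LINT y:{a..x}|lebesgue. g y)"
          unfolding set_lebesgue_integral_def by (rule integral_mult_right_zero)
        also have "(LINT y:{a..x}|lebesgue. g y) = integral {a..x} g"
          using lg by (intro set_lebesgue_integral_eq_integral) (simp add: locally_integrable_def)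
        also have "\<dots> = G x - G a" using G True by (auto simp: primitive_def)
        finally show ?thesis using True by simp
      qed (simp add: h_def)
    qed simp
    finally show ?thesis .
  qed
  also have "\<dots> = (LINT y|lebesgue. LINT x|lebesgue. h x y)"
    by (rule Fubini_integral[OF int, symmetric])
  also have "\<dots> = integral {a..b} (\<lambda>y. (F b - F y) * g y)"
  proof -
    have "(\<lambda>x. (F b - F x) * g x) absolutely_integrable_on {a..b}"
      using locally_integrable_mult_continuous[OF lg continuous_on_diff[OF continuous_on_const primitive_continuous[OF F]]]
      by (simp add: locally_integrable_def)
    then have "integral {a..b} (\<lambda>x. (F b - F x) * g x) = (LINT x:{a..b}|lebesgue. (F b - F x) * g x)"
      by (rule set_lebesgue_integral_eq_integral(2)[symmetric])
    also have "\<dots> = (LINT y|lebesgue. LINT x|lebesgue. h x y)"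
      unfolding set_lebesgue_integral_def
    proof (rule Bochner_Integration.integral_cong)
      fix y :: real
      show "indicator {a..b} y *\<^sub>R ((F b - F y) * g y) = (LINT x|lebesgue. h x y)"
      proof (cases "y \<in> {a..b}")
        case True
        have "(LINT x|lebesgue. h x y) = (LINT x|lebesgue. g y * (indicator {y..b} x *\<^sub>R f x))"
          using True by (intro Bochner_Integration.integral_cong) (auto simp: h_def indicator_def)
        also have "\<dots> = g y * (LINT x:{y..b}|lebesgue. f x)"
          unfolding set_lebesgue_integral_def by (rule integral_mult_right_zero)
        also have "(LINT x:{y..b}|lebesgue. f x) = integral {y..b} f"
          using lf by (intro set_lebesgue_integral_eq_integral) (simp add: locally_integrable_def)
        also have "\<dots> = F b - F y" using F True by (auto simp: primitive_def)
        finally show ?thesis using True by simp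
      qed (simp add: h_def)
    qed simp
    finally show ?thesis by simp
  qed
  finally show ?thesis .
qed

text \<open>The product rule is the swapped identity with its two differences multiplied
  out.\<close>

lemma primitive_mult:
  assumes F: "primitive F f" and G: "primitive G g"
  shows "primitive (\<lambda>x. F x * G x) (\<lambda>x. G x * f x + F x * g x)"
  unfolding primitive_def
proof (intro conjI allI impI)
  have lf: "locally_integrable f" and lg: "locally_integrable g" using F G by (auto simp: primitive_def)
  have Gf: "locally_integrable (\<lambda>x. G x * f x)" and Fg: "locally_integrable (\<lambda>x. F x * g x)"
    using locally_integrable_mult_continuous primitive_continuous F G lf lg by metis+
  then show "locally_integrable (\<lambda>x. G x * f x + F x * g x)" by (rule locally_integrable_add)
  fix a b :: real assume ab: "a \<le> b"
  note int = locally_integrable_integrable[of _ a b]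
  have "integral {a..b} (\<lambda>x. G x * f x) - G a * integral {a..b} f = F b * integral {a..b} g - integral {a..b} (\<lambda>x. F x * g x)"
  proof -
    have "((\<lambda>x. G x * f x - G a * f x) has_integral integral {a..b} (\<lambda>x. G x * f x) - G a * integral {a..b} f) {a..b}"
      by (intro has_integral_diff has_integral_mult_right integrable_integral int lf Gf)
    moreover have "((\<lambda>x. F b * g x - F x * g x) has_integral F b * integral {a..b} g - integral {a..b} (\<lambda>x. F x * g x)) {a..b}"
      by (intro has_integral_diff has_integral_mult_right integrable_integral int lg Fg)
    ultimately show ?thesis
      using integral_primitive_swap[OF F G ab] by (simp add: left_diff_distrib integral_unique)
  qed
  moreover have "integral {a..b} f = F b - F a" "integral {a..b} g = G b - G a"
    using F G ab by (auto simp: primitive_def)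
  moreover have "integral {a..b} (\<lambda>x. G x * f x + F x * g x) = integral {a..b} (\<lambda>x. G x * f x) + integral {a..b} (\<lambda>x. F x * g x)"
    using int[OF Gf] int[OF Fg] by (rule Henstock_Kurzweil_Integration.integral_add)
  ultimately show "F b * G b - F a * G a = integral {a..b} (\<lambda>x. G x * f x + F x * g x)"
    by (simp add: algebra_simps)
qed

lemma primitive_smooth:
  assumes der: "\<And>x. (\<eta> has_real_derivative \<eta>' x) (at x)" and cont: "continuous_on UNIV \<eta>'"
  shows "primitive (\<lambda>x. of_real (\<eta> x)) (\<lambda>x. of_real (\<eta>' x))"
  unfolding primitive_def locally_integrable_def
proof (intro conjI allI impI)
  fix a b :: real
  have c: "continuous_on {a..b} (\<lambda>x. complex_of_real (\<eta>' x))"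
    using cont by (intro continuous_intros) (auto intro: continuous_on_subset)
  then show "(\<lambda>x. complex_of_real (\<eta>' x)) absolutely_integrable_on {a..b}"
    by (rule absolutely_integrable_continuous_real)
  assume "a \<le> b"
  then have "((\<lambda>x. complex_of_real (\<eta>' x)) has_integral complex_of_real (\<eta> b) - complex_of_real (\<eta> a)) {a..b}"
    by (intro fundamental_theorem_of_calculus has_vector_derivative_of_real)
      (auto intro!: der[THEN has_field_derivative_at_within] simp flip: has_real_derivative_iff_has_vector_derivative)
  then show "complex_of_real (\<eta> b) - complex_of_real (\<eta> a) = integral {a..b} (\<lambda>x. complex_of_real (\<eta>' x))"
    by (simp add: integral_unique)
qed

lemma square_integrable_locally_integrable:
  assumes "square_integrable f" shows "locally_integrable f"
  unfolding locally_integrable_def set_integrable_def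
proof (intro allI)
  fix a b :: real
  have [measurable]: "f \<in> borel_measurable lebesgue" using assms by (simp add: square_integrable_def)
  show "integrable lebesgue (\<lambda>x. indicat_real {a..b} x *\<^sub>R f x)"
  proof (rule Bochner_Integration.integrable_bound)
    show "(\<lambda>x. indicat_real {a..b} x *\<^sub>R f x) \<in> borel_measurable lebesgue"
      by (intro borel_measurable_scaleR borel_measurable_indicator) auto
    show "integrable lebesgue (\<lambda>x. indicat_real {a..b} x + (cmod (f x))\<^sup>2)"
      using assms by (auto simp: square_integrable_def emeasure_lborel_Icc_eq intro!: Bochner_Integration.integrable_add)
    have "c \<le> 1 + c\<^sup>2" for c :: real using sum_squares_bound[of 1 c] zero_le_power2[of c] unfolding power_one by linarith
    then show "AE x in lebesgue. norm (indicat_real {a..b} x *\<^sub>R f x) \<le> norm (indicat_real {a..b} x + (cmod (f x))\<^sup>2)"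
      by (intro always_eventually) (auto simp: indicator_def)
  qed
qed

text \<open>Lebesgue differentiation: at almost every \<open>x\<close> the value is the limit of the
  averages over \<open>[x, x + h]\<close>, all of which vanish.\<close>

lemma locally_integrable_zero_AE:
  assumes v: "locally_integrable v" and zero: "\<And>a b. a < b \<Longrightarrow> integral {a..b} v = 0"
  shows "AE x in lebesgue. v x = 0"
proof -
  have "\<And>a b. v integrable_on cbox a b" using locally_integrable_integrable[OF v] by simp
  then obtain N where N: "negligible N" and
    *: "\<And>x e. x \<notin> N \<Longrightarrow> 0 < e \<Longrightarrow> \<exists>d>0. \<forall>h. 0 < h \<and> h < d \<longrightarrow>
                         norm (integral (cbox x (x + h *\<^sub>R One)) v /\<^sub>R h ^ DIM(real) - v x) < e"
    using integrable_ccontinuous_explicit by metis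
  have "v x = 0" if xN: "x \<notin> N" for x
  proof (rule ccontr)
    assume "v x \<noteq> 0"
    then obtain d where d: "d > 0" "\<And>h. 0 < h \<and> h < d \<Longrightarrow> norm (integral (cbox x (x + h *\<^sub>R One)) v /\<^sub>R h ^ DIM(real) - v x) < norm (v x)"
      using *[OF xN, of "norm (v x)"] by auto
    have "norm (integral {x..x + d/2} v /\<^sub>R (d/2) - v x) < norm (v x)" using d(2)[of "d/2"] d(1) by simp
    then show False using zero[of x "x + d/2"] d(1) by simp
  qed
  then show ?thesis
    using N by (intro AE_I'[of N]) (auto simp: negligible_iff_null_sets)
qed

subsection \<open>Test functions\<close>

lemma test_functionI:
  assumes "\<And>n. (deriv ^^ n) \<eta> differentiable_on UNIV" "\<And>x. \<bar>x\<bar> > R \<Longrightarrow> \<eta> x = 0"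
  shows "test_function \<eta>"
proof -
  have "{x. \<eta> x \<noteq> 0} \<subseteq> {-R..R}" using assms(2) by (force simp: abs_le_iff not_less[symmetric])
  then have "bounded {x. \<eta> x \<noteq> 0}" using bounded_subset[OF bounded_closed_interval] by blast
  then show ?thesis using assms(1) by (simp add: test_function_def compact_closure)
qed

lemma test_function_support:
  assumes "test_function \<eta>" obtains R where "R > 0" "\<And>x. \<bar>x\<bar> \<ge> R \<Longrightarrow> \<eta> x = 0"
proof -
  have "bounded {x. \<eta> x \<noteq> 0}" using assms by (simp add: test_function_def compact_closure)
  then obtain r where r: "\<And>x. \<eta> x \<noteq> 0 \<Longrightarrow> \<bar>x\<bar> \<le> r" by (auto simp: bounded_iff)
  show ?thesis by (rule that[of "max r 0 + 1"]) (use r in force)+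
qed

lemma test_function_deriv:
  assumes "test_function \<eta>" shows "(\<eta> has_real_derivative deriv \<eta> x) (at x)"
proof -
  have "\<eta> differentiable_on UNIV" using assms by (auto simp: test_function_def dest: spec[of _ 0])
  then show ?thesis by (simp add: differentiable_on_def DERIV_deriv_iff_real_differentiable)
qed

lemma test_function_continuous: "test_function \<eta> \<Longrightarrow> continuous_on A \<eta>"
  using test_function_deriv by (meson DERIV_continuous_on has_field_derivative_at_within)

lemma test_function_continuous_deriv: "test_function \<eta> \<Longrightarrow> continuous_on A (deriv \<eta>)"
  using spec[of "\<lambda>n. (deriv ^^ n) \<eta> differentiable_on UNIV" 1]
  by (auto simp: test_function_def intro: differentiable_imp_continuous_on continuous_on_subset)

lemma test_function_diff:
  assumes f: "test_function f" and g: "test_function g"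
  shows "test_function (\<lambda>x. f x - c * g x)"
proof -
  have fn: "((deriv ^^ n) f has_real_derivative (deriv ^^ Suc n) f x) (at x)" if "test_function f" for f n x
    using that by (auto simp: test_function_def differentiable_on_def DERIV_deriv_iff_real_differentiable)
  have *: "(deriv ^^ n) (\<lambda>x. f x - c * g x) = (\<lambda>x. (deriv ^^ n) f x - c * (deriv ^^ n) g x)" for n
  proof (induction n)
    case (Suc n)
    show ?case
    proof
      fix x
      have "((\<lambda>x. (deriv ^^ n) f x - c * (deriv ^^ n) g x) has_real_derivative
         (deriv ^^ Suc n) f x - c * (deriv ^^ Suc n) g x) (at x)"
        by (intro DERIV_diff DERIV_cmult fn f g)
      then show "(deriv ^^ Suc n) (\<lambda>x. f x - c * g x) x = (deriv ^^ Suc n) f x - c * (deriv ^^ Suc n) g x"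
        using Suc by (simp add: DERIV_imp_deriv)
    qed
  qed simp
  obtain R R' where R: "\<And>x. \<bar>x\<bar> \<ge> R \<Longrightarrow> f x = 0" "\<And>x. \<bar>x\<bar> \<ge> R' \<Longrightarrow> g x = 0"
    using test_function_support[OF f] test_function_support[OF g] by metis
  show ?thesis
  proof (rule test_functionI[of _ "max R R'"])
    show "(deriv ^^ n) (\<lambda>x. f x - c * g x) differentiable_on UNIV" for n
      unfolding * using f g by (intro differentiable_on_diff differentiable_on_mult differentiable_on_const)
        (auto simp: test_function_def)
  qed (use R in simp)
qed

text \<open>The vanishing total integral makes the antiderivative taken from the far left return to
  0 beyond the support.\<close>

lemma test_function_antiderivative:
  assumes \<kappa>: "test_function \<kappa>" "integral UNIV \<kappa> = 0"
  shows "\<exists>\<eta>. test_function \<eta> \<and> deriv \<eta> = \<kappa>"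
proof -
  obtain R where R: "R > 0" "\<And>x. \<bar>x\<bar> \<ge> R \<Longrightarrow> \<kappa> x = 0" using test_function_support[OF \<kappa>(1)] by metis
  \<comment> \<open>Starting one unit to the left of the support makes the two cases of the
    differentiation overlap, so no one-sided derivative occurs at the starting point.\<close>
  define \<eta> where "\<eta> x = integral {-R-1..x} \<kappa>" for x
  have cont: "continuous_on A \<kappa>" for A by (rule test_function_continuous[OF \<kappa>(1)])
  have zero: "\<eta> x = 0" if "x \<le> -R" for x
    unfolding \<eta>_def using that R by (subst integral_cong[of _ _ "\<lambda>x. 0"]) auto
  have tot: "\<eta> x = 0" if "x \<ge> R" for x
  proof -
    have "(\<kappa> has_integral \<eta> x) {-R-1..x}"
      unfolding \<eta>_def by (intro integrable_integral integrable_continuous_real cont)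
    then have "(\<kappa> has_integral \<eta> x) UNIV"
      by (rule has_integral_on_superset) (use that R in \<open>auto intro!: R(2)\<close>)
    then show ?thesis using \<kappa>(2) by (simp add: integral_unique)
  qed
  have der: "(\<eta> has_real_derivative \<kappa> x) (at x)" for x
  proof (cases "x > -R-1")
    case True
    have "(\<eta> has_real_derivative \<kappa> x) (at x within {-R-1..x+1})"
      unfolding \<eta>_def using True by (intro integral_has_real_derivative cont) auto
    then show ?thesis using True by (simp add: at_within_Icc_at)
  next
    case False
    have "((\<lambda>x. 0) has_real_derivative 0) (at x)" by simp
    then have "(\<eta> has_real_derivative 0) (at x)"
      by (rule has_field_derivative_transform_within_open[of _ _ _ "{..<-R}"])
         (use False in \<open>auto simp: zero\<close>)
    then show ?thesis using False R by simp
  qed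
  then have d: "deriv \<eta> = \<kappa>" by (auto intro: DERIV_imp_deriv)
  have "(deriv ^^ n) \<eta> differentiable_on UNIV" for n
  proof (cases n)
    case 0 then show ?thesis using der
      by (auto simp: differentiable_on_def real_differentiable_def intro: has_field_derivative_at_within)
  next
    case (Suc m)
    then show ?thesis using \<kappa>(1) by (simp add: test_function_def funpow_Suc_right d del: funpow.simps)
  qed
  then have "test_function \<eta>"
  proof (rule test_functionI[of _ R])
    fix x assume "\<bar>x\<bar> > R"
    then show "\<eta> x = 0" using zero[of x] tot[of x] by linarith
  qed
  with d show ?thesis by blast
qed

text \<open>The classical smooth bump on \<open>(a, b)\<close>. The parameter \<open>t\<close> makes
  it increase to the indicator of \<open>(a, b)\<close> as \<open>t\<close> decreases to 0, which
  replaces mollification.\<close>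

definition bump :: "real \<Rightarrow> real \<Rightarrow> real \<Rightarrow> real \<Rightarrow> real" where
  "bump a b t x = (if a < x \<and> x < b then exp (- t / ((x - a) * (b - x))) else 0)"

text \<open>With \<open>w x = 1 / ((x - a) * (b - x))\<close>, the functions \<open>P w\<^sup>k exp (- t w)\<close>, \<open>P\<close> a polynomial, form a
  class closed under differentiation, because \<open>w' = (2 x - a - b) w\<^sup>2\<close>.\<close>

context
  fixes a b t :: real assumes ab: "a < b" and t: "t > 0"
begin

private definition w where "w x = 1 / ((x - a) * (b - x))"

private definition F :: "real poly \<Rightarrow> nat \<Rightarrow> real \<Rightarrow> real" where
  "F P k x = (if a < x \<and> x < b then poly P x * w x ^ k * exp (- t * w x) else 0)"

text \<open>With \<open>q = (x - a) (b - x)\<close>, so that \<open>w q = 1\<close>, the three terms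
  of the derivative carry \<open>w^k\<close>, \<open>w^(k+1)\<close> and \<open>w^(k+2)\<close>.
  Bringing them to the common power \<open>w^(k+2)\<close> costs the factors \<open>q^2\<close>,
  \<open>q\<close> and 1.\<close>

private definition D :: "real poly \<Rightarrow> nat \<Rightarrow> real poly" where
  "D P k = pderiv P * ([:-a, 1:] * [:b, -1:])\<^sup>2 + smult (of_nat k) (P * [:-(a + b), 2:] * ([:-a, 1:] * [:b, -1:]))
     - smult t (P * [:-(a + b), 2:])"

text \<open>The exponential beats \<open>w^m\<close> with \<open>m = k + 2\<close>, since
  \<open>exp s = exp (s / m) ^ m\<close> is at least \<open>(s / m)^m\<close>. The two surplus
  powers of \<open>w\<close> are the quadratic factor, which makes the derivative vanish at the
  endpoints.\<close>

private lemma F_quadratic_bound: "\<exists>C\<ge>0. \<forall>x. a < x \<longrightarrow> x < b \<longrightarrow> \<bar>F P k x\<bar> \<le> C * ((x - a) * (b - x))\<^sup>2"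
proof -
  obtain B where B: "\<And>x. x \<in> {a..b} \<Longrightarrow> \<bar>poly P x\<bar> \<le> B"
    using compact_imp_bounded[OF compact_continuous_image[of "{a..b}" "poly P"]]
    by (force simp: bounded_iff intro: continuous_intros)
  have B0: "B \<ge> 0" using B[of a] ab by auto
  define m where "m = k + 2"
  define K where "K = (real m / t) ^ m"
  have "\<bar>F P k x\<bar> \<le> B * K * ((x - a) * (b - x))\<^sup>2" if x: "a < x" "x < b" for x
  proof -
    have w: "w x > 0" using x by (simp add: w_def)
    have "t * w x / m \<le> exp (t * w x / m)" using exp_ge_add_one_self[of "t * w x / m"] by linarith
    then have "(t * w x / m) ^ m \<le> exp (t * w x / m) ^ m" using w t by (intro power_mono) auto
    also have "\<dots> = exp (real m * (t * w x / real m))" by (rule exp_of_nat_mult[symmetric])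
    also have "\<dots> = exp (t * w x)" by (simp add: m_def)
    finally have "(t * w x / m) ^ m * exp (- t * w x) \<le> 1"
      using mult_right_mono[of _ "exp (t * w x)" "exp (- t * w x)"] by (simp add: exp_minus)
    then have "K * ((t * w x / m) ^ m * exp (- t * w x)) \<le> K * 1"
      by (rule mult_left_mono) (use t in \<open>simp add: K_def\<close>)
    moreover have "K * (t * w x / m) ^ m = w x ^ m"
      unfolding K_def power_mult_distrib[symmetric] using t by (simp add: m_def)
    ultimately have "w x ^ m * exp (- t * w x) \<le> K" by (simp add: mult.assoc[symmetric])
    moreover have "w x ^ m = w x ^ k * (w x)\<^sup>2" by (simp add: m_def power_add power2_eq_square)
    moreover have "1 / (w x)\<^sup>2 = ((x - a) * (b - x))\<^sup>2" using x by (simp add: w_def power_divide)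
    ultimately have "w x ^ k * exp (- t * w x) \<le> K * ((x - a) * (b - x))\<^sup>2"
      using w by (metis (no_types, opaque_lifting) divide_inverse mult.assoc mult.commute mult_1 pos_le_divide_eq zero_less_power)
    then have "\<bar>poly P x\<bar> * (w x ^ k * exp (- t * w x)) \<le> B * (K * ((x - a) * (b - x))\<^sup>2)"
      using B[of x] x B0 w by - (rule mult_mono, auto)
    then show ?thesis using x w by (simp add: F_def abs_mult power_abs mult.assoc)
  qed
  moreover have "B * K \<ge> 0" using B0 t by (simp add: K_def)
  ultimately show ?thesis by blast
qed

private lemma DERIV_zero_quadratic:
  fixes f :: "real \<Rightarrow> real"
  assumes "\<And>y. \<bar>f y - f x\<bar> \<le> C * (y - x)\<^sup>2"
  shows "(f has_real_derivative 0) (at x)"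
  unfolding has_field_derivative_iff
proof (rule Lim_null_comparison)
  show "\<forall>\<^sub>F y in at x. norm ((f y - f x) / (y - x)) \<le> C * \<bar>y - x\<bar>"
    unfolding eventually_at_filter
  proof (intro always_eventually allI impI)
    fix y assume "y \<noteq> x"
    then show "norm ((f y - f x) / (y - x)) \<le> C * \<bar>y - x\<bar>"
      using assms[of y] by (simp add: divide_le_eq power2_eq_square abs_mult_self_eq mult.assoc)
  qed
  have "((\<lambda>y. C * \<bar>y - x\<bar>) \<longlongrightarrow> C * \<bar>x - x\<bar>) (at x)" by (intro tendsto_intros)
  then show "((\<lambda>y. C * \<bar>y - x\<bar>) \<longlongrightarrow> 0) (at x)" by simp
qed

private lemma F_deriv: "(F P k has_real_derivative F (D P k) (k + 2) x) (at x)"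
proof -
  consider "a < x" "x < b" | "x < a \<or> x > b" | "x = a \<or> x = b" by linarith
  then show ?thesis
  proof cases
    case 1
    define q where "q = (x - a) * (b - x)"
    have q: "q > 0" using 1 by (simp add: q_def)
    have wq: "w x = 1 / q" by (simp add: w_def q_def)
    have w': "(w has_real_derivative (2 * x - a - b) * (w x)\<^sup>2) (at x)"
      unfolding w_def using 1
      by (auto intro!: derivative_eq_intros) (simp add: power2_eq_square algebra_simps)
    have "((\<lambda>x. poly P x * w x ^ k * exp (- t * w x)) has_real_derivative
       (poly (pderiv P) x * w x ^ k + poly P x * (of_nat k * w x ^ (k - 1) * ((2 * x - a - b) * (w x)\<^sup>2))) * exp (- t * w x)
         + poly P x * w x ^ k * (exp (- t * w x) * (- t * ((2 * x - a - b) * (w x)\<^sup>2)))) (at x)"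
      by (auto intro!: derivative_eq_intros w')
    also have "of_nat k * w x ^ (k - 1) * ((2 * x - a - b) * (w x)\<^sup>2) = of_nat k * (2 * x - a - b) * w x ^ (k + 1)"
      by (cases k) (simp_all add: power2_eq_square)
    also have "(poly (pderiv P) x * w x ^ k + poly P x * (of_nat k * (2 * x - a - b) * w x ^ (k + 1))) * exp (- t * w x)
         + poly P x * w x ^ k * (exp (- t * w x) * (- t * ((2 * x - a - b) * (w x)\<^sup>2)))
        = (poly (pderiv P) x * q\<^sup>2 + of_nat k * (poly P x * (2 * x - a - b) * q) - t * (poly P x * (2 * x - a - b)))
           * w x ^ (k + 2) * exp (- t * w x)"
      using q unfolding wq by (simp add: field_simps power2_eq_square)
    also have "poly (pderiv P) x * q\<^sup>2 + of_nat k * (poly P x * (2 * x - a - b) * q) - t * (poly P x * (2 * x - a - b)) = poly (D P k) x"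
      by (simp add: D_def q_def power2_eq_square algebra_simps)
    finally show ?thesis
      unfolding F_def[of "D P k"] using 1
      by (simp, elim has_field_derivative_transform_within_open[of _ _ _ "{a<..<b}"]) (auto simp: F_def)
  next
    case 2
    have "((\<lambda>x. 0) has_real_derivative 0) (at x)" by simp
    then have "(F P k has_real_derivative 0) (at x)"
      by (rule has_field_derivative_transform_within_open[of _ _ _ "- {a..b}"])
         (use 2 in \<open>auto simp: F_def\<close>)
    then show ?thesis using 2 by (auto simp: F_def)
  next
    case 3
    obtain C where C: "C \<ge> 0" "\<And>x. a < x \<Longrightarrow> x < b \<Longrightarrow> \<bar>F P k x\<bar> \<le> C * ((x - a) * (b - x))\<^sup>2"
      using F_quadratic_bound by metis
    have Fx: "F P k x = 0" "F (D P k) (k + 2) x = 0" using 3 by (auto simp: F_def)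
    \<comment> \<open>At an endpoint \<open>x\<close> one of the two factors has absolute value
      \<open>\<bar>y - x\<bar>\<close> and the other is at most \<open>b - a\<close>.\<close>
    have "\<bar>F P k y - F P k x\<bar> \<le> C * (b - a)\<^sup>2 * (y - x)\<^sup>2" for y
    proof (cases "a < y \<and> y < b")
      case True
      have "((y - a) * (b - y))\<^sup>2 \<le> (b - a)\<^sup>2 * (y - x)\<^sup>2"
      proof (cases "x = a")
        case xa: True
        have "(b - y)\<^sup>2 \<le> (b - a)\<^sup>2" using True by (intro power_mono) auto
        then have "(y - a)\<^sup>2 * (b - y)\<^sup>2 \<le> (y - a)\<^sup>2 * (b - a)\<^sup>2" by (intro mult_left_mono) auto
        then show ?thesis using xa by (simp add: power_mult_distrib mult.commute)
      next
        case False
        then have xb: "x = b" using 3 by simp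
        have "(y - a)\<^sup>2 \<le> (b - a)\<^sup>2" using True by (intro power_mono) auto
        then have "(y - a)\<^sup>2 * (b - y)\<^sup>2 \<le> (b - a)\<^sup>2 * (b - y)\<^sup>2" by (intro mult_right_mono) auto
        then show ?thesis using xb by (simp add: power_mult_distrib power2_commute[of y b])
      qed
      then have "C * ((y - a) * (b - y))\<^sup>2 \<le> C * ((b - a)\<^sup>2 * (y - x)\<^sup>2)" using C(1) by (rule mult_left_mono)
      then show ?thesis using C(2)[of y] True Fx by simp
    next
      case False
      then show ?thesis using C(1) Fx by (auto simp: F_def)
    qed
    then show ?thesis unfolding Fx(2) by (rule DERIV_zero_quadratic)
  qed
qed

lemma test_function_bump: "test_function (bump a b t)"
proof -
  have eq: "bump a b t = F 1 0"
    by (auto simp: bump_def F_def w_def fun_eq_iff)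
  have "\<exists>P k. (deriv ^^ n) (F 1 0) = F P k" for n
  proof (induction n)
    case (Suc n)
    then obtain P k where "(deriv ^^ n) (F 1 0) = F P k" by auto
    then have "(deriv ^^ Suc n) (F 1 0) = F (D P k) (k + 2)"
      using DERIV_imp_deriv[OF F_deriv] by auto
    then show ?case by blast
  qed auto
  then have "(deriv ^^ n) (F 1 0) differentiable_on UNIV" for n
    using F_deriv by (metis differentiable_on_def has_field_derivative_at_within real_differentiable_def)
  then show ?thesis unfolding eq
    by (rule test_functionI[of _ "max \<bar>a\<bar> \<bar>b\<bar>"]) (auto simp: F_def)
qed

end

subsection \<open>Weak derivatives\<close>

lemma bump_nonneg: "bump a b t x \<ge> 0" and bump_le_1: "t > 0 \<Longrightarrow> bump a b t x \<le> 1"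
  by (auto simp: bump_def)

lemma test_function_deriv_support:
  assumes "test_function \<eta>"
  obtains R where "R > 0" "\<And>x. \<bar>x\<bar> \<ge> R \<Longrightarrow> \<eta> x = 0" "\<And>x. \<bar>x\<bar> \<ge> R \<Longrightarrow> deriv \<eta> x = 0"
proof -
  obtain R where R: "R > 0" "\<And>x. \<bar>x\<bar> \<ge> R \<Longrightarrow> \<eta> x = 0" using test_function_support[OF assms] by metis
  have "deriv \<eta> x = 0" if "\<bar>x\<bar> \<ge> R + 1" for x
  proof -
    have "((\<lambda>x. 0) has_real_derivative 0) (at x)" by simp
    then have "(\<eta> has_real_derivative 0) (at x)"
      by (rule has_field_derivative_transform_within_open[of _ _ _ "- {-R..R}"])
         (use that R in \<open>auto simp: abs_if split: if_splits\<close>)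
    then show ?thesis by (rule DERIV_imp_deriv)
  qed
  then show ?thesis using that[of "R + 1"] R by auto
qed

lemma locally_integrable_compact_support:
  assumes f: "locally_integrable f" and h: "continuous_on UNIV h" "\<And>x. \<bar>x\<bar> \<ge> R \<Longrightarrow> h x = 0"
  shows "integrable lebesgue (\<lambda>x. f x * of_real (h x))"
    "(LINT x|lebesgue. f x * of_real (h x)) = integral {-R..R} (\<lambda>x. f x * of_real (h x))"
proof -
  have "locally_integrable (\<lambda>x. of_real (h x) * f x)"
    by (intro locally_integrable_mult_continuous f continuous_intros h)
  then have "(\<lambda>x. f x * of_real (h x)) absolutely_integrable_on {-R..R}"
    by (simp add: locally_integrable_def mult.commute)
  moreover have "indicat_real {-R..R} x *\<^sub>R (f x * of_real (h x)) = f x * of_real (h x)" for x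
  proof (cases "x \<in> {-R..R}")
    case False
    then have "\<bar>x\<bar> \<ge> R" by auto
    then show ?thesis using h(2) by simp
  qed simp
  ultimately show "integrable lebesgue (\<lambda>x. f x * of_real (h x))"
     "(LINT x|lebesgue. f x * of_real (h x)) = integral {-R..R} (\<lambda>x. f x * of_real (h x))"
    using set_lebesgue_integral_eq_integral(2)[of "{-R..R}" "\<lambda>x. f x * of_real (h x)"]
    by (auto simp: set_integrable_def set_lebesgue_integral_def)
qed

lemma integrable_mult_test_function:
  assumes "locally_integrable f" "test_function \<eta>"
  shows "integrable lebesgue (\<lambda>x. f x * of_real (\<eta> x))"
  using test_function_support[OF assms(2)]
    locally_integrable_compact_support(1)[OF assms(1) test_function_continuous[OF assms(2)]] by metis

lemma primitive_integral_by_parts: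
  assumes F: "primitive F f" and \<eta>: "test_function \<eta>"
  shows "(LINT x|lebesgue. F x * of_real (deriv \<eta> x)) = - (LINT x|lebesgue. f x * of_real (\<eta> x))"
proof -
  obtain R where R: "R > 0" "\<And>x. \<bar>x\<bar> \<ge> R \<Longrightarrow> \<eta> x = 0" "\<And>x. \<bar>x\<bar> \<ge> R \<Longrightarrow> deriv \<eta> x = 0"
    using test_function_deriv_support[OF \<eta>] by metis
  have lf: "locally_integrable f" using F by (simp add: primitive_def)
  have lF: "locally_integrable F"
    using primitive_continuous[OF F] by (auto simp: locally_integrable_def intro: absolutely_integrable_continuous_real)
  note c = test_function_continuous[OF \<eta>] and c' = test_function_continuous_deriv[OF \<eta>]
  have "primitive (\<lambda>x. F x * of_real (\<eta> x)) (\<lambda>x. of_real (\<eta> x) * f x + F x * of_real (deriv \<eta> x))"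
    by (intro primitive_mult F primitive_smooth test_function_deriv \<eta> c')
  then have "F R * of_real (\<eta> R) - F (-R) * of_real (\<eta> (-R)) =
      integral {-R..R} (\<lambda>x. of_real (\<eta> x) * f x + F x * of_real (deriv \<eta> x))"
    using R(1) by (simp add: primitive_def)
  then have "0 = integral {-R..R} (\<lambda>x. f x * of_real (\<eta> x) + F x * of_real (deriv \<eta> x))"
    using R by (simp add: mult.commute)
  also have "\<dots> = integral {-R..R} (\<lambda>x. f x * of_real (\<eta> x)) + integral {-R..R} (\<lambda>x. F x * of_real (deriv \<eta> x))"
  proof (rule Henstock_Kurzweil_Integration.integral_add)
    show "(\<lambda>x. f x * of_real (\<eta> x)) integrable_on {-R..R}" "(\<lambda>x. F x * of_real (deriv \<eta> x)) integrable_on {-R..R}"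
      using locally_integrable_integrable[OF locally_integrable_mult_continuous[OF lf]]
        locally_integrable_integrable[OF locally_integrable_mult_continuous[OF lF]] c[of UNIV] c'[of UNIV]
      by (simp_all add: mult.commute[of _ "of_real _"] continuous_on_of_real)
  qed
  also have "\<dots> = (LINT x|lebesgue. f x * of_real (\<eta> x)) + (LINT x|lebesgue. F x * of_real (deriv \<eta> x))"
    using locally_integrable_compact_support(2)[OF lf c R(2)] locally_integrable_compact_support(2)[OF lF c' R(3)] by simp
  finally show ?thesis by (simp add: eq_neg_iff_add_eq_0 add.commute)
qed

text \<open>Letting \<open>t\<close> tend to 0 under the integral, with \<open>v\<close> on
  \<open>{a..b}\<close> as majorant, shows that \<open>v\<close> has integral 0 over every
  interval.\<close>

lemma fundamental_lemma:
  assumes v: "locally_integrable v"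
    and zero: "\<And>a b t. a < b \<Longrightarrow> t > 0 \<Longrightarrow> (LINT x|lebesgue. v x * of_real (bump a b t x)) = 0"
  shows "AE x in lebesgue. v x = 0"
proof (rule locally_integrable_zero_AE[OF v])
  fix a b :: real assume ab: "a < b"
  have [measurable]: "v \<in> borel_measurable lebesgue" by (rule locally_integrable_measurable[OF v])
  have int1: "v absolutely_integrable_on {a..b}" using v by (simp add: locally_integrable_def)
  have int2: "v absolutely_integrable_on {a<..<b}"
    by (rule set_integrable_subset[OF int1]) auto
  note int = int1 int2
  let ?t = "\<lambda>n. inverse (real (Suc n))"
  have "(\<lambda>n. LINT x|lebesgue. v x * of_real (bump a b (?t n) x)) \<longlonglongrightarrow> (LINT x|lebesgue. indicat_real {a<..<b} x *\<^sub>R v x)"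
  proof (rule integral_dominated_convergence)
    show "integrable lebesgue (\<lambda>x. cmod (indicat_real {a..b} x *\<^sub>R v x))"
      using int by (intro integrable_norm) (simp add: set_integrable_def)
    show "(\<lambda>x. indicat_real {a<..<b} x *\<^sub>R v x) \<in> borel_measurable lebesgue"
      using int by (intro borel_measurable_integrable) (simp add: set_integrable_def)
    show "(\<lambda>x. v x * of_real (bump a b (?t n) x)) \<in> borel_measurable lebesgue" for n
      by (intro borel_measurable_integrable integrable_mult_test_function v test_function_bump ab) simp
    show "AE x in lebesgue. (\<lambda>n. v x * of_real (bump a b (?t n) x)) \<longlonglongrightarrow> indicat_real {a<..<b} x *\<^sub>R v x"
    proof (intro always_eventually allI)
      fix x
      have "(\<lambda>n. v x * of_real (exp (- ?t n / ((x - a) * (b - x))))) \<longlonglongrightarrow> v x * of_real (exp (- 0 / ((x - a) * (b - x))))"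
        if "a < x" "x < b"
        by (intro tendsto_intros LIMSEQ_inverse_real_of_nat) (use that in auto)
      then show "(\<lambda>n. v x * of_real (bump a b (?t n) x)) \<longlonglongrightarrow> indicat_real {a<..<b} x *\<^sub>R v x"
        by (cases "a < x \<and> x < b") (auto simp: bump_def)
    qed
    show "AE x in lebesgue. norm (v x * of_real (bump a b (?t n) x)) \<le> cmod (indicat_real {a..b} x *\<^sub>R v x)" for n
      using bump_le_1[of "?t n" a b] bump_nonneg[of a b "?t n"]
      by (intro always_eventually) (auto simp: norm_mult bump_def indicator_def intro: mult_left_le)
  qed
  then have "(LINT x|lebesgue. indicat_real {a<..<b} x *\<^sub>R v x) = 0"
    by (simp add: zero[OF ab] LIMSEQ_const_iff)
  then have "integral {a<..<b} v = 0"
    using set_lebesgue_integral_eq_integral(2)[OF int(2)] by (simp add: set_lebesgue_integral_def)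
  then show "integral {a..b} v = 0" by (simp add: integral_open_interval_real)
qed

text \<open>Subtracting a multiple \<open>d\<close> of one fixed bump \<rho> gives any bump mean 0
  and hence makes it the derivative of a test function. The pairing with \<open>w\<close> is
  therefore proportional to the mean, with factor \<open>C\<close>, and the fundamental lemma
  applies to \<open>w - C\<close>.\<close>

lemma du_Bois_Reymond:
  assumes w: "locally_integrable w"
    and zero: "\<And>\<eta>. test_function \<eta> \<Longrightarrow> (LINT x|lebesgue. w x * of_real (deriv \<eta> x)) = 0"
  shows "\<exists>C. AE x in lebesgue. w x = C"
proof -
  define \<rho> where "\<rho> = bump 0 1 1"
  have \<rho>: "test_function \<rho>" unfolding \<rho>_def by (rule test_function_bump) auto
  have one: "locally_integrable (\<lambda>x. 1)" by (simp add: locally_integrable_def)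
  have int: "(LINT x|lebesgue. of_real (\<kappa> x)) = complex_of_real (integral UNIV \<kappa>)"
     "integrable lebesgue \<kappa>" if "test_function \<kappa>" for \<kappa>
  proof -
    have "complex_integrable lebesgue (\<lambda>x. of_real (\<kappa> x))" using integrable_mult_test_function[OF one that] by simp
    then show i: "integrable lebesgue \<kappa>" by (simp only: complex_of_real_integrable_eq)
    then show "(LINT x|lebesgue. of_real (\<kappa> x)) = complex_of_real (integral UNIV \<kappa>)"
      using set_lebesgue_integral_eq_integral(2)[of UNIV \<kappa>] by (simp add: set_integrable_def set_lebesgue_integral_def integral_complex_of_real)
  qed
  have I: "integral UNIV \<rho> \<noteq> 0"
  proof
    assume "integral UNIV \<rho> = 0"
    then have "(LINT x|lebesgue. \<rho> x) = 0" using int[OF \<rho>] by (simp add: integral_complex_of_real)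
    then have "AE x in lebesgue. \<rho> x = 0"
      using integral_nonneg_eq_0_iff_AE[OF int(2)[OF \<rho>]] bump_nonneg by (auto simp: \<rho>_def)
    then have "AE x in lebesgue. x \<notin> {0<..<1::real}" by eventually_elim (auto simp: \<rho>_def bump_def split: if_splits)
    then have "{0<..<1::real} \<in> null_sets lebesgue" by (subst (asm) AE_iff_null_sets[symmetric]) auto
    then show False by (simp add: null_sets_def emeasure_lborel_Ioo)
  qed
  define C where "C = (LINT x|lebesgue. w x * of_real (\<rho> x)) / of_real (integral UNIV \<rho>)"
  have "AE x in lebesgue. w x + (- C) = 0"
  proof (rule fundamental_lemma)
    have c: "locally_integrable (\<lambda>x. - C)" by (simp add: locally_integrable_def)
    then show "locally_integrable (\<lambda>x. w x + - C)" by (intro locally_integrable_add w)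
    fix a b t :: real assume ab: "a < b" "t > 0"
    define \<kappa> where "\<kappa> = bump a b t"
    have \<kappa>: "test_function \<kappa>" using ab by (simp add: \<kappa>_def test_function_bump)
    define d where "d = integral UNIV \<kappa> / integral UNIV \<rho>"
    define \<kappa>' where "\<kappa>' x = \<kappa> x - d * \<rho> x" for x
    have \<kappa>': "test_function \<kappa>'" unfolding \<kappa>'_def by (intro test_function_diff \<kappa> \<rho>)
    have "complex_of_real (integral UNIV \<kappa>') = of_real (integral UNIV \<kappa> - d * integral UNIV \<rho>)"
      using int(1)[OF \<kappa>'] int(1)[OF \<kappa>] int(1)[OF \<rho>] int(2)[OF \<kappa>] int(2)[OF \<rho>]
      by (simp add: \<kappa>'_def integral_complex_of_real)
    then have "integral UNIV \<kappa>' = 0" using I by (simp add: d_def)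
    then obtain \<eta> where \<eta>: "test_function \<eta>" "deriv \<eta> = \<kappa>'" using test_function_antiderivative[OF \<kappa>'] by blast
    note ik = integrable_mult_test_function[OF w \<kappa>] and ir = integrable_mult_test_function[OF w \<rho>]
    have split: "(LINT x|lebesgue. w x * of_real (\<kappa> x) + - C * of_real (\<kappa> x)) =
       (LINT x|lebesgue. w x * of_real (\<kappa> x)) + (LINT x|lebesgue. - C * of_real (\<kappa> x))"
      by (intro Bochner_Integration.integral_add ik integrable_mult_test_function[OF c \<kappa>])
    have "0 = (LINT x|lebesgue. w x * of_real (\<kappa> x) - of_real d * (w x * of_real (\<rho> x)))"
      using zero[OF \<eta>(1)] by (simp add: \<eta>(2) \<kappa>'_def algebra_simps)
    also have "\<dots> = (LINT x|lebesgue. w x * of_real (\<kappa> x)) - of_real d * (LINT x|lebesgue. w x * of_real (\<rho> x))"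
      using ik ir by simp
    finally have "(LINT x|lebesgue. w x * of_real (\<kappa> x)) = C * (LINT x|lebesgue. of_real (\<kappa> x))"
      unfolding int(1)[OF \<kappa>] using I by (simp add: C_def d_def)
    moreover have "(LINT x|lebesgue. (w x + - C) * of_real (\<kappa> x)) =
       (LINT x|lebesgue. w x * of_real (\<kappa> x)) + (LINT x|lebesgue. - C * of_real (\<kappa> x))"
      unfolding distrib_right by (rule split)
    moreover have "(LINT x|lebesgue. - C * complex_of_real (\<kappa> x)) = - C * (LINT x|lebesgue. of_real (\<kappa> x))"
      by (rule integral_mult_right_zero)
    ultimately show "(LINT x|lebesgue. (w x + - C) * of_real (bump a b t x)) = 0"
      unfolding \<kappa>_def[symmetric] by simp
  qed
  then show ?thesis by (intro exI[of _ C]) (auto elim: eventually_mono)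
qed

section \<open>Weak derivatives and absolutely continuous representatives\<close>

lemma locally_integrable_rep: "locally_integrable (rep_L2 \<phi>)"
  by (intro square_integrable_locally_integrable square_integrable_rep)

lemma primitive_locally_integrable: "primitive F f \<Longrightarrow> locally_integrable F"
  using primitive_continuous by (auto simp: locally_integrable_def intro: absolutely_integrable_continuous_real)

lemma integral_mult_cong_AE:
  assumes "AE x in lebesgue. f x = g x" "locally_integrable f" "locally_integrable g" "continuous_on UNIV h"
  shows "(LINT x|lebesgue. f x * of_real (h x)) = (LINT x|lebesgue. g x * complex_of_real (h x))"
proof (rule integral_cong_AE)
  have [measurable]: "h \<in> borel_measurable lebesgue"
    by (intro measurable_completion) (simp add: borel_measurable_continuous_onI assms)
  show "(\<lambda>x. f x * of_real (h x)) \<in> borel_measurable lebesgue" "(\<lambda>x. g x * of_real (h x)) \<in> borel_measurable lebesgue"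
    using locally_integrable_measurable assms by (auto intro!: borel_measurable_times)
qed (use assms in \<open>auto elim: eventually_mono\<close>)

text \<open>Integration by parts in one direction, du Bois-Reymond for the difference of
  \<open>rep_L2 \<phi>\<close> and a primitive in the other. The representative \<open>F\<close>
  makes pointwise bounds and the product rule available.\<close>

lemma weak_derivative_iff_primitive:
  "weak_derivative \<phi> \<psi> \<longleftrightarrow> (\<exists>F. primitive F (rep_L2 \<psi>) \<and> (AE x in lebesgue. rep_L2 \<phi> x = F x))"
proof
  assume wd: "weak_derivative \<phi> \<psi>"
  obtain F where F: "primitive F (rep_L2 \<psi>)" using primitive_exists[OF locally_integrable_rep] by blast
  have lF: "locally_integrable F" by (rule primitive_locally_integrable[OF F])
  have "\<exists>C. AE x in lebesgue. rep_L2 \<phi> x + -1 * F x = C"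
  proof (rule du_Bois_Reymond)
    have lF': "locally_integrable (\<lambda>x. -1 * F x)" by (intro locally_integrable_mult_continuous lF) simp
    then show "locally_integrable (\<lambda>x. rep_L2 \<phi> x + -1 * F x)" by (intro locally_integrable_add locally_integrable_rep)
    fix \<eta> assume \<eta>: "test_function \<eta>"
    obtain R where R: "\<And>x. \<bar>x\<bar> \<ge> R \<Longrightarrow> deriv \<eta> x = 0"
      using test_function_deriv_support[OF \<eta>] by metis
    note int = locally_integrable_compact_support(1)[OF _ test_function_continuous_deriv[OF \<eta>] R]
    show "(LINT x|lebesgue. (rep_L2 \<phi> x + -1 * F x) * of_real (deriv \<eta> x)) = 0"
      using wd \<eta> primitive_integral_by_parts[OF F \<eta>] int[OF locally_integrable_rep[of \<phi>]] int[OF lF]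
      by (simp add: weak_derivative_def left_diff_distrib)
  qed
  then obtain C where C: "AE x in lebesgue. rep_L2 \<phi> x + -1 * F x = C" by blast
  have "AE x in lebesgue. rep_L2 \<phi> x = F x + C" using C by eventually_elim (auto simp: algebra_simps)
  then show "\<exists>F. primitive F (rep_L2 \<psi>) \<and> (AE x in lebesgue. rep_L2 \<phi> x = F x)"
    using primitive_add_const[OF F] by blast
next
  assume "\<exists>F. primitive F (rep_L2 \<psi>) \<and> (AE x in lebesgue. rep_L2 \<phi> x = F x)"
  then obtain F where F: "primitive F (rep_L2 \<psi>)" "AE x in lebesgue. rep_L2 \<phi> x = F x" by blast
  show "weak_derivative \<phi> \<psi>" unfolding weak_derivative_def
    using primitive_integral_by_parts[OF F(1)]
      integral_mult_cong_AE[OF F(2) locally_integrable_rep primitive_locally_integrable[OF F(1)] test_function_continuous_deriv] by simp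
qed

lemma weak_derivative_unique:
  assumes "weak_derivative \<phi> \<psi>" "weak_derivative \<phi> \<psi>'" shows "\<psi> = \<psi>'"
proof (rule L2_eqI)
  have l: "locally_integrable (\<lambda>x. - 1 * rep_L2 \<psi>' x)" by (intro locally_integrable_mult_continuous locally_integrable_rep) simp
  have "AE x in lebesgue. rep_L2 \<psi> x + -1 * rep_L2 \<psi>' x = 0"
  proof (rule fundamental_lemma)
    show "locally_integrable (\<lambda>x. rep_L2 \<psi> x + -1 * rep_L2 \<psi>' x)" by (intro locally_integrable_add locally_integrable_rep l)
    fix a b t :: real assume "a < b" "t > 0"
    then have t: "test_function (bump a b t)" by (rule test_function_bump)
    show "(LINT x|lebesgue. (rep_L2 \<psi> x + -1 * rep_L2 \<psi>' x) * of_real (bump a b t x)) = 0"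
      using assms t integrable_mult_test_function[OF locally_integrable_rep t]
      by (simp add: weak_derivative_def left_diff_distrib)
  qed
  then show "AE x in lebesgue. rep_L2 \<psi> x = rep_L2 \<psi>' x" by (auto elim: eventually_mono)
qed

lemma weak_deriv_eq: "weak_derivative \<phi> \<psi> \<Longrightarrow> weak_deriv \<phi> = \<psi>"
  unfolding weak_deriv_def by (auto intro: weak_derivative_unique)

lemma weak_derivative_weak_deriv: "\<phi> \<in> W12 \<Longrightarrow> weak_derivative \<phi> (weak_deriv \<phi>)"
  using weak_deriv_eq by (auto simp: W12_def)

lemma W12I: "weak_derivative \<phi> \<psi> \<Longrightarrow> \<phi> \<in> W12"
  by (auto simp: W12_def)

lemma square_integrable_compact_support:
  assumes "continuous_on UNIV h" "\<And>x. \<bar>x\<bar> \<ge> R \<Longrightarrow> h x = 0"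
  shows "square_integrable (\<lambda>x. complex_of_real (h x))"
proof -
  have [measurable]: "h \<in> borel_measurable lebesgue"
    by (intro measurable_completion) (simp add: borel_measurable_continuous_onI assms)
  have "locally_integrable (\<lambda>x. of_real (h x))"
    using assms(1) unfolding locally_integrable_def
    by (intro allI absolutely_integrable_continuous_real continuous_intros) (auto intro: continuous_on_subset)
  from locally_integrable_compact_support(1)[OF this assms]
  have "complex_integrable lebesgue (\<lambda>x. of_real ((h x)\<^sup>2))" by (simp add: power2_eq_square)
  then have "integrable lebesgue (\<lambda>x. (h x)\<^sup>2)" by (simp only: complex_of_real_integrable_eq)
  then show ?thesis by (simp add: square_integrable_def)
qed

definition of_fun :: "(real \<Rightarrow> real) \<Rightarrow> L2" where "of_fun h = abs_L2 (\<lambda>x. of_real (h x))"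

lemma cinner_of_fun:
  assumes "continuous_on UNIV h" "\<And>x. \<bar>x\<bar> \<ge> R \<Longrightarrow> h x = 0"
  shows "cinner_L2 \<phi> (of_fun h) = (LINT x|lebesgue. rep_L2 \<phi> x * of_real (h x))"
proof -
  have [measurable]: "h \<in> borel_measurable lebesgue"
    by (intro measurable_completion) (simp add: borel_measurable_continuous_onI assms)
  have [measurable]: "cnj \<in> borel_measurable borel"
    by (intro borel_measurable_continuous_onI continuous_intros)
  have ae: "AE x in lebesgue. rep_L2 (abs_L2 (\<lambda>x. of_real (h x))) x = of_real (h x)"
    using square_integrable_compact_support[of h R] assms by (intro rep_abs_L2) auto
  show ?thesis
    unfolding cinner_L2_rep of_fun_def
    by (rule integral_cong_AE) (use ae in \<open>auto elim: eventually_mono\<close>)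
qed

text \<open>Written with inner products against fixed vectors, the condition is visibly linear and
  stable under limits of both \<open>\<phi>\<close> and \<open>\<psi>\<close>.\<close>

lemma weak_derivative_iff_cinner:
  "weak_derivative \<phi> \<psi> \<longleftrightarrow> (\<forall>\<eta>. test_function \<eta> \<longrightarrow> cinner_L2 \<phi> (of_fun (deriv \<eta>)) = - cinner_L2 \<psi> (of_fun \<eta>))"
proof -
  have "(LINT x|lebesgue. rep_L2 \<phi> x * of_real (deriv \<eta> x)) = cinner_L2 \<phi> (of_fun (deriv \<eta>))"
    "(LINT x|lebesgue. rep_L2 \<psi> x * of_real (\<eta> x)) = cinner_L2 \<psi> (of_fun \<eta>)" if \<eta>: "test_function \<eta>" for \<eta>
    using test_function_deriv_support[OF \<eta>]
      cinner_of_fun[OF test_function_continuous_deriv[OF \<eta>]] cinner_of_fun[OF test_function_continuous[OF \<eta>]] by metis+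
  then show ?thesis unfolding weak_derivative_def by simp
qed

lemma weak_derivative_add:
  "weak_derivative \<phi> \<psi> \<Longrightarrow> weak_derivative \<phi>' \<psi>' \<Longrightarrow> weak_derivative (\<phi> + \<phi>') (\<psi> + \<psi>')"
  by (simp add: weak_derivative_iff_cinner cinner_add_left)

lemma weak_derivative_scaleC:
  "weak_derivative \<phi> \<psi> \<Longrightarrow> weak_derivative (scaleC_L2 a \<phi>) (scaleC_L2 a \<psi>)"
  by (simp add: weak_derivative_iff_cinner cinner_scaleC_left)

lemma weak_derivative_scaleR:
  "weak_derivative \<phi> \<psi> \<Longrightarrow> weak_derivative (r *\<^sub>R \<phi>) (r *\<^sub>R \<psi>)"
  unfolding scaleR_L2_def by (rule weak_derivative_scaleC)

lemma weak_derivative_diff: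
  "weak_derivative \<phi> \<psi> \<Longrightarrow> weak_derivative \<phi>' \<psi>' \<Longrightarrow> weak_derivative (\<phi> - \<phi>') (\<psi> - \<psi>')"
  by (simp add: weak_derivative_iff_cinner cinner_diff_left)

lemma tendsto_cinner_left: "(f \<longlongrightarrow> \<phi>) F \<Longrightarrow> ((\<lambda>n. cinner_L2 (f n) \<psi>) \<longlongrightarrow> cinner_L2 \<phi> \<psi>) F"
  unfolding cinner_inner by (intro tendsto_Complex tendsto_intros)

lemma weak_derivative_closed:
  assumes "\<And>n. weak_derivative (\<phi> n) (\<psi> n)" "\<phi> \<longlonglongrightarrow> \<phi>'" "\<psi> \<longlonglongrightarrow> \<psi>'"
  shows "weak_derivative \<phi>' \<psi>'"
  unfolding weak_derivative_iff_cinner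
proof (intro allI impI)
  fix \<eta> assume \<eta>: "test_function \<eta>"
  have "(\<lambda>n. cinner_L2 (\<phi> n) (of_fun (deriv \<eta>))) \<longlonglongrightarrow> cinner_L2 \<phi>' (of_fun (deriv \<eta>))"
    by (rule tendsto_cinner_left[OF assms(2)])
  moreover have "(\<lambda>n. - cinner_L2 (\<psi> n) (of_fun \<eta>)) \<longlonglongrightarrow> - cinner_L2 \<psi>' (of_fun \<eta>)"
    by (intro tendsto_minus tendsto_cinner_left assms)
  ultimately show "cinner_L2 \<phi>' (of_fun (deriv \<eta>)) = - cinner_L2 \<psi>' (of_fun \<eta>)"
    using assms(1) \<eta> by (auto simp: weak_derivative_iff_cinner intro: LIMSEQ_unique)
qed

lemma primitive_cong_AE:
  assumes F: "primitive F f" and eq: "AE x in lebesgue. f x = g x"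
  shows "primitive F g"
proof -
  obtain N where N: "negligible N" "\<And>x. x \<notin> N \<Longrightarrow> f x = g x"
    using eq by (auto simp: eventually_ae_filter negligible_iff_null_sets)
  have "g absolutely_integrable_on {a..b}" for a b
    using F N absolutely_integrable_spike[where S = N and f = f and g = g] by (auto simp: primitive_def locally_integrable_def)
  moreover have "integral {a..b} f = integral {a..b} g" for a b
    using N by (intro integral_spike[of N]) auto
  ultimately show ?thesis using F by (auto simp: primitive_def locally_integrable_def)
qed

text \<open>Here \<open>k\<close> is the derivative of the cut-off \<open>m\<close>. Its boundedness
  keeps \<open>mulop m u\<close> in \<open>W12\<close>, so that it is an admissible test
  vector.\<close>

lemma weak_derivative_mulop:
  assumes u: "weak_derivative u u'" and m: "m \<in> Linf" "k \<in> Linf"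
    and prim: "primitive (\<lambda>x. of_real (m x)) (\<lambda>x. of_real (k x))"
  shows "weak_derivative (mulop m u) (mulop k u + mulop m u')"
proof -
  obtain F where F: "primitive F (rep_L2 u')" "AE x in lebesgue. rep_L2 u x = F x"
    using u by (auto simp: weak_derivative_iff_primitive)
  have "AE x in lebesgue. of_real (m x) * rep_L2 u' x + F x * of_real (k x) = rep_L2 (mulop k u + mulop m u') x"
    using rep_add[of "mulop k u" "mulop m u'"] rep_mulop[OF m(1), of u'] rep_mulop[OF m(2), of u] F(2)
    by eventually_elim simp
  then have "primitive (\<lambda>x. F x * of_real (m x)) (rep_L2 (mulop k u + mulop m u'))"
    by (rule primitive_cong_AE[OF primitive_mult[OF F(1) prim]])
  moreover have "AE x in lebesgue. rep_L2 (mulop m u) x = F x * of_real (m x)"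
    using rep_mulop[OF m(1), of u] F(2) by eventually_elim simp
  ultimately show ?thesis unfolding weak_derivative_iff_primitive by blast
qed

subsection \<open>The resolvent of the approximating operators\<close>

lemma Linf_mult:
  assumes "m \<in> Linf" "n \<in> Linf" shows "(\<lambda>x. m x * n x) \<in> Linf"
proof -
  obtain K L where "K > 0" "AE x in lebesgue. \<bar>m x\<bar> \<le> K" "L > 0" "AE x in lebesgue. \<bar>n x\<bar> \<le> L"
    using Linf_bound assms by metis
  then have "AE x in lebesgue. \<bar>m x * n x\<bar> \<le> K * L"
    by (auto elim!: eventually_elim2 simp: abs_mult intro!: mult_mono)
  then show ?thesis using assms by (auto simp: Linf_def)
qed

lemma mulop_mulop:
  assumes "m \<in> Linf" "n \<in> Linf" shows "mulop m (mulop n \<phi>) = mulop (\<lambda>x. m x * n x) \<phi>"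
proof (rule L2_eqI)
  show "AE x in lebesgue. rep_L2 (mulop m (mulop n \<phi>)) x = rep_L2 (mulop (\<lambda>x. m x * n x) \<phi>) x"
    using rep_mulop[OF assms(1), of "mulop n \<phi>"] rep_mulop[OF assms(2), of \<phi>] rep_mulop[OF Linf_mult[OF assms], of \<phi>]
    by eventually_elim simp
qed

lemma mulop_cong_AE:
  assumes "m \<in> Linf" "n \<in> Linf" "AE x in lebesgue. m x = n x" shows "mulop m \<phi> = mulop n \<phi>"
proof (rule L2_eqI)
  show "AE x in lebesgue. rep_L2 (mulop m \<phi>) x = rep_L2 (mulop n \<phi>) x"
    using rep_mulop[OF assms(1), of \<phi>] rep_mulop[OF assms(2), of \<phi>] assms(3)
    by eventually_elim simp
qed

lemma Linf_const: "(\<lambda>x. r) \<in> Linf"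
  by (auto simp: Linf_def)

lemma mulop_one: "mulop (\<lambda>x. 1) \<phi> = \<phi>"
  using rep_mulop[OF Linf_const[of 1], of \<phi>] by (intro L2_eqI) (auto elim: eventually_mono)

lemma dirichlet_form_diff_left:
  assumes "a \<in> Linf" "u \<in> W12" "v \<in> W12"
  shows "dirichlet_form a (u - v) \<theta> = dirichlet_form a u \<theta> - dirichlet_form a v \<theta>"
proof -
  interpret bounded_linear "mulop a" by (rule bounded_linear_mulop[OF assms(1)])
  have "weak_deriv (u - v) = weak_deriv u - weak_deriv v"
    using assms by (intro weak_deriv_eq weak_derivative_diff weak_derivative_weak_deriv)
  then show ?thesis using assms by (simp add: dirichlet_form_mulop diff cinner_diff_left)
qed

lemma dirichlet_form_self:
  "dirichlet_form a u u = of_real (LINT x|lebesgue. a x * (cmod (rep_L2 (weak_deriv u) x))\<^sup>2)"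
proof -
  have "dirichlet_form a u u = (LINT x|lebesgue. complex_of_real (a x * (cmod (rep_L2 (weak_deriv u) x))\<^sup>2))"
    unfolding dirichlet_form_def by (simp only: of_real_mult complex_norm_square mult.assoc)
  then show ?thesis by (simp only: integral_complex_of_real)
qed

lemma dirichlet_form_self_nonneg:
  assumes "a \<in> Linf" "AE x in lebesgue. 0 \<le> a x"
  shows "0 \<le> Re (dirichlet_form a u u)"
proof -
  have "Re (dirichlet_form a u u) = (LINT x|lebesgue. a x * (cmod (rep_L2 (weak_deriv u) x))\<^sup>2)"
    by (simp add: dirichlet_form_self)
  also have "\<dots> \<ge> 0" using assms(2) by (intro integral_nonneg_AE) (auto elim: eventually_mono)
  finally show ?thesis .
qed

text \<open>With \<open>r = sqrt a\<close>, the pairs \<open>(u, r u')\<close> form a closed real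
  subspace of the product space. Projecting \<open>(f, 0)\<close> onto it gives the equation,
  because orthogonality to \<open>(\<theta>, r \<theta>')\<close> is its real part.\<close>

lemma form_resolvent_exists:
  assumes a: "a \<in> Linf" and \<epsilon>: "\<epsilon> > 0" "AE x in lebesgue. \<epsilon> \<le> a x"
  shows "\<exists>u\<in>W12. \<forall>\<theta>\<in>W12. dirichlet_form a u \<theta> = cinner_L2 (f - u) \<theta>"
proof -
  obtain K where K: "K > 0" "AE x in lebesgue. \<bar>a x\<bar> \<le> K" using Linf_bound[OF a] by metis
  have [measurable]: "a \<in> borel_measurable lebesgue" by (rule Linf_measurable[OF a])
  define r where "r x = sqrt (a x)" for x
  define s where "s x = 1 / sqrt (a x)" for x
  have rL: "r \<in> Linf" unfolding Linf_def
  proof (intro CollectI conjI exI)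
    show "AE x in lebesgue. \<bar>r x\<bar> \<le> sqrt K" using K(2) \<epsilon>(2)
      by eventually_elim (use \<epsilon>(1) in \<open>auto simp: r_def\<close>)
  qed (simp add: r_def[abs_def])
  have sL: "s \<in> Linf" unfolding Linf_def
  proof (intro CollectI conjI exI)
    show "AE x in lebesgue. \<bar>s x\<bar> \<le> 1 / sqrt \<epsilon>" using \<epsilon>(2)
      by eventually_elim (use \<epsilon>(1) in \<open>auto simp: s_def intro!: divide_left_mono\<close>)
  qed (simp add: s_def[abs_def])
  have sr: "AE x in lebesgue. s x * r x = 1" and rs: "AE x in lebesgue. r x * s x = 1"
    and rr: "AE x in lebesgue. r x * r x = a x"
    using \<epsilon>(2) by (eventually_elim, use \<epsilon>(1) in \<open>auto simp: s_def r_def\<close>)+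
  have sr_id: "mulop s (mulop r \<phi>) = \<phi>" "mulop r (mulop s \<phi>) = \<phi>" "mulop r (mulop r \<phi>) = mulop a \<phi>" for \<phi>
    using mulop_cong_AE[OF Linf_mult[OF sL rL] Linf_const sr, of \<phi>] mulop_cong_AE[OF Linf_mult[OF rL sL] Linf_const rs, of \<phi>]
      mulop_cong_AE[OF Linf_mult[OF rL rL] a rr, of \<phi>]
    by (simp_all add: mulop_mulop rL sL mulop_one)
  interpret s: bounded_linear "mulop s" by (rule bounded_linear_mulop[OF sL])
  \<comment> \<open>Written with \<open>s = 1 / r\<close> instead of \<open>r\<close>:
    multiplication by \<open>s\<close> is bounded thanks to \<open>\<epsilon> \<le> a x\<close>, so
    closedness reduces to that of the weak derivative.\<close>
  define V where "V = {(u, z). weak_derivative u (mulop s z)}"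
  have "subspace V"
    unfolding subspace_def V_def
    using weak_derivative_add weak_derivative_scaleR
    by (auto simp: s.add s.scaleR s.zero zero_prod_def weak_derivative_iff_cinner cinner_inner complex_eq_iff)
  moreover have "closed V"
    unfolding closed_sequential_limits
  proof (intro allI impI, elim conjE)
    fix p q assume p: "\<forall>n. p n \<in> V" and lim: "p \<longlonglongrightarrow> q"
    have "weak_derivative (fst q) (mulop s (snd q))"
    proof (rule weak_derivative_closed)
      show "weak_derivative (fst (p n)) (mulop s (snd (p n)))" for n using p by (auto simp: V_def case_prod_beta)
      show "(\<lambda>n. fst (p n)) \<longlonglongrightarrow> fst q" by (rule tendsto_fst[OF lim])
      show "(\<lambda>n. mulop s (snd (p n))) \<longlonglongrightarrow> mulop s (snd q)" by (rule s.tendsto[OF tendsto_snd[OF lim]])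
    qed
    then show "q \<in> V" by (auto simp: V_def case_prod_beta)
  qed
  ultimately obtain q where q: "q \<in> V" "\<And>v. v \<in> V \<Longrightarrow> inner ((f, 0) - q) v = 0"
    using orthogonal_projection_exists[of V "(f, 0)"] by blast
  obtain u z where uz: "q = (u, z)" by (cases q)
  have u: "weak_derivative u (mulop s z)" using q(1) by (simp add: uz V_def)
  have z: "z = mulop r (weak_deriv u)" using weak_deriv_eq[OF u] by (simp add: sr_id)
  have re: "Re (dirichlet_form a u \<theta>) = Re (cinner_L2 (f - u) \<theta>)" if \<theta>: "\<theta> \<in> W12" for \<theta>
  proof -
    have "(\<theta>, mulop r (weak_deriv \<theta>)) \<in> V"
      using weak_derivative_weak_deriv[OF \<theta>] by (simp add: V_def sr_id)
    from q(2)[OF this] have "inner (f - u) \<theta> = inner z (mulop r (weak_deriv \<theta>))" by (simp add: uz inner_simps)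
    also have "\<dots> = inner (mulop a (weak_deriv u)) (weak_deriv \<theta>)"
      by (simp add: z inner_mulop_commute[OF rL, symmetric] sr_id)
    finally show ?thesis by (simp add: dirichlet_form_mulop a inner_L2_def)
  qed
  have "dirichlet_form a u \<theta> = cinner_L2 (f - u) \<theta>" if \<theta>: "\<theta> \<in> W12" for \<theta>
  proof (rule complex_eqI)
    show "Re (dirichlet_form a u \<theta>) = Re (cinner_L2 (f - u) \<theta>)" by (rule re[OF \<theta>])
    \<comment> \<open>The projection is real orthogonal and so yields real parts only; the test
      vector \<open>\<i>\<close> times \<theta> supplies the imaginary part.\<close>
    have wi: "weak_derivative (scaleC_L2 \<i> \<theta>) (scaleC_L2 \<i> (weak_deriv \<theta>))"
      by (intro weak_derivative_scaleC weak_derivative_weak_deriv \<theta>)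
    have "Re (dirichlet_form a u (scaleC_L2 \<i> \<theta>)) = Im (dirichlet_form a u \<theta>)"
      by (simp add: dirichlet_form_mulop a weak_deriv_eq[OF wi] cinner_scaleC_right)
    then show "Im (dirichlet_form a u \<theta>) = Im (cinner_L2 (f - u) \<theta>)"
      using re[OF W12I[OF wi]] by (simp add: cinner_scaleC_right)
  qed
  then show ?thesis using W12I[OF u] by blast
qed

lemma Linf_add:
  assumes "m \<in> Linf" "n \<in> Linf" shows "(\<lambda>x. m x + n x) \<in> Linf"
proof -
  obtain K L where "K > 0" "AE x in lebesgue. \<bar>m x\<bar> \<le> K" "L > 0" "AE x in lebesgue. \<bar>n x\<bar> \<le> L"
    using Linf_bound assms by metis
  then have "AE x in lebesgue. \<bar>m x + n x\<bar> \<le> K + L"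
    by (auto elim!: eventually_elim2 simp: abs_triangle_ineq[THEN order_trans])
  then show ?thesis using assms by (auto simp: Linf_def)
qed

text \<open>\<open>resolvent\<close> is a definite description, so its value is known only after
  existence and uniqueness. For uniqueness, the difference of two solutions has form value minus its
  squared norm, while the form is nonnegative.\<close>

lemma resolvent_viscosity_approx:
  fixes f :: L2
  assumes c: "c \<in> Linf" "AE x in lebesgue. 0 \<le> c x" and \<epsilon>: "\<epsilon> > 0"
  defines "u \<equiv> resolvent (viscosity_approx c \<epsilon>) 1 f"
  shows "u \<in> W12" "\<And>\<theta>. \<theta> \<in> W12 \<Longrightarrow> dirichlet_form (\<lambda>x. c x + \<epsilon>) u \<theta> = cinner_L2 (f - u) \<theta>"
proof -
  let ?a = "\<lambda>x. c x + \<epsilon>"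
  have a: "?a \<in> Linf" by (intro Linf_add Linf_const c)
  have ae: "AE x in lebesgue. \<epsilon> \<le> ?a x" and ae0: "AE x in lebesgue. 0 \<le> ?a x"
    using c(2) by (eventually_elim, use \<epsilon> in auto)+
  obtain w where w: "w \<in> W12" "\<And>\<theta>. \<theta> \<in> W12 \<Longrightarrow> dirichlet_form ?a w \<theta> = cinner_L2 (f - w) \<theta>"
    using form_resolvent_exists[OF a \<epsilon> ae] by blast
  have uniq: "v = w" if v: "v \<in> W12" "\<And>\<theta>. \<theta> \<in> W12 \<Longrightarrow> dirichlet_form ?a v \<theta> = cinner_L2 (f - v) \<theta>" for v
  proof -
    have d: "v - w \<in> W12" using weak_derivative_diff[OF weak_derivative_weak_deriv[OF v(1)] weak_derivative_weak_deriv[OF w(1)]]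
      by (rule W12I)
    have "dirichlet_form ?a (v - w) (v - w) = cinner_L2 (f - v) (v - w) - cinner_L2 (f - w) (v - w)"
      by (simp add: dirichlet_form_diff_left[OF a v(1) w(1)] v(2)[OF d] w(2)[OF d])
    also have "\<dots> = cinner_L2 ((f - v) - (f - w)) (v - w)" by (rule cinner_diff_left[symmetric])
    also have "(f - v) - (f - w) = (-1) *\<^sub>R (v - w)" by (simp add: algebra_simps)
    finally have "Re (dirichlet_form ?a (v - w) (v - w)) = - inner (v - w) (v - w)"
      by (simp only: cinner_scaleR_left) (simp add: inner_L2_def)
    with dirichlet_form_self_nonneg[OF a ae0] have "inner (v - w) (v - w) \<le> 0" by (metis neg_0_le_iff_le)
    then have "v - w = 0" by (metis inner_ge_zero inner_eq_zero_iff order_antisym)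
    then show ?thesis by simp
  qed
  have "u = w"
    unfolding u_def resolvent_def
  proof (rule the_equality)
    show "(w, f - 1 *\<^sub>R w) \<in> viscosity_approx c \<epsilon>"
      using w by (simp add: viscosity_approx_def form_operator_def)
    show "v = w" if "(v, f - 1 *\<^sub>R v) \<in> viscosity_approx c \<epsilon>" for v
      by (rule uniq) (use that in \<open>simp_all add: viscosity_approx_def form_operator_def\<close>)
  qed
  then show "u \<in> W12" "\<And>\<theta>. \<theta> \<in> W12 \<Longrightarrow> dirichlet_form ?a u \<theta> = cinner_L2 (f - u) \<theta>"
    using w by auto
qed

subsection \<open>Logarithmic cut-off functions\<close>

text \<open>The function \<open>s\<close> of the overview when \<open>p\<close> is
  \<open>1/c\<close>.\<close>

definition tail :: "(real \<Rightarrow> real) \<Rightarrow> real \<Rightarrow> real \<Rightarrow> real" where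
  "tail p b y = integral {y..b} p"

text \<open>Formally minus the derivative of \<open>ln (1 + tail p b y)\<close>, that is the slope
  of the cut-off before normalisation.\<close>

definition weight :: "(real \<Rightarrow> real) \<Rightarrow> real \<Rightarrow> real \<Rightarrow> real" where
  "weight p b y = p y / (1 + tail p b y)"

text \<open>To be used with \<open>p\<close> equal to \<open>1/c\<close>. Boundedness of
  \<open>p\<close> away from \<open>x0\<close> makes the slope of each cut-off bounded, and
  \<open>p_div\<close> makes the normalisation tend to infinity.\<close>

context
  fixes x0 b :: real and p :: "real \<Rightarrow> real"
  assumes x0b: "x0 < b"
    and p_int: "\<And>\<delta>. x0 < \<delta> \<Longrightarrow> p absolutely_integrable_on {\<delta>..b}"
    and p_nonneg: "\<And>x. x0 < x \<Longrightarrow> x \<le> b \<Longrightarrow> 0 \<le> p x"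
    and p_bounded: "\<And>\<delta>. x0 < \<delta> \<Longrightarrow> \<exists>K. \<forall>x\<in>{\<delta>..b}. p x \<le> K"
    and p_div: "\<And>M. \<exists>\<delta>\<in>{x0<..<b}. M \<le> integral {\<delta>..b} p"
begin

lemma tail_nonneg: "x0 < y \<Longrightarrow> 0 \<le> tail p b y"
  unfolding tail_def using p_nonneg by (intro integral_nonneg set_lebesgue_integral_eq_integral(1) p_int) auto

lemma tail_split:
  assumes "x0 < x" "x \<le> y" "y \<le> b" shows "integral {x..y} p = tail p b x - tail p b y"
  using Henstock_Kurzweil_Integration.integral_combine[OF assms(2,3) set_lebesgue_integral_eq_integral(1)[OF p_int[OF assms(1)]]]
  by (simp add: tail_def)

lemma tail_antimono: "x0 < x \<Longrightarrow> x \<le> y \<Longrightarrow> y \<le> b \<Longrightarrow> tail p b y \<le> tail p b x"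
  using tail_split[of x y] integral_nonneg[of p "{x..y}"] p_nonneg
    set_lebesgue_integral_eq_integral(1)[OF absolutely_integrable_on_subinterval[OF p_int[of x], of x y]] by force

lemma weight_nonneg: "x0 < x \<Longrightarrow> x \<le> b \<Longrightarrow> 0 \<le> weight p b x"
  using p_nonneg tail_nonneg by (simp add: weight_def)

lemma weight_le: "x0 < x \<Longrightarrow> x \<le> b \<Longrightarrow> weight p b x \<le> p x"
  using p_nonneg[of x] tail_nonneg[of x] by (simp add: weight_def divide_le_eq algebra_simps)

lemma weight_integrable:
  assumes "x0 < \<delta>" shows "weight p b absolutely_integrable_on {\<delta>..b}"
proof -
  have c: "continuous_on {\<delta>..b} (\<lambda>x. 1 / (1 + tail p b x))"
    unfolding tail_def
    using tail_nonneg[unfolded tail_def] assms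
    by (intro continuous_intros indefinite_integral_continuous_1' set_lebesgue_integral_eq_integral(1) p_int)
      (auto simp: add_nonneg_eq_0_iff)
  have "(\<lambda>x. 1 / (1 + tail p b x) * p x) absolutely_integrable_on {\<delta>..b}"
  proof (rule absolutely_integrable_bounded_measurable_product_real)
    show "(\<lambda>x. 1 / (1 + tail p b x)) \<in> borel_measurable (lebesgue_on {\<delta>..b})"
      by (rule continuous_imp_measurable_on_sets_lebesgue[OF c]) simp
    show "bounded ((\<lambda>x. 1 / (1 + tail p b x)) ` {\<delta>..b})"
      by (intro compact_imp_bounded compact_continuous_image c compact_Icc)
  qed (use assms in \<open>auto intro: p_int\<close>)
  then show ?thesis unfolding weight_def by (simp add: mult.commute)
qed

text \<open>The tail is largest at the left end, so freezing the denominator there bounds the weight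
  from below.\<close>

lemma weight_step:
  assumes "x0 < \<delta>'" "\<delta>' \<le> \<delta>" "\<delta> \<le> b"
  shows "(tail p b \<delta>' - tail p b \<delta>) / (1 + tail p b \<delta>') \<le> integral {\<delta>'..\<delta>} (weight p b)"
proof -
  have i: "p integrable_on {\<delta>'..\<delta>}" "weight p b integrable_on {\<delta>'..\<delta>}"
    using assms by (auto intro!: set_lebesgue_integral_eq_integral(1) absolutely_integrable_on_subinterval[OF p_int[of \<delta>']]
        absolutely_integrable_on_subinterval[OF weight_integrable[of \<delta>']])
  have "(tail p b \<delta>' - tail p b \<delta>) / (1 + tail p b \<delta>') = integral {\<delta>'..\<delta>} (\<lambda>x. p x / (1 + tail p b \<delta>'))"
    using tail_split[OF assms] by simp
  also have "\<dots> \<le> integral {\<delta>'..\<delta>} (weight p b)"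
  proof (rule integral_le)
    show "(\<lambda>x. p x / (1 + tail p b \<delta>')) integrable_on {\<delta>'..\<delta>}"
      by (rule integrable_on_divide[OF i(1)])
    show "p x / (1 + tail p b \<delta>') \<le> weight p b x" if "x \<in> {\<delta>'..\<delta>}" for x
      unfolding weight_def using that assms p_nonneg[of x] tail_antimono[of \<delta>' x] tail_nonneg[of x] tail_nonneg[of \<delta>']
      by (intro divide_left_mono mult_pos_pos) auto
  qed (rule i)
  finally show ?thesis .
qed

text \<open>Doubling \<open>1 + tail\<close> adds at least \<open>1/2\<close> to the integral of \<open>weight\<close>; this replaces the chain
  rule for \<open>ln (1 + tail)\<close>.\<close>

lemma weight_divergent: "\<exists>\<delta>\<in>{x0<..<b}. M \<le> integral {\<delta>..b} (weight p b)"
proof -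
  have *: "\<exists>\<delta>\<in>{x0<..<b}. real n / 2 \<le> integral {\<delta>..b} (weight p b)" for n
  proof (induction n)
    case 0
    have "0 \<le> integral {(x0 + b) / 2..b} (weight p b)"
      using x0b weight_nonneg by (intro integral_nonneg set_lebesgue_integral_eq_integral(1) weight_integrable) auto
    then show ?case using x0b by (intro bexI[of _ "(x0 + b) / 2"]) auto
  next
    case (Suc n)
    then obtain \<delta> where \<delta>: "x0 < \<delta>" "\<delta> < b" "real n / 2 \<le> integral {\<delta>..b} (weight p b)" by auto
    obtain \<delta>' where \<delta>': "x0 < \<delta>'" "\<delta>' < b" "2 * tail p b \<delta> + 1 \<le> tail p b \<delta>'"
      using p_div[of "2 * tail p b \<delta> + 1"] by (auto simp: tail_def)
    have t: "0 \<le> tail p b \<delta>" using tail_nonneg \<delta> by simp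
    have le: "\<delta>' \<le> \<delta>"
      using tail_antimono[of \<delta> \<delta>'] \<delta> \<delta>' t by linarith
    have "1 / 2 \<le> (tail p b \<delta>' - tail p b \<delta>) / (1 + tail p b \<delta>')" using \<delta>'(3) t by (simp add: field_simps)
    also have "\<dots> \<le> integral {\<delta>'..\<delta>} (weight p b)" using weight_step[of \<delta>' \<delta>] \<delta>' \<delta> le by simp
    finally have "1 / 2 \<le> integral {\<delta>'..\<delta>} (weight p b)" .
    moreover have "integral {\<delta>'..\<delta>} (weight p b) + integral {\<delta>..b} (weight p b) = integral {\<delta>'..b} (weight p b)"
      using le \<delta> \<delta>' by (intro Henstock_Kurzweil_Integration.integral_combine set_lebesgue_integral_eq_integral(1) weight_integrable) auto
    ultimately have "real (Suc n) / 2 \<le> integral {\<delta>'..b} (weight p b)" using \<delta>(3) by (simp add: add_divide_distrib)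
    then show ?case using \<delta>' by auto
  qed
  obtain n where "2 * M < real n" using reals_Archimedean2 by blast
  then have "M \<le> real n / 2" by simp
  then show ?thesis using *[of n] order_trans by blast
qed

text \<open>\<open>m\<close> is the primitive of \<open>k\<close> that vanishes at
  \<open>\<delta>\<close>, and division by \<open>L\<close> makes it reach 1 at \<open>b\<close>.
  The last clause does not involve \<open>\<delta>\<close> except through \<open>L\<close>; it gives
  convergence to the indicator of \<open>(x0, \<infinity>)\<close> at each fixed point as
  \<open>L\<close> grows.\<close>

lemma cutoff_exists:
  assumes \<delta>: "x0 < \<delta>" "\<delta> < b" and L: "L = integral {\<delta>..b} (weight p b)" "L > 0"
  defines "k \<equiv> (\<lambda>x. if \<delta> < x \<and> x < b then weight p b x / L else 0)"
  shows "\<exists>m. k \<in> Linf \<and> m \<in> Linf \<and> primitive (\<lambda>x. of_real (m x)) (\<lambda>x. of_real (k x)) \<and>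
    (\<forall>x. 0 \<le> m x \<and> m x \<le> 1) \<and> (\<forall>x\<le>x0. m x = 0) \<and> (\<forall>x\<ge>b. m x = 1) \<and>
    (\<forall>x. x0 < x \<longrightarrow> x < b \<longrightarrow> 1 - m x \<le> integral {x..b} (weight p b) / L)"
proof -
  have wi: "weight p b absolutely_integrable_on {\<delta><..<b}"
    by (rule set_integrable_subset[OF weight_integrable[OF \<delta>(1)]]) auto
  have k_ind: "k = (\<lambda>x. (indicat_real {\<delta><..<b} x *\<^sub>R weight p b x) / L)"
    by (auto simp: k_def indicator_def)
  have km[measurable]: "k \<in> borel_measurable lebesgue"
    unfolding k_ind using wi by (intro borel_measurable_divide borel_measurable_integrable) (auto simp: set_integrable_def)
  obtain K where K: "\<And>x. x \<in> {\<delta>..b} \<Longrightarrow> p x \<le> K" using p_bounded[OF \<delta>(1)] by blast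
  have k0: "0 \<le> k x" for x using weight_nonneg[of x] L(2) \<delta> by (simp add: k_def)
  have kb: "\<bar>k x\<bar> \<le> \<bar>K\<bar> / L" for x
    using k0[of x] weight_le[of x] K[of x] \<delta> L(2) by (auto simp: k_def intro!: divide_right_mono)
  have kL: "k \<in> Linf" using kb by (auto simp: Linf_def)
  have kint: "k absolutely_integrable_on {x..y}" for x y
    by (rule measurable_bounded_by_integrable_imp_absolutely_integrable[where g = "\<lambda>x. \<bar>K\<bar> / L"])
      (use kb measurable_restrict_space1[OF km] in auto)
  have "locally_integrable (\<lambda>x. of_real (k x))"
    unfolding locally_integrable_def
    using kint by (auto intro!: absolutely_integrable_linear[OF _ bounded_linear_of_real, unfolded o_def])
  then obtain F where F: "primitive F (\<lambda>x. complex_of_real (k x))" using primitive_exists by blast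
  \<comment> \<open>Increments of \<open>F\<close> are real, being integrals of \<open>k\<close>, so
    taking the real part loses nothing.\<close>
  define m where "m x = Re (F x - F \<delta>)" for x
  have F_diff: "F y - F x = of_real (integral {x..y} k)" if "x \<le> y" for x y
  proof -
    have "(k has_integral integral {x..y} k) {x..y}" using kint set_lebesgue_integral_eq_integral(1) by blast
    from has_integral_linear[OF this bounded_linear_of_real[where 'a = complex]]
    show ?thesis using F that by (simp add: primitive_def o_def integral_unique)
  qed
  have Fm: "F x - F \<delta> = of_real (m x)" for x
    using F_diff[of x \<delta>] F_diff[of \<delta> x] by (cases "x \<le> \<delta>") (auto simp: m_def complex_eq_iff algebra_simps)
  have m_diff: "m y - m x = integral {x..y} k" if "x \<le> y" for x y
  proof -
    have "m y - m x = Re (F y - F x)" by (simp add: m_def)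
    then show ?thesis by (simp add: F_diff[OF that])
  qed
  have prim: "primitive (\<lambda>x. of_real (m x)) (\<lambda>x. of_real (k x))"
    using primitive_add_const[OF F, of "- F \<delta>"] by (simp add: Fm)
  have mono: "m x \<le> m y" if "x \<le> y" for x y
    using m_diff[OF that] integral_nonneg[OF set_lebesgue_integral_eq_integral(1)[OF kint] k0, of x y] by simp
  have left: "m x = 0" if "x \<le> \<delta>" for x
  proof -
    have "integral {x..\<delta>} k = integral {x..\<delta>} (\<lambda>x. 0)" by (rule integral_cong) (auto simp: k_def)
    moreover have "m \<delta> = 0" by (simp add: m_def)
    ultimately show ?thesis using m_diff[OF that] by simp
  qed
  have up: "1 - m x = integral {x..b} (weight p b) / L \<and> m b = 1" if "\<delta> \<le> x" "x \<le> b" for x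
  proof -
    have int: "integral {y..b} k = integral {y..b} (weight p b) / L" if "\<delta> \<le> y" for y
    proof -
      have "integral {y..b} k = integral {y<..<b} k" by (simp add: integral_open_interval_real)
      also have "\<dots> = integral {y<..<b} (\<lambda>x. weight p b x / L)" by (rule integral_cong) (use that in \<open>auto simp: k_def\<close>)
      also have "\<dots> = integral {y..b} (weight p b) / L" by (simp add: integral_open_interval_real)
      finally show ?thesis .
    qed
    have "m b = 1" using m_diff[of \<delta> b] int[of \<delta>] L \<delta> left[of \<delta>] by simp
    then show ?thesis using m_diff[of x b] int[of x] that by simp
  qed
  have mb: "m b = 1" using up[of \<delta>] \<delta> by simp
  have right: "m x = 1" if "b \<le> x" for x
  proof -
    have "integral {b..x} k = integral {b..x} (\<lambda>x. 0)" by (rule integral_cong) (auto simp: k_def)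
    then show ?thesis using m_diff[OF that] mb by simp
  qed
  have m01: "0 \<le> m x \<and> m x \<le> 1" for x
  proof
    show "0 \<le> m x" using left[of x] left[of \<delta>] mono[of \<delta> x] by (cases "x \<le> \<delta>") auto
    show "m x \<le> 1" using right[of x] right[of b] mono[of x b] by (cases "b \<le> x") auto
  qed
  have "m = (\<lambda>x. Re (of_real (m x)))" by simp
  also have "\<dots> \<in> borel_measurable lebesgue"
    by (rule measurable_compose[OF primitive_measurable[OF prim] borel_measurable_Re])
  finally have mL: "m \<in> Linf" using m01 unfolding Linf_def by (auto intro!: exI[of _ 1] always_eventually)
  have low: "1 - m x \<le> integral {x..b} (weight p b) / L" if x: "x0 < x" "x < b" for x
  proof (cases "\<delta> \<le> x")
    case True then show ?thesis using up[of x] x by simp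
  next
    \<comment> \<open>To the left of \<open>\<delta>\<close> the right-hand side is at least 1,
      since its integral contains the one defining \<open>L\<close>.\<close>
    case False
    have "L \<le> integral {x..b} (weight p b)"
      unfolding L(1)
      by (rule integral_subset_le)
        (use False x \<delta> in \<open>auto intro!: set_lebesgue_integral_eq_integral(1) weight_integrable weight_nonneg\<close>)
    then have "1 \<le> integral {x..b} (weight p b) / L" using L(2) by simp
    then show ?thesis using m01[of x] by linarith
  qed
  show ?thesis
    by (intro exI[of _ m] conjI kL mL prim) (use m01 left right low \<delta> in auto)
qed

end

subsection \<open>Energy estimates\<close>

lemma integrable_mult_norm_sq:
  assumes "a \<in> Linf" shows "integrable lebesgue (\<lambda>x. a x * (cmod (rep_L2 \<phi> x))\<^sup>2)"
proof -
  obtain K where K: "K > 0" "AE x in lebesgue. \<bar>a x\<bar> \<le> K" using Linf_bound[OF assms] by metis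
  have [measurable]: "a \<in> borel_measurable lebesgue" by (rule Linf_measurable[OF assms])
  show ?thesis
  proof (rule Bochner_Integration.integrable_bound)
    show "integrable lebesgue (\<lambda>x. K * (cmod (rep_L2 \<phi> x))\<^sup>2)" using integrable_norm_rep_sq by simp
    show "AE x in lebesgue. norm (a x * (cmod (rep_L2 \<phi> x))\<^sup>2) \<le> norm (K * (cmod (rep_L2 \<phi> x))\<^sup>2)"
      using K(2) by eventually_elim (use K(1) in \<open>auto simp: abs_mult intro!: mult_right_mono\<close>)
  qed measurable
qed

lemma inner_mulop:
  assumes "m \<in> Linf"
  shows "inner (mulop m \<phi>) \<psi> = (LINT x|lebesgue. m x * Re (rep_L2 \<phi> x * cnj (rep_L2 \<psi> x)))"
    "integrable lebesgue (\<lambda>x. m x * Re (rep_L2 \<phi> x * cnj (rep_L2 \<psi> x)))"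
proof -
  have [measurable]: "m \<in> borel_measurable lebesgue" by (rule Linf_measurable[OF assms])
  have [measurable]: "cnj \<in> borel_measurable borel"
    by (intro borel_measurable_continuous_onI continuous_intros)
  have ae: "AE x in lebesgue. Re (rep_L2 (mulop m \<phi>) x * cnj (rep_L2 \<psi> x)) = m x * Re (rep_L2 \<phi> x * cnj (rep_L2 \<psi> x))"
    using rep_mulop[OF assms, of \<phi>] by eventually_elim (simp add: algebra_simps)
  show "inner (mulop m \<phi>) \<psi> = (LINT x|lebesgue. m x * Re (rep_L2 \<phi> x * cnj (rep_L2 \<psi> x)))"
    unfolding inner_L2_rep by (rule integral_cong_AE) (use ae in auto)
  have "integrable lebesgue (\<lambda>x. Re (rep_L2 (mulop m \<phi>) x * cnj (rep_L2 \<psi> x)))"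
    by (rule integrable_Re[OF integrable_rep_cnj])
  then show "integrable lebesgue (\<lambda>x. m x * Re (rep_L2 \<phi> x * cnj (rep_L2 \<psi> x)))"
    by (subst (asm) integrable_cong_AE[OF _ _ ae]) auto
qed

text \<open>Testing with \<open>m u\<close> produces the integrals of \<open>m a |u'|^2\<close>,
  which is nonnegative and dropped, and of the cross term \<open>k a u' cnj u\<close>. Young's
  inequality with parameter \<open>\<tau>\<close> splits the latter into the energy
  \<open>inner v u\<close> and the cut-off error.\<close>

lemma form_cutoff_lower_bound:
  assumes a: "a \<in> Linf" "AE x in lebesgue. 0 \<le> a x"
    and u: "u \<in> W12" "\<And>\<theta>. \<theta> \<in> W12 \<Longrightarrow> dirichlet_form a u \<theta> = cinner_L2 v \<theta>"
    and m: "m \<in> Linf" "k \<in> Linf" "primitive (\<lambda>x. of_real (m x)) (\<lambda>x. of_real (k x))" "\<And>x. 0 \<le> m x"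
    and \<tau>: "\<tau> > 0"
  shows "inner v (mulop m u) \<ge>
    - (\<tau> * inner v u + (LINT x|lebesgue. a x * (k x)\<^sup>2 * (cmod (rep_L2 u x))\<^sup>2) / \<tau>) / 2"
proof -
  define u' where "u' = weak_deriv u"
  have wd: "weak_derivative (mulop m u) (mulop k u + mulop m u')"
    unfolding u'_def by (intro weak_derivative_mulop weak_derivative_weak_deriv u m)
  have A: "inner v u = (LINT x|lebesgue. a x * (cmod (rep_L2 u' x))\<^sup>2)"
    using u(2)[OF u(1)] dirichlet_form_self[of a u] unfolding inner_L2_def u'_def by (metis Re_complex_of_real)
  have "inner v (mulop m u) = Re (dirichlet_form a u (mulop m u))"
    using u(2)[OF W12I[OF wd]] by (simp add: inner_L2_def)
  also have "\<dots> = inner (mulop a u') (mulop k u + mulop m u')"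
    by (simp add: dirichlet_form_mulop a weak_deriv_eq[OF wd] u'_def inner_L2_def)
  finally have eq: "inner v (mulop m u) = inner (mulop (\<lambda>x. k x * a x) u') u + inner (mulop (\<lambda>x. m x * a x) u') u'"
    by (simp add: inner_add_right inner_mulop_commute[OF m(1), symmetric] inner_mulop_commute[OF m(2), symmetric] mulop_mulop a m)
  have "inner (mulop (\<lambda>x. m x * a x) u') u' \<ge> 0"
    unfolding inner_mulop(1)[OF Linf_mult[OF m(1) a(1)]] complex_mult_cnj Re_complex_of_real
    using a(2) m(4) by (intro integral_nonneg_AE) (auto elim: eventually_mono)
  then have 1: "inner v (mulop m u) \<ge> inner (mulop (\<lambda>x. k x * a x) u') u" by (simp add: eq)
  note kk = Linf_mult[OF a(1) Linf_mult[OF m(2) m(2)]]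
  have i2: "integrable lebesgue (\<lambda>x. a x * (k x)\<^sup>2 * (cmod (rep_L2 u x))\<^sup>2)"
    using integrable_mult_norm_sq[OF kk, of u] by (simp add: power2_eq_square mult.assoc)
  have "- (\<tau> * inner v u + (LINT x|lebesgue. a x * (k x)\<^sup>2 * (cmod (rep_L2 u x))\<^sup>2) / \<tau>) / 2 =
     (LINT x|lebesgue. - (\<tau> * (a x * (cmod (rep_L2 u' x))\<^sup>2) + a x * (k x)\<^sup>2 * (cmod (rep_L2 u x))\<^sup>2 / \<tau>) / 2)"
    unfolding A using i2 integrable_mult_norm_sq[OF a(1), of u'] by simp
  also have "\<dots> \<le> inner (mulop (\<lambda>x. k x * a x) u') u"
    unfolding inner_mulop(1)[OF Linf_mult[OF m(2) a(1)]]
  proof (rule integral_mono_AE)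
    show "integrable lebesgue (\<lambda>x. - (\<tau> * (a x * (cmod (rep_L2 u' x))\<^sup>2) + a x * (k x)\<^sup>2 * (cmod (rep_L2 u x))\<^sup>2 / \<tau>) / 2)"
      using i2 integrable_mult_norm_sq[OF a(1), of u'] by simp
    show "integrable lebesgue (\<lambda>x. k x * a x * Re (rep_L2 u' x * cnj (rep_L2 u x)))"
      by (rule inner_mulop(2)[OF Linf_mult[OF m(2) a(1)]])
    show "AE x in lebesgue. - (\<tau> * (a x * (cmod (rep_L2 u' x))\<^sup>2) + a x * (k x)\<^sup>2 * (cmod (rep_L2 u x))\<^sup>2 / \<tau>) / 2
        \<le> k x * a x * Re (rep_L2 u' x * cnj (rep_L2 u x))"
      using a(2)
    proof eventually_elim
      case (elim x)
      define y where "y = cmod (rep_L2 u' x)"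
      define z where "z = cmod (rep_L2 u x)"
      have "\<bar>Re (rep_L2 u' x * cnj (rep_L2 u x))\<bar> \<le> y * z"
        using abs_Re_le_cmod[of "rep_L2 u' x * cnj (rep_L2 u x)"] by (simp add: norm_mult y_def z_def)
      then have "\<bar>k x * Re (rep_L2 u' x * cnj (rep_L2 u x))\<bar> \<le> \<bar>k x\<bar> * (y * z)"
        unfolding abs_mult by (intro mult_left_mono) auto
      moreover have "2 * (\<bar>k x\<bar> * (y * z)) \<le> \<tau> * y\<^sup>2 + (k x)\<^sup>2 * z\<^sup>2 / \<tau>"
      proof -
        have "0 \<le> (\<tau> * y - \<bar>k x\<bar> * z)\<^sup>2 / \<tau>" using \<tau> by simp
        also have "\<dots> = \<tau> * y\<^sup>2 + (k x)\<^sup>2 * z\<^sup>2 / \<tau> - 2 * (\<bar>k x\<bar> * (y * z))"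
          using \<tau> by (simp add: field_simps power2_eq_square)
        finally show ?thesis by simp
      qed
      ultimately have "- (\<tau> * y\<^sup>2 + (k x)\<^sup>2 * z\<^sup>2 / \<tau>) / 2 \<le> k x * Re (rep_L2 u' x * cnj (rep_L2 u x))"
      proof -
        have "- E / 2 \<le> R" if "\<bar>R\<bar> \<le> W" "2 * W \<le> E" for R W E :: real using that by linarith
        then show "\<lbrakk>\<bar>k x * Re (rep_L2 u' x * cnj (rep_L2 u x))\<bar> \<le> \<bar>k x\<bar> * (y * z);
            2 * (\<bar>k x\<bar> * (y * z)) \<le> \<tau> * y\<^sup>2 + (k x)\<^sup>2 * z\<^sup>2 / \<tau>\<rbrakk> \<Longrightarrow> ?thesis" by blast
      qed
      from mult_left_mono[OF this elim] show ?case
        by (simp add: y_def z_def algebra_simps)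
    qed
  qed
  finally show ?thesis using 1 by linarith
qed

text \<open>Start from a point \<open>y\<close> of \<open>{b..e}\<close> where \<open>u\<close> is
  controlled by its norm and integrate \<open>|u'|\<close> from \<open>x\<close> to
  \<open>y\<close>. The coefficient \<open>a\<close> enters only through
  \<open>c x \<le> a x\<close> and the energy bound \<open>A\<close>, which makes the result uniform
  in \<epsilon> when \<open>a\<close> is \<open>c\<close> plus \<epsilon>.\<close>

lemma W12_pointwise_bound:
  assumes u: "weak_derivative u u'" and a: "a \<in> Linf"
    and c: "\<And>x. x0 < x \<Longrightarrow> x \<le> e \<Longrightarrow> 0 < c x \<and> c x \<le> a x" and a0: "AE x in lebesgue. 0 \<le> a x"
    and p: "\<And>\<delta>. x0 < \<delta> \<Longrightarrow> (\<lambda>x. inverse (c x)) absolutely_integrable_on {\<delta>..e}"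
    and be: "x0 < b" "b < e"
    and A: "(LINT x|lebesgue. a x * (cmod (rep_L2 u' x))\<^sup>2) \<le> A" and N: "(norm u)\<^sup>2 \<le> N"
  shows "AE x in lebesgue. x0 < x \<and> x \<le> b \<longrightarrow> (cmod (rep_L2 u x))\<^sup>2 \<le>
    (sqrt (N / (e - b) + 1) + (A + 1 + integral {b..e} (\<lambda>x. inverse (c x))) / 2)\<^sup>2 * (1 + integral {x..b} (\<lambda>x. inverse (c x)))"
proof -
  obtain F where F: "primitive F (rep_L2 u')" "AE x in lebesgue. rep_L2 u x = F x"
    using u by (auto simp: weak_derivative_iff_primitive)
  let ?p = "\<lambda>x. inverse (c x)"
  define B where "B = integral {b..e} ?p"
  have B0: "B \<ge> 0" unfolding B_def using be c
    by (intro integral_nonneg set_lebesgue_integral_eq_integral(1) p) (auto simp: less_imp_le)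
  have A0: "A \<ge> 0" using A a0 by (intro order_trans[OF _ A] integral_nonneg_AE) (auto elim: eventually_mono)
  have N0: "N \<ge> 0" using N by (rule order_trans[rotated]) simp
  have ca: "continuous_on UNIV F" by (rule primitive_continuous[OF F(1)])
  \<comment> \<open>An average argument: otherwise the squared norm over \<open>{b..e}\<close> alone
    would be at least \<open>N + (e - b)\<close>.\<close>
  have "\<exists>y\<in>{b..e}. (cmod (F y))\<^sup>2 \<le> N / (e - b) + 1"
  proof (rule ccontr)
    assume "\<not> ?thesis"
    then have *: "N / (e - b) + 1 \<le> (cmod (F y))\<^sup>2" if "y \<in> {b..e}" for y using that by force
    have ind: "integrable lebesgue (indicat_real {b..e})" by (simp add: emeasure_lborel_Icc_eq)
    have "(e - b) * (N / (e - b) + 1) = (LINT x|lebesgue. indicat_real {b..e} x * (N / (e - b) + 1))"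
      using be by simp
    also have "\<dots> \<le> (LINT x|lebesgue. (cmod (rep_L2 u x))\<^sup>2)"
    proof (rule integral_mono_AE)
      show "integrable lebesgue (\<lambda>x. indicat_real {b..e} x * (N / (e - b) + 1))" using ind by simp
      show "AE x in lebesgue. indicat_real {b..e} x * (N / (e - b) + 1) \<le> (cmod (rep_L2 u x))\<^sup>2"
        using F(2) by eventually_elim (use * in \<open>auto simp: indicator_def\<close>)
    qed (rule integrable_norm_rep_sq)
    also have "\<dots> \<le> N" using N by (simp add: norm_L2_rep)
    finally have "(e - b) * (N / (e - b)) + (e - b) \<le> N" by (simp add: distrib_left)
    then show False using be by simp
  qed
  then obtain y where y: "b \<le> y" "y \<le> e" "(cmod (F y))\<^sup>2 \<le> N / (e - b) + 1" by auto
  have main: "(cmod (F x))\<^sup>2 \<le> (sqrt (N / (e - b) + 1) + (A + 1 + B) / 2)\<^sup>2 * (1 + integral {x..b} ?p)"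
    if x: "x0 < x" "x \<le> b" for x
  proof -
    define s where "s = integral {x..b} ?p"
    have pi: "?p absolutely_integrable_on {x..e}" using x p by simp
    have s0: "s \<ge> 0" unfolding s_def using x be c
      by (intro integral_nonneg set_lebesgue_integral_eq_integral(1) absolutely_integrable_on_subinterval[OF pi]) (auto simp: less_imp_le)
    \<comment> \<open>Balances Young's inequality: the energy contributes \<open>\<mu> A\<close> and
      \<open>1/c\<close> contributes \<open>(s + B) / \<mu>\<close>, each at most a constant times
      \<open>sqrt (1 + s)\<close>.\<close>
    define \<mu> where "\<mu> = sqrt (1 + s)"
    have l: "\<mu> \<ge> 1" "\<mu>\<^sup>2 = 1 + s" using s0 by (auto simp: \<mu>_def)
    have pix: "?p integrable_on {x..y}" using x y
      by (intro set_lebesgue_integral_eq_integral(1) absolutely_integrable_on_subinterval[OF pi]) auto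
    have ai: "(\<lambda>x. a x * (cmod (rep_L2 u' x))\<^sup>2) absolutely_integrable_on {x..y}"
      using integrable_mult_norm_sq[OF a, of u'] unfolding set_integrable_def
      by (intro integrable_mult_indicator) auto
    have ui: "rep_L2 u' absolutely_integrable_on {x..y}" using locally_integrable_rep by (simp add: locally_integrable_def)
    have "integral {x..y} (\<lambda>t. cmod (rep_L2 u' t)) \<le> integral {x..y} (\<lambda>t. (\<mu> * (a t * (cmod (rep_L2 u' t))\<^sup>2) + ?p t / \<mu>) / 2)"
    proof (rule integral_le)
      show "(\<lambda>t. cmod (rep_L2 u' t)) integrable_on {x..y}"
        using ui by (simp add: absolutely_integrable_on_def)
      show "(\<lambda>t. (\<mu> * (a t * (cmod (rep_L2 u' t))\<^sup>2) + ?p t / \<mu>) / 2) integrable_on {x..y}"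
        using set_lebesgue_integral_eq_integral(1)[OF ai] pix
        by (intro integrable_on_divide integrable_add integrable_on_mult_right) auto
      fix t assume t: "t \<in> {x..y}"
      define z where "z = cmod (rep_L2 u' t)"
      have ct: "0 < c t" "c t \<le> a t" using c[of t] t x y by auto
      have "0 \<le> (\<mu> * c t * z - 1)\<^sup>2 / (\<mu> * c t)" using ct l by simp
      also have "\<dots> = \<mu> * (c t * z\<^sup>2) + ?p t / \<mu> - 2 * z"
        using ct l by (simp add: field_simps power2_eq_square)
      finally have "2 * z \<le> \<mu> * (c t * z\<^sup>2) + ?p t / \<mu>" by simp
      also have "\<dots> \<le> \<mu> * (a t * z\<^sup>2) + ?p t / \<mu>"
        using ct l by (intro add_right_mono mult_left_mono mult_right_mono) auto
      finally show "cmod (rep_L2 u' t) \<le> (\<mu> * (a t * (cmod (rep_L2 u' t))\<^sup>2) + ?p t / \<mu>) / 2" by (simp add: z_def)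
    qed
    also have "\<dots> = (\<mu> * integral {x..y} (\<lambda>t. a t * (cmod (rep_L2 u' t))\<^sup>2) + integral {x..y} ?p / \<mu>) / 2"
      using set_lebesgue_integral_eq_integral(1)[OF ai] pix
      by (intro integral_unique has_integral_divide has_integral_add has_integral_mult_right integrable_integral)
    also have "\<dots> \<le> (\<mu> * A + (s + B) / \<mu>) / 2"
    proof -
      have "integral {x..y} (\<lambda>t. a t * (cmod (rep_L2 u' t))\<^sup>2) = (LINT t|lebesgue. indicat_real {x..y} t *\<^sub>R (a t * (cmod (rep_L2 u' t))\<^sup>2))"
        using set_lebesgue_integral_eq_integral(2)[OF ai] by (simp add: set_lebesgue_integral_def)
      also have "\<dots> \<le> (LINT t|lebesgue. a t * (cmod (rep_L2 u' t))\<^sup>2)"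
        using a0 ai integrable_mult_norm_sq[OF a, of u']
        by (intro integral_mono_AE) (auto simp: set_integrable_def indicator_def elim: eventually_mono)
      finally have 1: "integral {x..y} (\<lambda>t. a t * (cmod (rep_L2 u' t))\<^sup>2) \<le> A" using A by simp
      have "integral {x..y} ?p \<le> integral {x..e} ?p"
        using x y c by (intro integral_subset_le pix set_lebesgue_integral_eq_integral(1)[OF pi]) (auto simp: less_imp_le)
      also have "\<dots> = s + B" unfolding s_def B_def using x be
        by (intro Henstock_Kurzweil_Integration.integral_combine[symmetric] set_lebesgue_integral_eq_integral(1)[OF pi]) auto
      finally show ?thesis using 1 l by (intro divide_right_mono add_mono mult_left_mono) auto
    qed
    also have "\<dots> \<le> (A + 1 + B) / 2 * \<mu>"
    proof -
      have "s / \<mu> \<le> \<mu>" using l by (simp add: divide_le_eq power2_eq_square)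
      moreover have "B / \<mu> \<le> B * \<mu>"
        using mult_left_mono[of "inverse \<mu>" \<mu> B] B0 l inverse_le_1_iff[of \<mu>] by (simp add: divide_inverse)
      ultimately show ?thesis by (simp add: add_divide_distrib algebra_simps)
    qed
    finally have int: "integral {x..y} (\<lambda>t. cmod (rep_L2 u' t)) \<le> (A + 1 + B) / 2 * \<mu>" .
    have diff: "F y - F x = integral {x..y} (rep_L2 u')" using F(1) x y by (simp add: primitive_def)
    have "norm (F y - F x) \<le> integral {x..y} (\<lambda>t. cmod (rep_L2 u' t))"
      unfolding diff by (rule integral_norm_bound_integral) (use ui in \<open>auto simp: absolutely_integrable_on_def\<close>)
    then have "cmod (F x) \<le> cmod (F y) + (A + 1 + B) / 2 * \<mu>"
      using int norm_triangle_sub[of "F x" "F y"] norm_minus_commute[of "F x" "F y"] by linarith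
    also have "cmod (F y) \<le> sqrt (N / (e - b) + 1) * \<mu>"
    proof -
      have "cmod (F y) \<le> sqrt (N / (e - b) + 1)" using y(3) real_le_rsqrt by blast
      also have "\<dots> \<le> sqrt (N / (e - b) + 1) * \<mu>" using l N0 be mult_left_mono[of 1 \<mu> "sqrt (N / (e - b) + 1)"] by simp
      finally show ?thesis .
    qed
    finally have "cmod (F x) \<le> (sqrt (N / (e - b) + 1) + (A + 1 + B) / 2) * \<mu>" by (simp add: distrib_right)
    then have "(cmod (F x))\<^sup>2 \<le> ((sqrt (N / (e - b) + 1) + (A + 1 + B) / 2) * \<mu>)\<^sup>2" by (rule power_mono) simp
    then show ?thesis by (simp add: power_mult_distrib l s_def)
  qed
  show ?thesis using F(2) by eventually_elim (use main in \<open>simp add: B_def\<close>)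
qed

subsection \<open>Localisation of the viscosity operator\<close>

text \<open>Passes from the extended integral over the half-open interval to unbounded finite
  integrals: by Fatou along points decreasing to \<open>x0\<close>, a common bound \<open>M\<close>
  would make the former finite.\<close>

lemma integral_diverges_at_left:
  fixes p :: "real \<Rightarrow> real"
  assumes int: "\<And>\<delta>. x0 < \<delta> \<Longrightarrow> p absolutely_integrable_on {\<delta>..e}"
    and nonneg: "\<And>x. x0 < x \<Longrightarrow> x \<le> e \<Longrightarrow> 0 \<le> p x"
    and be: "x0 < b" "b < e"
    and div: "(\<integral>\<^sup>+x\<in>{x0<..e}. ennreal (p x) \<partial>lebesgue) = \<infinity>"
  shows "\<exists>\<delta>\<in>{x0<..<b}. M \<le> integral {\<delta>..b} p"
proof (rule ccontr)
  assume neg: "\<not> ?thesis"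
  \<comment> \<open>The shift by 2 keeps the first point strictly below \<open>b\<close>.\<close>
  define d where "d n = x0 + (b - x0) / real (n + 2)" for n
  have d: "x0 < d n" "d n < b" for n
  proof -
    have "(b - x0) / real (n + 2) < b - x0"
      using mult_strict_left_mono[of 1 "real (n + 2)" "b - x0"] be by (simp add: pos_divide_less_eq)
    then show "x0 < d n" "d n < b" using be by (auto simp: d_def)
  qed
  have lim: "d \<longlonglongrightarrow> x0"
  proof -
    have "(\<lambda>n. x0 + (b - x0) * inverse (real (n + 2))) \<longlonglongrightarrow> x0 + (b - x0) * 0"
      by (intro tendsto_intros LIMSEQ_ignore_initial_segment[OF tendsto_inverse_0_at_top[OF filterlim_real_sequentially]])
    then show ?thesis by (simp add: d_def[abs_def] divide_inverse)
  qed
  have pi: "integrable lebesgue (\<lambda>x. indicat_real {\<delta>..e} x * p x)" if "x0 < \<delta>" for \<delta>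
    using int[OF that] by (simp add: set_integrable_def)
  have "(\<integral>\<^sup>+x\<in>{x0<..e}. ennreal (p x) \<partial>lebesgue) =
      (\<integral>\<^sup>+x. liminf (\<lambda>n. ennreal (indicat_real {d n..e} x * p x)) \<partial>lebesgue)"
  proof (rule nn_integral_cong)
    fix x
    have "(\<lambda>n. ennreal (indicat_real {d n..e} x * p x)) \<longlonglongrightarrow> ennreal (p x) * indicator {x0<..e} x"
    proof (rule tendsto_eventually)
      show "\<forall>\<^sub>F n in sequentially. ennreal (indicat_real {d n..e} x * p x) = ennreal (p x) * indicator {x0<..e} x"
      proof (cases "x0 < x")
        case True
        then have "\<forall>\<^sub>F n in sequentially. d n < x" by (rule order_tendstoD(2)[OF lim])
        then show ?thesis by eventually_elim (use True in \<open>auto simp: indicator_def\<close>)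
      next
        case False
        then have "indicat_real {d n..e} x = 0" for n using d(1)[of n] by (auto simp: indicator_def)
        then show ?thesis using False by (intro always_eventually) simp
      qed
    qed
    then show "ennreal (p x) * indicator {x0<..e} x = liminf (\<lambda>n. ennreal (indicat_real {d n..e} x * p x))"
      by (intro lim_imp_Liminf[symmetric]) auto
  qed
  also have "\<dots> \<le> liminf (\<lambda>n. \<integral>\<^sup>+x. ennreal (indicat_real {d n..e} x * p x) \<partial>lebesgue)"
    using borel_measurable_integrable[OF pi[OF d(1)]] by (intro nn_integral_liminf) auto
  also have "\<dots> \<le> liminf (\<lambda>n::nat. ennreal (M + integral {b..e} p))"
  proof (rule Liminf_mono, intro always_eventually allI)
    fix n
    have "(\<integral>\<^sup>+x. ennreal (indicat_real {d n..e} x * p x) \<partial>lebesgue) = ennreal (LINT x|lebesgue. indicat_real {d n..e} x * p x)"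
      using d(1)[of n] nonneg by (intro nn_integral_eq_integral pi always_eventually) (auto simp: indicator_def)
    also have "(LINT x|lebesgue. indicat_real {d n..e} x * p x) = integral {d n..e} p"
      using set_lebesgue_integral_eq_integral(2)[OF int[OF d(1)]] by (simp add: set_lebesgue_integral_def)
    also have "\<dots> = integral {d n..b} p + integral {b..e} p"
      using d[of n] be by (intro Henstock_Kurzweil_Integration.integral_combine[symmetric] set_lebesgue_integral_eq_integral(1) int) auto
    also have "ennreal \<dots> \<le> ennreal (M + integral {b..e} p)"
      using neg d[of n] by (intro ennreal_leI) force
    finally show "(\<integral>\<^sup>+x. ennreal (indicat_real {d n..e} x * p x) \<partial>lebesgue) \<le> ennreal (M + integral {b..e} p)" .
  qed
  finally show False using div by (simp add: Liminf_const top_unique)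
qed

lemma Linf_one_minus: "m \<in> Linf \<Longrightarrow> (\<lambda>x. 1 - m x) \<in> Linf"
  using Linf_add[OF Linf_const[of 1] Linf_mult[OF Linf_const[of "-1"]]] by simp

lemma mulop_one_minus:
  assumes "m \<in> Linf" shows "mulop (\<lambda>x. 1 - m x) \<phi> = \<phi> - mulop m \<phi>"
proof (rule L2_eqI)
  have m': "(\<lambda>x. 1 - m x) \<in> Linf"
    by (rule Linf_one_minus[OF assms])
  show "AE x in lebesgue. rep_L2 (mulop (\<lambda>x. 1 - m x) \<phi>) x = rep_L2 (\<phi> - mulop m \<phi>) x"
    using rep_mulop[OF m', of \<phi>] rep_mulop[OF assms, of \<phi>] rep_diff[of \<phi> "mulop m \<phi>"]
    by eventually_elim (simp add: left_diff_distrib)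
qed

text \<open>Operators are relations here; their linearity has to be read off from the adjoint, which
  is always a subspace.\<close>

lemma self_adjoint_diff:
  assumes "self_adjoint_op H" "(u, v) \<in> H" "(u', v') \<in> H" shows "(u - u', v - v') \<in> H"
proof -
  have H: "adjoint_op H = H" using assms(1) by (simp add: self_adjoint_op_def)
  have right: "cinner_L2 w (\<phi> - \<psi>) = cinner_L2 w \<phi> - cinner_L2 w \<psi>" for w \<phi> \<psi>
    by (metis cinner_diff_left cinner_commute complex_cnj_diff)
  have "(u, v) \<in> adjoint_op H" "(u', v') \<in> adjoint_op H" using assms H by auto
  then have "(u - u', v - v') \<in> adjoint_op H" unfolding adjoint_op_def by (force simp: right)
  then show ?thesis using H by simp
qed

text \<open>With right-hand side \<open>u + v\<close> the vector \<open>u\<close> is a solution. If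
  \<open>w\<close> is another, positivity applied to the pair \<open>(w - u, u - w)\<close> forces
  it to vanish.\<close>

lemma resolvent_eq:
  assumes H: "self_adjoint_op H" "positive_op H" and uv: "(u, v) \<in> H"
  shows "resolvent H 1 (u + v) = u"
  unfolding resolvent_def
proof (rule the_equality)
  show "(u, u + v - 1 *\<^sub>R u) \<in> H" using uv by simp
  fix w assume "(w, u + v - 1 *\<^sub>R w) \<in> H"
  from self_adjoint_diff[OF H(1) this uv] have "(w - u, u - w) \<in> H" by simp
  then have "0 \<le> cinner_L2 (u - w) (w - u)" using H(2) by (auto simp: positive_op_def)
  then have "0 \<le> inner (u - w) (w - u)" by (simp add: inner_L2_def less_eq_complex_def)
  then have "inner (w - u) (w - u) \<le> 0" by (simp add: inner_simps inner_commute)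
  then have "w - u = 0" by (metis inner_ge_zero inner_eq_zero_iff order_antisym)
  then show "w = u" by simp
qed

lemma Linf_indicator: "A \<in> sets lebesgue \<Longrightarrow> indicator A \<in> Linf"
  unfolding Linf_def by (auto intro!: exI[of _ 1] always_eventually simp: indicator_def)

text \<open>On the support of \<open>k\<close> the factors combine to
  \<open>c k^2 C (1 + s) = C / L^2 * weight p b x\<close>, whose integral is \<open>C / L\<close>.
  The \<epsilon> part is estimated crudely by the bound \<open>K\<close> of \<open>k\<close>, which
  is enough while the cut-off is fixed.\<close>

lemma cutoff_energy_bound:
  assumes c: "c \<in> Linf" and pos: "\<And>x. x0 < x \<Longrightarrow> x \<le> b \<Longrightarrow> 0 < c x"
    and \<delta>: "x0 < \<delta>" "\<delta> < b"
    and p_int: "\<And>\<delta>. x0 < \<delta> \<Longrightarrow> p absolutely_integrable_on {\<delta>..b}" and p: "p = (\<lambda>x. inverse (c x))"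
    and L: "L = integral {\<delta>..b} (weight p b)" "L > 0" "weight p b absolutely_integrable_on {\<delta>..b}"
    and k: "k = (\<lambda>x. if \<delta> < x \<and> x < b then weight p b x / L else 0)" "k \<in> Linf"
      "K \<ge> 0" "AE x in lebesgue. \<bar>k x\<bar> \<le> K"
    and \<epsilon>: "\<epsilon> > 0"
    and u: "AE x in lebesgue. x0 < x \<and> x \<le> b \<longrightarrow> (cmod (rep_L2 u x))\<^sup>2 \<le> C * (1 + integral {x..b} p)"
    and N: "(norm u)\<^sup>2 \<le> N"
  shows "(LINT x|lebesgue. (c x + \<epsilon>) * (k x)\<^sup>2 * (cmod (rep_L2 u x))\<^sup>2) \<le> C / L + \<epsilon> * K\<^sup>2 * N"
proof -
  note a = Linf_add[OF c Linf_const[of \<epsilon>]]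
  have wi: "integrable lebesgue (\<lambda>x. indicat_real {\<delta>..b} x * weight p b x)"
    using L(3) by (simp add: set_integrable_def)
  have "(LINT x|lebesgue. (c x + \<epsilon>) * (k x)\<^sup>2 * (cmod (rep_L2 u x))\<^sup>2) \<le>
     (LINT x|lebesgue. C / L\<^sup>2 * (indicat_real {\<delta>..b} x * weight p b x) + \<epsilon> * K\<^sup>2 * (cmod (rep_L2 u x))\<^sup>2)"
  proof (rule integral_mono_AE)
    show "integrable lebesgue (\<lambda>x. (c x + \<epsilon>) * (k x)\<^sup>2 * (cmod (rep_L2 u x))\<^sup>2)"
      using integrable_mult_norm_sq[OF Linf_mult[OF a Linf_mult[OF k(2) k(2)]], of u]
      by (simp add: power2_eq_square mult.assoc)
    show "integrable lebesgue (\<lambda>x. C / L\<^sup>2 * (indicat_real {\<delta>..b} x * weight p b x) + \<epsilon> * K\<^sup>2 * (cmod (rep_L2 u x))\<^sup>2)"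
      using wi integrable_norm_rep_sq[of u] by (intro Bochner_Integration.integrable_add integrable_mult_right)
    show "AE x in lebesgue. (c x + \<epsilon>) * (k x)\<^sup>2 * (cmod (rep_L2 u x))\<^sup>2 \<le>
       C / L\<^sup>2 * (indicat_real {\<delta>..b} x * weight p b x) + \<epsilon> * K\<^sup>2 * (cmod (rep_L2 u x))\<^sup>2"
      using u k(4)
    proof eventually_elim
      case (elim x)
      define z where "z = (cmod (rep_L2 u x))\<^sup>2"
      have z: "z \<ge> 0" by (simp add: z_def)
      have "(k x)\<^sup>2 \<le> K\<^sup>2" using elim(2) by (rule power2_mono[OF order_trans]) (use k(3) in simp)
      then have 1: "\<epsilon> * (k x)\<^sup>2 * z \<le> \<epsilon> * K\<^sup>2 * z" using \<epsilon> z by (intro mult_right_mono mult_left_mono) auto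
      have 2: "c x * (k x)\<^sup>2 * z \<le> C / L\<^sup>2 * (indicat_real {\<delta>..b} x * weight p b x)"
      proof (cases "\<delta> < x \<and> x < b")
        case True
        define s where "s = tail p b x"
        have cx: "c x > 0" using pos True \<delta> by simp
        have s: "s \<ge> 0" unfolding s_def tail_def using True \<delta> pos
          by (intro integral_nonneg set_lebesgue_integral_eq_integral(1) p_int) (auto simp: p less_imp_le)
        have "z \<le> C * (1 + s)" using elim(1) True \<delta> by (simp add: z_def s_def tail_def)
        then have "c x * (k x)\<^sup>2 * z \<le> c x * (k x)\<^sup>2 * (C * (1 + s))" using cx by (intro mult_left_mono) auto
        also have "\<dots> = C / L\<^sup>2 * weight p b x"
        proof -
          define r where "r = 1 + s"
          have w: "weight p b x = 1 / (c x * r)" and r: "r > 0"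
            using s unfolding weight_def s_def[symmetric] r_def by (simp_all add: p divide_inverse)
          then show ?thesis
            using True cx L(2) unfolding r_def[symmetric] by (simp add: k(1) w field_simps power2_eq_square)
        qed
        finally show ?thesis using True by simp
      next
        case False
        have "k x = 0" using False by (auto simp: k(1))
        \<comment> \<open>Inside \<open>{\<delta>..b}\<close> only the endpoints are left. The sign
          of \<open>C\<close> is read off from the pointwise bound at \<open>x\<close>
          itself.\<close>
        moreover have "indicat_real {\<delta>..b} x * weight p b x \<ge> 0 \<and> C / L\<^sup>2 * (indicat_real {\<delta>..b} x * weight p b x) \<ge> 0"
        proof (cases "x \<in> {\<delta>..b}")
          case True
          have s: "tail p b x \<ge> 0" unfolding tail_def using True \<delta> pos
            by (intro integral_nonneg set_lebesgue_integral_eq_integral(1) p_int) (auto simp: p less_imp_le)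
          have "0 \<le> C * (1 + tail p b x)" using elim(1) True \<delta> by (auto simp: tail_def intro: order_trans[OF zero_le_power2])
          then have "C \<ge> 0" using s by (simp add: zero_le_mult_iff)
          then show ?thesis using True s pos[of x] \<delta> by (auto simp: weight_def p)
        qed simp
        ultimately show ?thesis by simp
      qed
      show ?case using 1 2 by (simp add: z_def[symmetric] distrib_right)
    qed
  qed
  also have "\<dots> = C / L\<^sup>2 * (LINT x|lebesgue. indicat_real {\<delta>..b} x * weight p b x) + \<epsilon> * K\<^sup>2 * (LINT x|lebesgue. (cmod (rep_L2 u x))\<^sup>2)"
    using wi integrable_norm_rep_sq[of u] by (subst Bochner_Integration.integral_add) auto
  also have "(LINT x|lebesgue. indicat_real {\<delta>..b} x * weight p b x) = L"
    using set_lebesgue_integral_eq_integral(2)[OF L(3)] by (simp add: L(1) set_lebesgue_integral_def)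
  also have "C / L\<^sup>2 * L + \<epsilon> * K\<^sup>2 * (LINT x|lebesgue. (cmod (rep_L2 u x))\<^sup>2) \<le> C / L + \<epsilon> * K\<^sup>2 * N"
  proof (rule add_mono)
    show "C / L\<^sup>2 * L \<le> C / L" using L(2) by (simp add: power2_eq_square)
    show "\<epsilon> * K\<^sup>2 * (LINT x|lebesgue. (cmod (rep_L2 u x))\<^sup>2) \<le> \<epsilon> * K\<^sup>2 * N"
      using N \<epsilon> unfolding norm_L2_rep by (intro mult_left_mono) auto
  qed
  finally show ?thesis .
qed

text \<open>Three limits in a fixed order: \<epsilon> to 0 with the cut-off fixed, since the bound
  \<open>K\<close> of its slope depends on it; then \<open>L\<close> to infinity; then
  \<open>\<tau>\<close> to 0. The constants \<open>A\<close>, \<open>N\<close> and \<open>C\<close>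
  depend on none of these parameters.\<close>

lemma viscosity_operator_local:
  assumes c: "c \<in> Linf" and \<alpha>: "\<alpha> > 0"
    and c0: "AE x in lebesgue. 0 \<le> c x"
    and pos: "\<forall>x\<in>{x0<..x0 + \<alpha>}. 0 < c x"
    and bdd: "\<forall>\<epsilon>\<in>{0<..<\<alpha>}. bounded ((\<lambda>x. inverse (c x)) ` {x0 + \<epsilon><..x0 + \<alpha>})"
    and div: "(\<integral>\<^sup>+x\<in>{x0<..x0 + \<alpha>}. ennreal (inverse (c x)) \<partial>lebesgue) = \<infinity>"
    and H: "is_viscosity_operator c H0" and uv: "(u, v) \<in> H0"
  shows "0 \<le> inner v (mulop (indicator {x0<..}) u)"
    "inner v (mulop (indicator {x0<..}) u) \<le> inner v u"
proof -
  define e where "e = x0 + \<alpha>"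
  \<comment> \<open>The midpoint leaves the interval \<open>{b..e}\<close>, on which the norm of the
    solution yields the starting value of the pointwise bound.\<close>
  define b where "b = x0 + \<alpha> / 2"
  define p where "p x = inverse (c x)" for x
  have be: "x0 < b" "b < e" using \<alpha> by (auto simp: b_def e_def)
  have pos': "0 < c x" if "x0 < x" "x \<le> e" for x using pos that by (simp add: e_def)
  have p0: "0 \<le> p x" if "x0 < x" "x \<le> e" for x using pos'[OF that] by (simp add: p_def)
  have pb: "\<exists>K. \<forall>x\<in>{\<delta>..e}. p x \<le> K" if "x0 < \<delta>" for \<delta>
  proof -
    \<comment> \<open>\<open>bdd\<close> excludes the left endpoint and admits only parameters below
      \<open>\<alpha>\<close>; half of the minimum reaches strictly to the left of
      \<open>\<delta>\<close> in either case.\<close>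
    have "min (\<delta> - x0) \<alpha> / 2 \<in> {0<..<\<alpha>}" using that \<alpha> by auto
    from bspec[OF bdd this] obtain K where "\<And>x. x \<in> {x0 + min (\<delta> - x0) \<alpha> / 2<..e} \<Longrightarrow> \<bar>p x\<bar> \<le> K"
      unfolding bounded_iff p_def e_def real_norm_def by blast
    moreover have "x0 + min (\<delta> - x0) \<alpha> / 2 < \<delta>" using that \<alpha> by (auto simp: min_def field_simps)
    ultimately have "p x \<le> K" if "x \<in> {\<delta>..e}" for x using that abs_le_D1[of "p x" K] by simp
    then show ?thesis by blast
  qed
  have cm[measurable]: "c \<in> borel_measurable lebesgue" by (rule Linf_measurable[OF c])
  have pm: "p \<in> borel_measurable lebesgue" unfolding p_def[abs_def] by measurable
  have p_int: "p absolutely_integrable_on {\<delta>..e}" if "x0 < \<delta>" for \<delta>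
  proof -
    obtain K where K: "\<And>x. x \<in> {\<delta>..e} \<Longrightarrow> p x \<le> K" using pb[OF \<open>x0 < \<delta>\<close>] by blast
    show ?thesis
      by (rule measurable_bounded_by_integrable_imp_absolutely_integrable[where g = "\<lambda>x. K"])
        (use K p0 that measurable_restrict_space1[OF pm] in auto)
  qed
  have p_int_b: "p absolutely_integrable_on {\<delta>..b}" if "x0 < \<delta>" for \<delta>
    by (rule absolutely_integrable_on_subinterval[OF p_int[OF that]]) (use be in auto)
  have p_div: "\<exists>\<delta>\<in>{x0<..<b}. M \<le> integral {\<delta>..b} p" for M
    by (rule integral_diverges_at_left[OF p_int p0 be]) (use div in \<open>auto simp: p_def e_def\<close>)
  have p0b: "0 \<le> p x" if "x0 < x" "x \<le> b" for x using p0 that be by simp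
  have pbb: "\<exists>K. \<forall>x\<in>{\<delta>..b}. p x \<le> K" if "x0 < \<delta>" for \<delta> using pb[OF that] be by fastforce
  have w_int: "weight p b absolutely_integrable_on {\<delta>..b}" if "x0 < \<delta>" for \<delta>
    by (rule weight_integrable[of x0]) (fact be(1) p_int_b p0b pbb p_div that)+
  have w_div: "\<exists>\<delta>\<in>{x0<..<b}. M \<le> integral {\<delta>..b} (weight p b)" for M
    by (rule weight_divergent) (fact be(1) p_int_b p0b pbb p_div)+

  \<comment> \<open>Convergence of the approximating solutions\<close>
  have sa: "self_adjoint_op H0" "positive_op H0" using H by (auto simp: is_viscosity_operator_def)
  define U where "U \<epsilon> = resolvent (viscosity_approx c \<epsilon>) 1 (u + v)" for \<epsilon>
  define V where "V \<epsilon> = u + v - U \<epsilon>" for \<epsilon>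
  have U: "(U \<longlongrightarrow> u) (at_right 0)"
  proof -
    have "((\<lambda>\<epsilon>. resolvent (viscosity_approx c \<epsilon>) 1 (u + v)) \<longlongrightarrow> resolvent H0 1 (u + v)) (at_right 0)"
      using H zero_less_one unfolding is_viscosity_operator_def strong_resolvent_limit_def by blast
    then show ?thesis by (simp add: U_def[abs_def] resolvent_eq[OF sa uv])
  qed
  have V: "(V \<longlongrightarrow> v) (at_right 0)"
  proof -
    have "((\<lambda>\<epsilon>. u + v - U \<epsilon>) \<longlongrightarrow> u + v - u) (at_right 0)" by (intro tendsto_intros U)
    then show ?thesis by (simp add: V_def[abs_def])
  qed
  \<comment> \<open>The summand 1, here and in \<open>N\<close>, turns convergence into strict
    bounds that hold for all small \<epsilon>.\<close>
  define A where "A = inner v u + 1"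
  define N where "N = (norm u)\<^sup>2 + 1"
  define C where "C = (sqrt (N / (e - b) + 1) + (A + 1 + integral {b..e} p) / 2)\<^sup>2"
  have evA: "\<forall>\<^sub>F \<epsilon> in at_right 0. inner (V \<epsilon>) (U \<epsilon>) < A"
    by (rule order_tendstoD(2)[OF tendsto_inner[OF V U]]) (simp add: A_def)
  have evN: "\<forall>\<^sub>F \<epsilon> in at_right 0. (norm (U \<epsilon>))\<^sup>2 < N"
    by (rule order_tendstoD(2)[OF tendsto_power[OF tendsto_norm[OF U]]]) (simp add: N_def)
  have ev0: "\<forall>\<^sub>F \<epsilon> in at_right 0. (0::real) < \<epsilon>" by (rule eventually_at_right_less)

  \<comment> \<open>\<open>h\<close> is separate from \<open>k\<close> so that the bound covers both
    \<open>m\<close> with slope \<open>k\<close> and \<open>1 - m\<close> with slope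
    \<open>- k\<close>; only the square of the slope enters the error.\<close>
  have bound: "- (\<tau> * A + C / L / \<tau>) / 2 \<le> inner v (mulop m u)"
    if \<tau>: "\<tau> > 0" and \<delta>: "x0 < \<delta>" "\<delta> < b" and L: "L = integral {\<delta>..b} (weight p b)" "L > 0"
      and k: "k = (\<lambda>x. if \<delta> < x \<and> x < b then weight p b x / L else 0)" "k \<in> Linf"
      and m: "m \<in> Linf" "h \<in> Linf" "\<And>x. 0 \<le> m x" "primitive (\<lambda>x. of_real (m x)) (\<lambda>x. of_real (h x))"
      and h: "\<And>x. (h x)\<^sup>2 = (k x)\<^sup>2"
    for \<tau> \<delta> L k m h
  proof -
    obtain K where K: "K > 0" "AE x in lebesgue. \<bar>k x\<bar> \<le> K" using Linf_bound[OF k(2)] by metis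
    have le: "\<forall>\<^sub>F \<epsilon> in at_right 0. - (\<tau> * A + (C / L + \<epsilon> * K\<^sup>2 * N) / \<tau>) / 2 \<le> inner (V \<epsilon>) (mulop m (U \<epsilon>))"
      using evA evN ev0
    proof eventually_elim
      case (elim \<epsilon>)
      let ?a = "\<lambda>x. c x + \<epsilon>"
      have a: "?a \<in> Linf" by (intro Linf_add c Linf_const)
      have a0: "AE x in lebesgue. 0 \<le> ?a x" using c0 by eventually_elim (use elim in simp)
      note Ue = resolvent_viscosity_approx[OF c c0 elim(3), where f = "u + v", folded U_def V_def]
      have en: "inner (V \<epsilon>) (U \<epsilon>) = (LINT x|lebesgue. ?a x * (cmod (rep_L2 (weak_deriv (U \<epsilon>)) x))\<^sup>2)"
        using Ue(2)[OF Ue(1)] dirichlet_form_self[of ?a "U \<epsilon>"] unfolding inner_L2_def by (metis Re_complex_of_real)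
      have pw: "AE x in lebesgue. x0 < x \<and> x \<le> b \<longrightarrow> (cmod (rep_L2 (U \<epsilon>) x))\<^sup>2 \<le> C * (1 + integral {x..b} p)"
        unfolding C_def p_def[abs_def]
        by (rule W12_pointwise_bound[OF weak_derivative_weak_deriv[OF Ue(1)] a _ a0 _ be])
          (use pos' p_int elim en in \<open>auto simp: p_def[abs_def] less_imp_le\<close>)
      have I: "(LINT x|lebesgue. ?a x * (h x)\<^sup>2 * (cmod (rep_L2 (U \<epsilon>) x))\<^sup>2) \<le> C / L + \<epsilon> * K\<^sup>2 * N"
        unfolding h
        by (rule cutoff_energy_bound[OF c _ \<delta> _ _ L w_int[OF \<delta>(1)] k _ K(2) elim(3) pw])
          (use pos' be K elim p_int_b in \<open>auto simp: p_def[abs_def]\<close>)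
      have "- (\<tau> * inner (V \<epsilon>) (U \<epsilon>) + (LINT x|lebesgue. ?a x * (h x)\<^sup>2 * (cmod (rep_L2 (U \<epsilon>) x))\<^sup>2) / \<tau>) / 2
         \<le> inner (V \<epsilon>) (mulop m (U \<epsilon>))"
        by (rule form_cutoff_lower_bound[OF a a0 Ue m(1,2,4,3) \<tau>])
      moreover have "\<tau> * inner (V \<epsilon>) (U \<epsilon>) \<le> \<tau> * A" using elim \<tau> by simp
      moreover have "(LINT x|lebesgue. ?a x * (h x)\<^sup>2 * (cmod (rep_L2 (U \<epsilon>) x))\<^sup>2) / \<tau> \<le> (C / L + \<epsilon> * K\<^sup>2 * N) / \<tau>"
        using I \<tau> by (intro divide_right_mono) auto
      ultimately show ?case by argo
    qed
    have r: "((\<lambda>\<epsilon>. inner (V \<epsilon>) (mulop m (U \<epsilon>))) \<longlongrightarrow> inner v (mulop m u)) (at_right 0)"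
      by (intro tendsto_inner V bounded_linear.tendsto[OF bounded_linear_mulop] m U)
    have l: "((\<lambda>\<epsilon>. - (\<tau> * A + (C / L + \<epsilon> * K\<^sup>2 * N) / \<tau>) / 2) \<longlongrightarrow> - (\<tau> * A + (C / L + 0 * K\<^sup>2 * N) / \<tau>) / 2) (at_right 0)"
      using \<tau> by (intro tendsto_intros) auto
    have "- (\<tau> * A + (C / L + 0 * K\<^sup>2 * N) / \<tau>) / 2 \<le> inner v (mulop m u)"
      by (rule tendsto_le[OF _ r l le]) simp
    then show ?thesis by simp
  qed

  \<comment> \<open>A sequence of cut-offs with unbounded normalisation\<close>
  define good :: "nat \<Rightarrow> (real \<Rightarrow> real) \<Rightarrow> real \<Rightarrow> bool" where "good n m L \<longleftrightarrow> m \<in> Linf \<and> L \<ge> real (Suc n) \<and> (\<forall>x. 0 \<le> m x \<and> m x \<le> 1) \<and> (\<forall>x\<le>x0. m x = 0) \<and> (\<forall>x\<ge>b. m x = 1) \<and>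
    (\<forall>x. x0 < x \<longrightarrow> x < b \<longrightarrow> 1 - m x \<le> integral {x..b} (weight p b) / L) \<and>
    (\<forall>\<tau>>0. - (\<tau> * A + C / L / \<tau>) / 2 \<le> inner v (mulop m u) \<and>
       inner v (mulop m u) \<le> inner v u + (\<tau> * A + C / L / \<tau>) / 2)" for n m L
  have "\<exists>m L. good n m L" for n
  proof -
    obtain \<delta> where \<delta>: "x0 < \<delta>" "\<delta> < b" "real (Suc n) \<le> integral {\<delta>..b} (weight p b)"
      using w_div[of "real (Suc n)"] by auto
    define L where "L = integral {\<delta>..b} (weight p b)"
    have L: "L > 0" using \<delta>(3) by (simp add: L_def)
    define k where "k = (\<lambda>x. if \<delta> < x \<and> x < b then weight p b x / L else 0)"
    have "\<exists>m. k \<in> Linf \<and> m \<in> Linf \<and> primitive (\<lambda>x. of_real (m x)) (\<lambda>x. of_real (k x)) \<and>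
        (\<forall>x. 0 \<le> m x \<and> m x \<le> 1) \<and> (\<forall>x\<le>x0. m x = 0) \<and> (\<forall>x\<ge>b. m x = 1) \<and>
        (\<forall>x. x0 < x \<longrightarrow> x < b \<longrightarrow> 1 - m x \<le> integral {x..b} (weight p b) / L)"
      unfolding k_def
      by (rule cutoff_exists) (fact be(1) p_int_b p0b pbb p_div \<delta>(1) \<delta>(2) L_def L)+
    then obtain m where m: "k \<in> Linf" "m \<in> Linf" "primitive (\<lambda>x. of_real (m x)) (\<lambda>x. of_real (k x))"
      "\<And>x. 0 \<le> m x \<and> m x \<le> 1" "\<forall>x\<le>x0. m x = 0" "\<forall>x\<ge>b. m x = 1"
      "\<forall>x. x0 < x \<longrightarrow> x < b \<longrightarrow> 1 - m x \<le> integral {x..b} (weight p b) / L"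
      by blast
    have "primitive (\<lambda>x. - 1) (\<lambda>x. 0)" by (simp add: primitive_def locally_integrable_def)
    from primitive_add_const[OF primitive_mult[OF this m(3)], of 1]
    have prim': "primitive (\<lambda>x. of_real (1 - m x)) (\<lambda>x. of_real (- k x))" by simp
    have k': "(\<lambda>x. - k x) \<in> Linf" using Linf_mult[OF Linf_const[of "-1"] m(1)] by simp
    have "- (\<tau> * A + C / L / \<tau>) / 2 \<le> inner v (mulop m u) \<and>
       inner v (mulop m u) \<le> inner v u + (\<tau> * A + C / L / \<tau>) / 2" if \<tau>: "\<tau> > 0" for \<tau>
    proof
      show "- (\<tau> * A + C / L / \<tau>) / 2 \<le> inner v (mulop m u)"
        by (rule bound[OF \<tau> \<delta>(1,2) L_def L k_def m(1,2,1) _ m(3)]) (use m in auto)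
      \<comment> \<open>The lower bound for \<open>1 - m\<close> is the upper bound for
        \<open>m\<close>, because \<open>inner v\<close> of the two pieces adds up to
        \<open>inner v u\<close>.\<close>
      have "- (\<tau> * A + C / L / \<tau>) / 2 \<le> inner v (mulop (\<lambda>x. 1 - m x) u)"
        by (rule bound[OF \<tau> \<delta>(1,2) L_def L k_def m(1) Linf_one_minus[OF m(2)] k' _ prim']) (use m in auto)
      then show "inner v (mulop m u) \<le> inner v u + (\<tau> * A + C / L / \<tau>) / 2"
        unfolding mulop_one_minus[OF m(2)] inner_diff_right by argo
    qed
    then show ?thesis using m \<delta>(3) unfolding L_def[symmetric] good_def by (intro exI[of _ m] exI[of _ L]) blast
  qed
  then obtain m L where mL: "\<And>n. good n (m n) (L n)" by metis
  have m: "\<And>n. m n \<in> Linf" and L: "\<And>n. L n \<ge> real (Suc n)" and m01: "\<And>n x. 0 \<le> m n x" "\<And>n x. m n x \<le> 1"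
    and m_left: "\<And>n x. x \<le> x0 \<Longrightarrow> m n x = 0" and m_right: "\<And>n x. b \<le> x \<Longrightarrow> m n x = 1"
    and m_mid: "\<And>n x. x0 < x \<Longrightarrow> x < b \<Longrightarrow> 1 - m n x \<le> integral {x..b} (weight p b) / L n"
    and m_low: "\<And>n \<tau>. \<tau> > 0 \<Longrightarrow> - (\<tau> * A + C / L n / \<tau>) / 2 \<le> inner v (mulop (m n) u)"
    and m_up: "\<And>n \<tau>. \<tau> > 0 \<Longrightarrow> inner v (mulop (m n) u) \<le> inner v u + (\<tau> * A + C / L n / \<tau>) / 2"
    using mL unfolding good_def by blast+

  \<comment> \<open>Passage to the indicator of the half-line\<close>
  have Linv: "(\<lambda>n. r / L n) \<longlonglongrightarrow> 0" for r
  proof -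
    have "(\<lambda>n. inverse (L n)) \<longlonglongrightarrow> 0"
    proof (rule tendsto_sandwich[OF _ _ tendsto_const LIMSEQ_inverse_real_of_nat])
      show "\<forall>\<^sub>F n in sequentially. 0 \<le> inverse (L n)" using order_trans[OF of_nat_0_le_iff L] by (intro always_eventually) simp
      show "\<forall>\<^sub>F n in sequentially. inverse (L n) \<le> inverse (real (Suc n))"
        using L by (intro always_eventually allI le_imp_inverse_le) auto
    qed
    from tendsto_mult_right_zero[OF this, of r] show ?thesis by (simp add: divide_inverse)
  qed
  define Q where "Q = indicat_real {x0<..}"
  have QL: "Q \<in> Linf" unfolding Q_def by (rule Linf_indicator) simp
  have m_lim: "(\<lambda>n. m n x) \<longlonglongrightarrow> Q x" for x
  proof -
    consider "x \<le> x0" | "b \<le> x" | "x0 < x" "x < b" by linarith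
    then show ?thesis
    proof cases
      case 3
      have lim1: "(\<lambda>n. 1 - integral {x..b} (weight p b) / L n) \<longlonglongrightarrow> 1 - 0" by (intro tendsto_intros Linv)
      have "(\<lambda>n. m n x) \<longlonglongrightarrow> 1"
      proof (rule tendsto_sandwich)
        show "(\<lambda>n. 1 - integral {x..b} (weight p b) / L n) \<longlonglongrightarrow> 1"
          using lim1 by simp
        show "\<forall>\<^sub>F n in sequentially. 1 - integral {x..b} (weight p b) / L n \<le> m n x"
        proof (intro always_eventually allI)
          show "1 - integral {x..b} (weight p b) / L n \<le> m n x" for n using m_mid[OF 3, of n] by linarith
        qed
        show "\<forall>\<^sub>F n in sequentially. m n x \<le> 1" by (intro always_eventually allI m01)
      qed (rule tendsto_const)
      then show ?thesis using 3 by (simp add: Q_def)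
    qed (use be in \<open>auto simp: m_left m_right Q_def\<close>)
  qed
  have lim: "(\<lambda>n. inner v (mulop (m n) u)) \<longlonglongrightarrow> inner v (mulop Q u)"
    unfolding inner_mulop_commute[OF m, symmetric] inner_mulop_commute[OF QL, symmetric] inner_mulop(1)[OF m] inner_mulop(1)[OF QL]
  proof (rule integral_dominated_convergence)
    let ?g = "\<lambda>x. Re (rep_L2 v x * cnj (rep_L2 u x))"
    show "integrable lebesgue (\<lambda>x. \<bar>?g x\<bar>)" by (intro integrable_abs integrable_Re integrable_rep_cnj)
    show "(\<lambda>x. Q x * ?g x) \<in> borel_measurable lebesgue" "(\<lambda>x. m n x * ?g x) \<in> borel_measurable lebesgue" for n
      by (intro borel_measurable_integrable inner_mulop(2) QL m)+
    show "AE x in lebesgue. (\<lambda>n. m n x * ?g x) \<longlonglongrightarrow> Q x * ?g x"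
      by (intro always_eventually allI tendsto_intros m_lim)
    show "AE x in lebesgue. norm (m n x * ?g x) \<le> \<bar>?g x\<bar>" for n
      by (intro always_eventually allI) (use m01 in \<open>simp add: abs_mult mult_left_le_one_le\<close>)
  qed
  have lim0: "(\<lambda>n. (\<tau> * A + C / L n / \<tau>) / 2) \<longlonglongrightarrow> \<tau> * A / 2" if "\<tau> > 0" for \<tau>
  proof -
    have "(\<lambda>n. (\<tau> * A + C / L n / \<tau>) / 2) \<longlonglongrightarrow> (\<tau> * A + 0 / \<tau>) / 2" using that by (intro tendsto_intros Linv) auto
    then show ?thesis by simp
  qed
  have low: "- (\<tau> * A / 2) \<le> inner v (mulop Q u)" if "\<tau> > 0" for \<tau>
    by (rule LIMSEQ_le[OF tendsto_minus[OF lim0[OF that]] lim]) (use m_low[OF that] in \<open>simp only: minus_divide_left, blast\<close>)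
  have up: "inner v (mulop Q u) \<le> inner v u + \<tau> * A / 2" if "\<tau> > 0" for \<tau>
    by (rule LIMSEQ_le[OF lim tendsto_add[OF tendsto_const lim0[OF that]]]) (use m_up[OF that] in blast)
  have t0: "((\<lambda>\<tau>. \<tau> * A / 2) \<longlongrightarrow> 0 * A / 2) (at_right 0)" by (intro tendsto_intros) auto
  have ev: "\<forall>\<^sub>F \<tau> in at_right 0. - (\<tau> * A / 2) \<le> inner v (mulop Q u)"
    "\<forall>\<^sub>F \<tau> in at_right 0. inner v (mulop Q u) \<le> inner v u + \<tau> * A / 2"
    using ev0 low up by (auto elim: eventually_mono)
  have "- (0 * A / 2) \<le> inner v (mulop Q u)"
    by (rule tendsto_upperbound[OF tendsto_minus[OF t0] ev(1)]) simp
  then show "0 \<le> inner v (mulop (indicator {x0<..}) u)" by (simp add: Q_def)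
  have "inner v (mulop Q u) \<le> inner v u + 0 * A / 2"
    by (rule tendsto_lowerbound[OF tendsto_add[OF tendsto_const t0] ev(2)]) simp
  then show "inner v (mulop (indicator {x0<..}) u) \<le> inner v u" by (simp add: Q_def)
qed

subsection \<open>Invariance\<close>

lemma mulop_eq_zero_iff:
  assumes "m \<in> Linf" shows "mulop m \<phi> = 0 \<longleftrightarrow> (AE x in lebesgue. m x = 0 \<or> rep_L2 \<phi> x = 0)"
proof
  assume "mulop m \<phi> = 0"
  then have "AE x in lebesgue. rep_L2 (mulop m \<phi>) x = 0" using rep_zero by simp
  then show "AE x in lebesgue. m x = 0 \<or> rep_L2 \<phi> x = 0"
    using rep_mulop[OF assms, of \<phi>] by eventually_elim auto
next
  assume *: "AE x in lebesgue. m x = 0 \<or> rep_L2 \<phi> x = 0"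
  show "mulop m \<phi> = 0"
    by (rule L2_eqI) (use * rep_mulop[OF assms, of \<phi>] rep_zero in eventually_elim, auto)
qed

text \<open>The complement is required only up to a null set, so the open half-line to the right of
  \<open>x0\<close> can serve for \<open>{..<x0}\<close>.\<close>

lemma L2_on_iff_mulop:
  assumes "A \<in> sets lebesgue" "AE x in lebesgue. x \<in> A \<longleftrightarrow> x \<notin> I"
  shows "\<phi> \<in> L2_on I \<longleftrightarrow> mulop (indicator A) \<phi> = 0"
proof -
  have "(AE x in lebesgue. indicat_real A x = 0 \<or> rep_L2 \<phi> x = 0) \<longleftrightarrow> (AE x in lebesgue. x \<notin> I \<longrightarrow> rep_L2 \<phi> x = 0)"
    by (rule eventually_cong[OF assms(2)]) (auto simp: indicator_def)
  then show ?thesis by (simp add: L2_on_def mulop_eq_zero_iff[OF Linf_indicator[OF assms(1)]])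
qed

text \<open>Multiplication by an indicator is an orthogonal projection; this turns the localised
  inequality into the dissipativity condition of the norm estimate.\<close>

lemma inner_mulop_indicator:
  assumes "A \<in> sets lebesgue"
  shows "inner (mulop (indicator A) v) (mulop (indicator A) u) = inner v (mulop (indicator A) u)"
proof -
  have "(\<lambda>x. indicat_real A x * indicator A x) = indicator A" by (auto simp: indicator_def)
  then show ?thesis
    using Linf_indicator[OF assms] by (simp add: inner_mulop_commute mulop_mulop)
qed

lemma exp_semigroup_invariant:
  assumes S: "exp_semigroup H S" "closure (Domain H) = UNIV" and A: "A \<in> sets lebesgue" "AE x in lebesgue. x \<in> A \<longleftrightarrow> x \<notin> I"
    and pos: "\<And>u v. (u, v) \<in> H \<Longrightarrow> 0 \<le> inner v (mulop (indicator A) u)" and t: "t > 0"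
  shows "S t ` L2_on I \<subseteq> L2_on I"
proof
  fix \<psi> assume "\<psi> \<in> S t ` L2_on I"
  then obtain \<phi> where \<phi>: "\<phi> \<in> L2_on I" "\<psi> = S t \<phi>" by auto
  have "norm (mulop (indicator A) (S t \<phi>)) \<le> norm (mulop (indicator A) \<phi>)"
    by (rule exp_semigroup_norm_le[OF S bounded_linear_mulop[OF Linf_indicator[OF A(1)]] _ t])
      (simp add: inner_mulop_indicator[OF A(1)] pos)
  then show "\<psi> \<in> L2_on I" using \<phi> by (simp add: L2_on_iff_mulop[OF A])
qed

text \<open>The indicator of \<open>[x0 - 1, x0]\<close> is nonnegative and nonzero, yet its image
  vanishes almost everywhere on \<open>[x0, x0 + 1]\<close>, a set of positive measure.\<close>

lemma not_positivity_improving: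
  assumes "T ` L2_on {..<x0} \<subseteq> L2_on {..<x0}" shows "\<not> positivity_improving T"
proof
  assume T: "positivity_improving T"
  have nn: "\<not> (AE x in lebesgue. x \<notin> {a..a+1::real})" for a
  proof
    assume "AE x in lebesgue. x \<notin> {a..a+1}"
    then have "{a..a+1} \<in> null_sets lebesgue" by (subst (asm) AE_iff_null_sets[symmetric]) auto
    then show False by (simp add: null_sets_def emeasure_lborel_Icc_eq)
  qed
  have ne: "AE x in lebesgue. x \<noteq> x0" by (intro AE_completion AE_lborel_singleton)
  define \<phi> where "\<phi> = abs_L2 (\<lambda>x. complex_of_real (indicator {x0-1..x0} x))"
  have eq: "(\<lambda>x. (cmod (complex_of_real (indicator {x0-1..x0} x)))\<^sup>2) = indicat_real {x0-1..x0}"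
    by (auto simp: indicator_def fun_eq_iff)
  have "square_integrable (\<lambda>x. complex_of_real (indicator {x0-1..x0} x))"
    unfolding square_integrable_def eq
  proof
    have "indicat_real {x0-1..x0} \<in> borel_measurable lebesgue" by (rule borel_measurable_indicator) simp
    then show "(\<lambda>x. complex_of_real (indicator {x0-1..x0} x)) \<in> borel_measurable lebesgue"
      by (rule measurable_compose) (intro borel_measurable_continuous_onI continuous_intros)
  qed (simp add: emeasure_lborel_Icc_eq)
  then have rep: "AE x in lebesgue. rep_L2 \<phi> x = of_real (indicator {x0-1..x0} x)"
    unfolding \<phi>_def by (rule rep_abs_L2)
  have "AE x in lebesgue. 0 \<le> rep_L2 \<phi> x" using rep by eventually_elim (simp add: indicator_def less_eq_complex_def)
  moreover have "\<phi> \<noteq> 0"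
  proof
    assume "\<phi> = 0"
    then have "AE x in lebesgue. x \<notin> {x0-1..x0-1+1}"
      using rep rep_zero by (simp, eventually_elim) (auto simp: indicator_def split: if_splits)
    then show False using nn by blast
  qed
  ultimately have "AE x in lebesgue. 0 < rep_L2 (T \<phi>) x" using T by (simp add: positivity_improving_def)
  moreover have "\<phi> \<in> L2_on {..<x0}"
    unfolding L2_on_def mem_Collect_eq using rep ne by eventually_elim (auto simp: indicator_def)
  then have "T \<phi> \<in> L2_on {..<x0}" using assms by blast
  then have "AE x in lebesgue. x \<notin> {..<x0} \<longrightarrow> rep_L2 (T \<phi>) x = 0" by (simp add: L2_on_def)
  ultimately have "AE x in lebesgue. x \<notin> {x0..x0+1}" by eventually_elim auto
  then show False using nn by blast
qed

theorem proposition6p5: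
  fixes x0 \<alpha> :: real and c :: "real \<Rightarrow> real" and S :: "real \<Rightarrow> L2 \<Rightarrow> L2"
  assumes "c \<in> Linf" and "\<alpha> > 0"
    and "AE x in lebesgue. 0 \<le> c x"
    and "\<forall>x\<in>{x0<..x0 + \<alpha>}. 0 < c x"
    and "\<forall>\<epsilon>\<in>{0<..<\<alpha>}. bounded ((\<lambda>x. inverse (c x)) ` {x0 + \<epsilon><..x0 + \<alpha>})"
    and "(\<integral>\<^sup>+x\<in>{x0<..x0 + \<alpha>}. ennreal (inverse (c x)) \<partial>lebesgue) = \<infinity>"
    and "is_viscosity_semigroup c S"
  shows "(\<forall>t>0. S t ` L2_on {..<x0} \<subseteq> L2_on {..<x0} \<and> S t ` L2_on {x0<..} \<subseteq> L2_on {x0<..}) \<and>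
         (\<forall>t>0. \<not> positivity_improving (S t))"
proof -
  obtain H0 where H0: "is_viscosity_operator c H0" and S: "exp_semigroup H0 S"
    using assms(7) by (auto simp: is_viscosity_semigroup_def)
  have dense: "closure (Domain H0) = UNIV"
    using H0 by (simp add: is_viscosity_operator_def self_adjoint_op_def)
  note loc = viscosity_operator_local[OF assms(1-6) H0]
  have ind: "indicat_real {..x0} = (\<lambda>x. 1 - indicator {x0<..} x)" by (auto simp: indicator_def)
  have "AE x in lebesgue. x \<noteq> x0" by (intro AE_completion AE_lborel_singleton)
  then have "AE x in lebesgue. x \<in> {x0<..} \<longleftrightarrow> x \<notin> {..<x0}" by eventually_elim auto
  then have ae: "AE x in lebesgue. x \<in> {x0<..} \<longleftrightarrow> x \<notin> {..<x0}" .
  have 1: "S t ` L2_on {..<x0} \<subseteq> L2_on {..<x0}" if "t > 0" for t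
    by (rule exp_semigroup_invariant[OF S dense _ ae _ that]) (simp, rule loc(1))
  \<comment> \<open>The upper half of the key inequality is the lower half for the complementary
    projection.\<close>
  have right: "0 \<le> inner v (mulop (indicator {..x0}) u)" if "(u, v) \<in> H0" for u v
    using loc(2)[OF that] by (simp add: ind mulop_one_minus Linf_indicator inner_diff_right)
  have ae': "AE x in lebesgue. x \<in> {..x0} \<longleftrightarrow> x \<notin> {x0<..}" by (simp add: not_less)
  have 2: "S t ` L2_on {x0<..} \<subseteq> L2_on {x0<..}" if "t > 0" for t
    by (rule exp_semigroup_invariant[OF S dense _ ae' _ that]) (simp, rule right)
  show ?thesis
    using 1 2 not_positivity_improving[OF 1] by simp
qed

end
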